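(* For the irreducible crystallographic root systems, with the Bourbaki normalization of the roots and of the form $B$, and with parameters $k_s$ and $k_l$ for the short and long roots respectively (a single parameter $k$ in the simply laced case), the degree zero component $(\nu'(\Omega'_W))_0$ is: Type $A_n$: $\frac{k^2}{32}(n+1)n(n-1)$; Type $B_n$: $\frac18k_l\,n(n-1)\big((n-2)k_l+k_s\big)$; Type $C_n$: $\frac18k_s\,n(n-1)\big((n-2)k_s+2k_l\big)$; Type $D_n$: $\frac{k^2}8n(n-1)(n-2)$; Type $E_6$: $\frac{45}2k^2$; Type $E_7$: $63k^2$; Type $E_8$: $210k^2$; Type $F_4$: $\frac32(k_s+2k_l)(k_s+k_l)$; Type $G_2$: $\frac3{16}(k_s+3k_l)(k_s+k_l)$.
   Context: $(V_0^*,\Phi,V_0,\Phi^\vee)$ is a real root system with coroots $\alpha^\vee\in V_0$, reflections $s_\alpha(v)=v-\alpha(v)\alpha^\vee$, finite Weyl group $W$, and $B$ a positive-definite $W$-invariant symmetric bilinear form on $V_0$, extended complex-bilinearly to $V=\mathbb C\otimes_{\mathbb R}V_0$; $B$ also denotes the dual form on $V^*$. Fix positive roots; $\alpha>0$ means $\alpha$ is positive. Bourbaki normalization: $B(\alpha,\alpha)=2$ for all roots in types $A,D,E$; in type $B_n$ short roots have $B(\alpha,\alpha)=1$ and long roots $2$; in type $C_n$ short $2$, long $4$; in type $F_4$ short $1$, long $2$; in type $G_2$ short $2$, long $6$. The parameter function $\alpha\mapsto k_\alpha\in\mathbb C$ is $W$-invariant. $\mathcal W=\mathcal W(V\oplus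 V^*,\omega)$ is the Weyl algebra: the quotient of the tensor algebra of $V\oplus V^*$ by $vw-wv=\omega(v,w)$, where $V,V^*$ are isotropic and $\omega(\lambda,v)=\lambda(v)$ for $\lambda\in V^*,v\in V$. $\nu':\mathfrak{so}(V,B)\to\mathcal W$ is $\nu'(f)=\sum_if(v_i)v_i^*$ ($\{v_i\}$ a basis of $V$, $\{v_i^*\}$ the dual basis of $V^*$). Set $$\nu'(\Omega'_W)=\frac1{16}\sum_{\alpha,\beta>0}k_\alpha k_\beta\frac1{B(\alpha^\vee,\beta^\vee)}\nu'([s_\alpha,s_\beta])^2\in\mathcal W,$$ where $[s_\alpha,s_\beta]=s_\alpha s_\beta-s_\beta s_\alpha$ is regarded in $\mathfrak{so}(V,B)$ and pairs with $B(\alpha^\vee,\beta^\vee)=0$ (for which $[s_\alpha,s_\beta]=0$) contribute $0$. $\eta:\mathcal W\to S(V\oplus V^* )$ is the linear isomorphism inverse to the symmetrization map $Q(u_1\cdots u_m)=\frac1{m!}\sum_{\sigma\in S_m}u_{\sigma(1)}\cdots u_{\sigma(m)}$, and $(x)_0$ denotes the degree $0$ component of $\eta(x)$. *)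

theory Defs
  imports "HOL-Analysis.Analysis" "HOL-Library.Poly_Mapping" "HOL-Combinatorics.Permutations"
begin

section \<open>Root systems\<close>

text \<open>
  A basis of \<open>V\<^sub>0\<close> is fixed, so that \<open>V\<^sub>0\<close> is \<open>real ^ 'n\<close> and \<open>V\<close> is \<open>complex ^ 'n\<close>; the dual
  spaces are identified with the same coordinate spaces through the dual basis. Thus for
  \<open>l\<close> in \<open>V\<^sub>0\<^sup>*\<close> and \<open>v\<close> in \<open>V\<^sub>0\<close> the value \<open>l(v)\<close> is the dot product \<open>l \<bullet> v\<close>. The dot product is only
  this pairing of \<open>V\<^sub>0\<^sup>*\<close> with \<open>V\<^sub>0\<close>; the invariant form \<open>B\<close> below is a separate and arbitrary object.
  The coroot of a root \<open>a\<close> is \<open>co a\<close>.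
\<close>

definition refl :: "(real^'n \<Rightarrow> real^'n) \<Rightarrow> real^'n \<Rightarrow> real^'n \<Rightarrow> real^'n" where
  "refl co a v = v - (a \<bullet> v) *\<^sub>R co a"

definition dual_refl :: "(real^'n \<Rightarrow> real^'n) \<Rightarrow> real^'n \<Rightarrow> real^'n \<Rightarrow> real^'n" where
  "dual_refl co a l = l - (l \<bullet> co a) *\<^sub>R a"

text \<open>Reduced crystallographic root systems \<open>(V\<^sub>0\<^sup>*, \<Phi>, V\<^sub>0, co ` \<Phi>)\<close>.\<close>

definition root_system :: "(real^'n) set \<Rightarrow> (real^'n \<Rightarrow> real^'n) \<Rightarrow> bool" where
  "root_system \<Phi> co \<longleftrightarrow>
     finite \<Phi> \<and> 0 \<notin> \<Phi> \<and> span \<Phi> = UNIV \<and> inj_on co \<Phi> \<and>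
     (\<forall>a\<in>\<Phi>. a \<bullet> co a = 2) \<and>
     (\<forall>a\<in>\<Phi>. dual_refl co a ` \<Phi> = \<Phi>) \<and>
     (\<forall>a\<in>\<Phi>. refl co a ` (co ` \<Phi>) = co ` \<Phi>) \<and>
     (\<forall>a\<in>\<Phi>. \<forall>b\<in>\<Phi>. a \<bullet> co b \<in> \<int>) \<and>
     (\<forall>a\<in>\<Phi>. \<forall>c. c *\<^sub>R a \<in> \<Phi> \<longrightarrow> c = 1 \<or> c = -1)"

text \<open>
  The Weyl group as a group of transformations of \<open>V\<^sub>0\<close> and, contragrediently, of \<open>V\<^sub>0\<^sup>*\<close>.
  Reflections are involutions, so closure under composition suffices.
\<close>

inductive_set weyl_group :: "(real^'n) set \<Rightarrow> (real^'n \<Rightarrow> real^'n) \<Rightarrow> (real^'n \<Rightarrow> real^'n) set"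
  for \<Phi> co where
  weyl_group_id: "id \<in> weyl_group \<Phi> co"
| weyl_group_refl: "w \<in> weyl_group \<Phi> co \<Longrightarrow> a \<in> \<Phi> \<Longrightarrow> refl co a \<circ> w \<in> weyl_group \<Phi> co"

inductive_set dual_weyl_group :: "(real^'n) set \<Rightarrow> (real^'n \<Rightarrow> real^'n) \<Rightarrow> (real^'n \<Rightarrow> real^'n) set"
  for \<Phi> co where
  dual_weyl_group_id: "id \<in> dual_weyl_group \<Phi> co"
| dual_weyl_group_refl:
    "w \<in> dual_weyl_group \<Phi> co \<Longrightarrow> a \<in> \<Phi> \<Longrightarrow> dual_refl co a \<circ> w \<in> dual_weyl_group \<Phi> co"

definition invariant_parameter :: "(real^'n) set \<Rightarrow> (real^'n \<Rightarrow> real^'n) \<Rightarrow> (real^'n \<Rightarrow> complex) \<Rightarrow> bool" where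
  "invariant_parameter \<Phi> co k \<longleftrightarrow> (\<forall>w\<in>dual_weyl_group \<Phi> co. \<forall>a\<in>\<Phi>. k (w a) = k a)"

definition positive_system :: "(real^'n) set \<Rightarrow> (real^'n) set \<Rightarrow> bool" where
  "positive_system \<Phi> P \<longleftrightarrow> (\<exists>v. (\<forall>a\<in>\<Phi>. a \<bullet> v \<noteq> 0) \<and> P = {a\<in>\<Phi>. a \<bullet> v > 0})"

definition invariant_form ::
    "(real^'n) set \<Rightarrow> (real^'n \<Rightarrow> real^'n) \<Rightarrow> (real^'n \<Rightarrow> real^'n \<Rightarrow> real) \<Rightarrow> bool" where
  "invariant_form \<Phi> co B \<longleftrightarrow>
     bilinear B \<and> (\<forall>u v. B u v = B v u) \<and> (\<forall>v. v \<noteq> 0 \<longrightarrow> B v v > 0) \<and>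
     (\<forall>w\<in>weyl_group \<Phi> co. \<forall>u v. B (w u) (w v) = B u v)"

text \<open>\<open>riesz B\<close> is the isomorphism of \<open>V\<^sub>0\<^sup>*\<close> with \<open>V\<^sub>0\<close> given by a nondegenerate form \<open>B\<close>.\<close>

definition riesz :: "(real^'n \<Rightarrow> real^'n \<Rightarrow> real) \<Rightarrow> real^'n \<Rightarrow> real^'n" where
  "riesz B l = (THE u. \<forall>v. B u v = l \<bullet> v)"

definition dual_form :: "(real^'n \<Rightarrow> real^'n \<Rightarrow> real) \<Rightarrow> real^'n \<Rightarrow> real^'n \<Rightarrow> real" where
  "dual_form B l m = B (riesz B l) (riesz B m)"

text \<open>In the simply laced types every root is both short and long.\<close>

definition short_roots :: "(real^'n) set \<Rightarrow> (real^'n \<Rightarrow> real^'n \<Rightarrow> real) \<Rightarrow> (real^'n) set" where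
  "short_roots \<Phi> B = {a\<in>\<Phi>. \<forall>b\<in>\<Phi>. dual_form B a a \<le> dual_form B b b}"

definition long_roots :: "(real^'n) set \<Rightarrow> (real^'n \<Rightarrow> real^'n \<Rightarrow> real) \<Rightarrow> (real^'n) set" where
  "long_roots \<Phi> B = {a\<in>\<Phi>. \<forall>b\<in>\<Phi>. dual_form B b b \<le> dual_form B a a}"

section \<open>Irreducible types\<close>

datatype cartan_type =
  Type_A nat | Type_B nat | Type_C nat | Type_D nat
  | Type_E6 | Type_E7 | Type_E8 | Type_F4 | Type_G2

fun type_rank :: "cartan_type \<Rightarrow> nat" where
  "type_rank (Type_A n) = n"
| "type_rank (Type_B n) = n"
| "type_rank (Type_C n) = n"
| "type_rank (Type_D n) = n"
| "type_rank Type_E6 = 6"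
| "type_rank Type_E7 = 7"
| "type_rank Type_E8 = 8"
| "type_rank Type_F4 = 4"
| "type_rank Type_G2 = 2"

definition simply_laced_entry :: "(nat \<times> nat) set \<Rightarrow> nat \<Rightarrow> nat \<Rightarrow> int" where
  "simply_laced_entry E i j = (if i = j then 2 else if (i, j) \<in> E \<or> (j, i) \<in> E then -1 else 0)"

definition path_edges :: "nat \<Rightarrow> (nat \<times> nat) set" where
  "path_edges n = {(i, Suc i) | i. 1 \<le> i \<and> i < n}"

definition E8_edges :: "(nat \<times> nat) set" where
  "E8_edges = {(1, 3), (3, 4), (2, 4), (4, 5), (5, 6), (6, 7), (7, 8)}"

text \<open>
  The Cartan matrices in Bourbaki's numbering, with indices from 1 and \<open>(i, j)\<close> entry
  \<open>\<alpha>\<^sub>i(\<alpha>\<^sub>j\<^sup>\<or>) = 2 B(\<alpha>\<^sub>i, \<alpha>\<^sub>j) / B(\<alpha>\<^sub>j, \<alpha>\<^sub>j)\<close>. An entry -2 or -3 therefore has \<open>\<alpha>\<^sub>i\<close> long and \<open>\<alpha>\<^sub>j\<close> short.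
  For types \<open>E\<^sub>6\<close> and \<open>E\<^sub>7\<close> only indices up to the rank are used.
\<close>

fun cartan_entry :: "cartan_type \<Rightarrow> nat \<Rightarrow> nat \<Rightarrow> int" where
  "cartan_entry (Type_A n) i j = simply_laced_entry (path_edges n) i j"
| "cartan_entry (Type_B n) i j =
     (if (i, j) = (n - 1, n) then -2 else simply_laced_entry (path_edges n) i j)"
| "cartan_entry (Type_C n) i j =
     (if (i, j) = (n, n - 1) then -2 else simply_laced_entry (path_edges n) i j)"
| "cartan_entry (Type_D n) i j =
     simply_laced_entry (path_edges (n - 1) \<union> {(n - 2, n)}) i j"
| "cartan_entry Type_E6 i j = simply_laced_entry E8_edges i j"
| "cartan_entry Type_E7 i j = simply_laced_entry E8_edges i j"
| "cartan_entry Type_E8 i j = simply_laced_entry E8_edges i j"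
| "cartan_entry Type_F4 i j =
     (if (i, j) = (2, 3) then -2 else simply_laced_entry (path_edges 4) i j)"
| "cartan_entry Type_G2 i j =
     (if (i, j) = (2, 1) then -3 else simply_laced_entry (path_edges 2) i j)"

definition root_base :: "(real^'n) set \<Rightarrow> nat \<Rightarrow> (nat \<Rightarrow> real^'n) \<Rightarrow> bool" where
  "root_base \<Phi> r \<alpha> \<longleftrightarrow>
     inj_on \<alpha> {1..r} \<and> \<alpha> ` {1..r} \<subseteq> \<Phi> \<and> independent (\<alpha> ` {1..r}) \<and>
     (\<forall>b\<in>\<Phi>. \<exists>c :: nat \<Rightarrow> nat.
        b = (\<Sum>i=1..r. real (c i) *\<^sub>R \<alpha> i) \<or> b = - (\<Sum>i=1..r. real (c i) *\<^sub>R \<alpha> i))"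

definition has_type :: "(real^'n) set \<Rightarrow> (real^'n \<Rightarrow> real^'n) \<Rightarrow> cartan_type \<Rightarrow> bool" where
  "has_type \<Phi> co X \<longleftrightarrow>
     (\<exists>\<alpha>. root_base \<Phi> (type_rank X) \<alpha> \<and>
        (\<forall>i\<in>{1..type_rank X}. \<forall>j\<in>{1..type_rank X}.
           \<alpha> i \<bullet> co (\<alpha> j) = of_int (cartan_entry X i j)))"

text \<open>Values of \<open>B(a, a)\<close> for \<open>a\<close> short and for \<open>a\<close> long in Bourbaki's normalization.\<close>

fun bourbaki_lengths :: "cartan_type \<Rightarrow> real \<times> real" where
  "bourbaki_lengths (Type_A n) = (2, 2)"
| "bourbaki_lengths (Type_B n) = (1, 2)"
| "bourbaki_lengths (Type_C n) = (2, 4)"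
| "bourbaki_lengths (Type_D n) = (2, 2)"
| "bourbaki_lengths Type_E6 = (2, 2)"
| "bourbaki_lengths Type_E7 = (2, 2)"
| "bourbaki_lengths Type_E8 = (2, 2)"
| "bourbaki_lengths Type_F4 = (1, 2)"
| "bourbaki_lengths Type_G2 = (2, 6)"

definition bourbaki_normalized ::
    "cartan_type \<Rightarrow> (real^'n) set \<Rightarrow> (real^'n \<Rightarrow> real^'n \<Rightarrow> real) \<Rightarrow> bool" where
  "bourbaki_normalized X \<Phi> B \<longleftrightarrow>
     (\<forall>a\<in>short_roots \<Phi> B. dual_form B a a = fst (bourbaki_lengths X)) \<and>
     (\<forall>a\<in>long_roots \<Phi> B. dual_form B a a = snd (bourbaki_lengths X))"

section \<open>Algebras presented by generators and relations\<close>

text \<open>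
  With words added by concatenation, \<open>'u list \<Rightarrow>\<^sub>0 complex\<close> with the convolution product is the free
  associative algebra on the set \<open>'u\<close>.
\<close>

instantiation list :: (type) monoid_add
begin
definition zero_list :: "'a list" where "zero_list = []"
definition plus_list :: "'a list \<Rightarrow> 'a list \<Rightarrow> 'a list" where "plus_list xs ys = xs @ ys"
instance by standard (simp_all add: zero_list_def plus_list_def)
end

type_synonym 'u free_alg = "'u list \<Rightarrow>\<^sub>0 complex"

definition fgen :: "'u \<Rightarrow> 'u free_alg" where
  "fgen u = Poly_Mapping.single [u] 1"

definition fconst :: "complex \<Rightarrow> 'u free_alg" where
  "fconst c = Poly_Mapping.single [] c"

definition two_sided_ideal :: "'a::ring_1 set \<Rightarrow> bool" where
  "two_sided_ideal I \<longleftrightarrow> 0 \<in> I \<and> (\<forall>x\<in>I. \<forall>y\<in>I. x - y \<in> I) \<and> (\<forall>x\<in>I. \<forall>a. a * x \<in> I \<and> x * a \<in> I)"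

definition ideal_generated :: "'a::ring_1 set \<Rightarrow> 'a set" where
  "ideal_generated R = \<Inter>{I. two_sided_ideal I \<and> R \<subseteq> I}"

definition ideal_cong :: "'a::ring_1 set \<Rightarrow> 'a \<Rightarrow> 'a \<Rightarrow> bool" where
  "ideal_cong I x y \<longleftrightarrow> x - y \<in> I"

lemma two_sided_ideal_generated: "two_sided_ideal (ideal_generated R)"
  unfolding two_sided_ideal_def ideal_generated_def by blast

lemma ideal_generated_superset: "R \<subseteq> ideal_generated R"
  unfolding ideal_generated_def by blast

lemma ideal_generated_minimal: "two_sided_ideal I \<Longrightarrow> R \<subseteq> I \<Longrightarrow> ideal_generated R \<subseteq> I"
  unfolding ideal_generated_def by blast

context
  fixes I :: "'a::ring_1 set"
  assumes I: "two_sided_ideal I"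
begin

lemma ideal_zero: "0 \<in> I"
  and ideal_diff: "x \<in> I \<Longrightarrow> y \<in> I \<Longrightarrow> x - y \<in> I"
  and ideal_mult_left: "x \<in> I \<Longrightarrow> a * x \<in> I"
  and ideal_mult_right: "x \<in> I \<Longrightarrow> x * a \<in> I"
  using I unfolding two_sided_ideal_def by blast+

lemma ideal_uminus: "x \<in> I \<Longrightarrow> - x \<in> I"
  using ideal_diff[OF ideal_zero, of x] by simp

lemma ideal_add: "x \<in> I \<Longrightarrow> y \<in> I \<Longrightarrow> x + y \<in> I"
  using ideal_diff[of x "- y"] ideal_uminus by simp

lemma equivp_ideal_cong: "equivp (ideal_cong I)"
proof (rule equivpI)
  show "reflp (ideal_cong I)"
    by (rule reflpI) (simp add: ideal_cong_def ideal_zero)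
  show "symp (ideal_cong I)"
    by (rule sympI) (metis ideal_cong_def ideal_uminus minus_diff_eq)
  show "transp (ideal_cong I)"
  proof (rule transpI)
    fix x y z assume "ideal_cong I x y" "ideal_cong I y z"
    then show "ideal_cong I x z"
      using ideal_add[of "x - y" "y - z"] by (simp add: ideal_cong_def)
  qed
qed

lemma ideal_cong_add: "ideal_cong I x y \<Longrightarrow> ideal_cong I x' y' \<Longrightarrow> ideal_cong I (x + x') (y + y')"
  using ideal_add[of "x - y" "x' - y'"] by (simp add: ideal_cong_def algebra_simps)

lemma ideal_cong_diff: "ideal_cong I x y \<Longrightarrow> ideal_cong I x' y' \<Longrightarrow> ideal_cong I (x - x') (y - y')"
  using ideal_diff[of "x - y" "x' - y'"] by (simp add: ideal_cong_def algebra_simps)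

lemma ideal_cong_uminus: "ideal_cong I x y \<Longrightarrow> ideal_cong I (- x) (- y)"
  using ideal_uminus[of "x - y"] by (simp add: ideal_cong_def)

lemma ideal_cong_mult: "ideal_cong I x y \<Longrightarrow> ideal_cong I x' y' \<Longrightarrow> ideal_cong I (x * x') (y * y')"
  using ideal_add[OF ideal_mult_right[of "x - y" x'] ideal_mult_left[of "x' - y'" y]]
  by (simp add: ideal_cong_def algebra_simps)

end

section \<open>The Weyl algebra and the symmetric algebra\<close>

text \<open>A pair \<open>(v, l)\<close> stands for \<open>v + l\<close> in \<open>V \<oplus> V\<^sup>*\<close>.\<close>

type_synonym 'n phase = "(complex^'n) \<times> (complex^'n)"

definition phase_scale :: "complex \<Rightarrow> 'n::finite phase \<Rightarrow> 'n phase" where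
  "phase_scale c u = (c *s fst u, c *s snd u)"

definition cpair :: "complex^'n \<Rightarrow> complex^'n \<Rightarrow> complex" where
  "cpair l v = (\<Sum>i\<in>UNIV. l $ i * v $ i)"

definition omega :: "'n::finite phase \<Rightarrow> 'n phase \<Rightarrow> complex" where
  "omega u w = cpair (snd u) (fst w) - cpair (snd w) (fst u)"

text \<open>
  The generators are all vectors of \<open>V \<oplus> V\<^sup>*\<close>. Imposing only the linearity relations gives the
  tensor algebra of \<open>V \<oplus> V\<^sup>*\<close>; the remaining relations are those defining its two quotients.
\<close>

definition linearity_relations :: "'n::finite phase free_alg set" where
  "linearity_relations =
     {fgen (u + v) - fgen u - fgen v | u v. True} \<union>
     {fgen (phase_scale c u) - fconst c * fgen u | c u. True}"

definition weyl_ideal :: "'n::finite phase free_alg set" where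
  "weyl_ideal = ideal_generated
     (linearity_relations \<union> {fgen u * fgen v - fgen v * fgen u - fconst (omega u v) | u v. True})"

definition sym_ideal :: "'n::finite phase free_alg set" where
  "sym_ideal = ideal_generated
     (linearity_relations \<union> {fgen u * fgen v - fgen v * fgen u | u v. True})"

lemma two_sided_weyl_ideal: "two_sided_ideal weyl_ideal"
  unfolding weyl_ideal_def by (rule two_sided_ideal_generated)

lemma two_sided_sym_ideal: "two_sided_ideal sym_ideal"
  unfolding sym_ideal_def by (rule two_sided_ideal_generated)

quotient_type (overloaded) 'n weyl_alg = "'n::finite phase free_alg" / "ideal_cong weyl_ideal"
  by (rule equivp_ideal_cong[OF two_sided_weyl_ideal])

quotient_type (overloaded) 'n sym_alg = "'n::finite phase free_alg" / "ideal_cong sym_ideal"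
  by (rule equivp_ideal_cong[OF two_sided_sym_ideal])

lemma fconst_1: "fconst 1 = 1"
  by (simp add: fconst_def flip: zero_list_def)

lemma fconst_0: "fconst 0 = 0"
  by (simp add: fconst_def)

lemma fconst_add: "fconst (a + b) = fconst a + fconst b"
  by (simp add: fconst_def single_add)

lemma fconst_mult: "fconst (a * b) = fconst a * fconst b"
  by (simp add: fconst_def mult_single flip: zero_list_def)

instantiation weyl_alg :: (finite) "{ring, monoid_mult}"
begin
lift_definition zero_weyl_alg :: "'a weyl_alg" is 0 .
lift_definition one_weyl_alg :: "'a weyl_alg" is 1 .
lift_definition plus_weyl_alg :: "'a weyl_alg \<Rightarrow> 'a weyl_alg \<Rightarrow> 'a weyl_alg" is "(+)"
  by (rule ideal_cong_add[OF two_sided_weyl_ideal])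
lift_definition minus_weyl_alg :: "'a weyl_alg \<Rightarrow> 'a weyl_alg \<Rightarrow> 'a weyl_alg" is "(-)"
  by (rule ideal_cong_diff[OF two_sided_weyl_ideal])
lift_definition uminus_weyl_alg :: "'a weyl_alg \<Rightarrow> 'a weyl_alg" is uminus
  by (rule ideal_cong_uminus[OF two_sided_weyl_ideal])
lift_definition times_weyl_alg :: "'a weyl_alg \<Rightarrow> 'a weyl_alg \<Rightarrow> 'a weyl_alg" is "(*)"
  by (rule ideal_cong_mult[OF two_sided_weyl_ideal])
instance
  by standard
    (transfer; simp add: ideal_cong_def algebra_simps ideal_zero[OF two_sided_weyl_ideal])+
end

lift_definition weyl_gen :: "'n::finite phase \<Rightarrow> 'n weyl_alg" is fgen .

lift_definition weyl_scale :: "complex \<Rightarrow> 'n::finite weyl_alg \<Rightarrow> 'n weyl_alg"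
  is "\<lambda>c x. fconst c * x"
  by (intro ideal_cong_mult[OF two_sided_weyl_ideal]) (simp_all add: ideal_cong_def ideal_zero[OF two_sided_weyl_ideal])

instantiation sym_alg :: (finite) "{ring, monoid_mult}"
begin
lift_definition zero_sym_alg :: "'a sym_alg" is 0 .
lift_definition one_sym_alg :: "'a sym_alg" is 1 .
lift_definition plus_sym_alg :: "'a sym_alg \<Rightarrow> 'a sym_alg \<Rightarrow> 'a sym_alg" is "(+)"
  by (rule ideal_cong_add[OF two_sided_sym_ideal])
lift_definition minus_sym_alg :: "'a sym_alg \<Rightarrow> 'a sym_alg \<Rightarrow> 'a sym_alg" is "(-)"
  by (rule ideal_cong_diff[OF two_sided_sym_ideal])
lift_definition uminus_sym_alg :: "'a sym_alg \<Rightarrow> 'a sym_alg" is uminus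
  by (rule ideal_cong_uminus[OF two_sided_sym_ideal])
lift_definition times_sym_alg :: "'a sym_alg \<Rightarrow> 'a sym_alg \<Rightarrow> 'a sym_alg" is "(*)"
  by (rule ideal_cong_mult[OF two_sided_sym_ideal])
instance
  by standard
    (transfer; simp add: ideal_cong_def algebra_simps ideal_zero[OF two_sided_sym_ideal])+
end

lift_definition sym_gen :: "'n::finite phase \<Rightarrow> 'n sym_alg" is fgen .

lift_definition sym_scale :: "complex \<Rightarrow> 'n::finite sym_alg \<Rightarrow> 'n sym_alg"
  is "\<lambda>c x. fconst c * x"
  by (intro ideal_cong_mult[OF two_sided_sym_ideal]) (simp_all add: ideal_cong_def ideal_zero[OF two_sided_sym_ideal])

lemma poly_mapping_single_induct [case_names single add]:
  assumes single: "\<And>w c. P (Poly_Mapping.single w c)"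
    and add: "\<And>p q. P p \<Longrightarrow> P q \<Longrightarrow> P (p + q)"
  shows "P (p :: 'a \<Rightarrow>\<^sub>0 'b::comm_monoid_add)"
proof (induction p rule: update_induct)
  case const
  show ?case using single[of _ 0] by simp
next
  case (update f a b)
  then have "Poly_Mapping.update a b f = f + Poly_Mapping.single a b"
    by (intro poly_mapping_eqI) (auto simp: lookup_update lookup_add lookup_single in_keys_iff when_def)
  then show ?case using single add update by simp
qed

lemma fconst_commute: "x * fconst c = fconst c * x"
proof (induction x rule: poly_mapping_single_induct)
  case (single w d)
  show ?case by (simp add: fconst_def mult_single mult.commute flip: zero_list_def)
qed (simp add: algebra_simps)

lemma weyl_cong_refl: "ideal_cong weyl_ideal x x"
  by (simp add: ideal_cong_def ideal_zero[OF two_sided_weyl_ideal])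

lemma weyl_scale_add: "weyl_scale c (x + y) = weyl_scale c x + weyl_scale c y"
  by transfer (simp add: algebra_simps weyl_cong_refl)

lemma weyl_scale_add_left: "weyl_scale (c + d) x = weyl_scale c x + weyl_scale d x"
  by transfer (simp add: algebra_simps fconst_add weyl_cong_refl)

lemma weyl_scale_scale: "weyl_scale c (weyl_scale d x) = weyl_scale (c * d) x"
  by transfer (simp add: algebra_simps fconst_mult weyl_cong_refl)

lemma weyl_scale_0: "weyl_scale 0 x = 0"
  by transfer (simp add: fconst_0 weyl_cong_refl)

lemma weyl_scale_1: "weyl_scale 1 x = x"
  by transfer (simp add: fconst_1 weyl_cong_refl)

lemma weyl_scale_mult_left: "weyl_scale c x * y = weyl_scale c (x * y)"
  by transfer (simp add: algebra_simps weyl_cong_refl)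

lemma weyl_scale_mult_right: "x * weyl_scale c y = weyl_scale c (x * y)"
  by transfer (metis fconst_commute mult.assoc weyl_cong_refl)

lemma weyl_scale_sum: "weyl_scale c (sum f A) = (\<Sum>a\<in>A. weyl_scale c (f a))"
proof (induction A rule: infinite_finite_induct)
qed (simp_all add: weyl_scale_add, (metis add_cancel_right_left weyl_scale_add)+)

lemma weyl_gen_add: "weyl_gen (u + v) = weyl_gen u + weyl_gen v"
proof transfer
  fix u v :: "'a phase"
  have "fgen (u + v) - fgen u - fgen v \<in> weyl_ideal"
    unfolding weyl_ideal_def linearity_relations_def
    by (rule subsetD[OF ideal_generated_superset]) blast
  then show "ideal_cong weyl_ideal (fgen (u + v)) (fgen u + fgen v)"
    by (simp add: ideal_cong_def algebra_simps)
qed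

lemma weyl_gen_scale: "weyl_gen (phase_scale c u) = weyl_scale c (weyl_gen u)"
proof transfer
  fix u :: "'a phase" and c
  have "fgen (phase_scale c u) - fconst c * fgen u \<in> weyl_ideal"
    unfolding weyl_ideal_def linearity_relations_def
    by (rule subsetD[OF ideal_generated_superset]) blast
  then show "ideal_cong weyl_ideal (fgen (phase_scale c u)) (fconst c * fgen u)"
    by (simp add: ideal_cong_def)
qed

section \<open>Symmetrization\<close>

definition symmetrized :: "'n::finite phase list \<Rightarrow> 'n weyl_alg" where
  "symmetrized us = weyl_scale (1 / fact (length us))
     (\<Sum>\<sigma> | \<sigma> permutes {..<length us}.
        prod_list (map (\<lambda>i. weyl_gen (us ! \<sigma> i)) [0..<length us]))"

text \<open>The linear extension of \<^const>\<open>symmetrized\<close> to the free algebra; it descends to the symmetric algebra.\<close>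

definition free_symmetrize :: "'n::finite phase free_alg \<Rightarrow> 'n weyl_alg" where
  "free_symmetrize p = (\<Sum>us\<in>Poly_Mapping.keys p. weyl_scale (Poly_Mapping.lookup p us) (symmetrized us))"

lemma free_symmetrize_superset:
  assumes "finite S" "Poly_Mapping.keys p \<subseteq> S"
  shows "free_symmetrize p = (\<Sum>us\<in>S. weyl_scale (Poly_Mapping.lookup p us) (symmetrized us))"
  unfolding free_symmetrize_def
  by (rule sum.mono_neutral_left) (use assms in \<open>auto simp: in_keys_iff weyl_scale_0\<close>)

lemma free_symmetrize_add: "free_symmetrize (p + q) = free_symmetrize p + free_symmetrize q"
proof -
  let ?S = "Poly_Mapping.keys p \<union> Poly_Mapping.keys q"
  have "Poly_Mapping.keys (p + q) \<subseteq> ?S" by (rule Poly_Mapping.keys_add)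
  then show ?thesis
    by (simp add: free_symmetrize_superset[of ?S] lookup_add weyl_scale_add_left sum.distrib)
qed

lemma free_symmetrize_0: "free_symmetrize 0 = 0"
  by (simp add: free_symmetrize_def)

lemma free_symmetrize_diff: "free_symmetrize (p - q) = free_symmetrize p - free_symmetrize q"
  using free_symmetrize_add[of "p - q" q] by simp

lemma free_symmetrize_single: "free_symmetrize (Poly_Mapping.single us c) = weyl_scale c (symmetrized us)"
  by (subst free_symmetrize_superset[of "{us}"]) auto

lemma symmetrized_permute:
  assumes p: "p permutes {..<length us}"
  shows "symmetrized (permute_list p us) = symmetrized us"
proof -
  let ?n = "length us"
  let ?f = "\<lambda>\<sigma>. prod_list (map (\<lambda>i. weyl_gen (us ! \<sigma> i)) [0..<?n])"
  have "(\<Sum>\<sigma> | \<sigma> permutes {..<?n}. prod_list (map (\<lambda>i. weyl_gen (permute_list p us ! \<sigma> i)) [0..<?n]))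
      = (\<Sum>\<sigma> | \<sigma> permutes {..<?n}. ?f (p \<circ> \<sigma>))"
  proof (intro sum.cong refl arg_cong[where f = prod_list] map_cong)
    fix \<sigma> i assume "\<sigma> \<in> {\<sigma>. \<sigma> permutes {..<?n}}" "i \<in> set [0..<?n]"
    then have "\<sigma> i < ?n" by (metis atLeastLessThan_iff atLeast_upt lessThan_iff mem_Collect_eq permutes_in_image set_upt)
    then show "weyl_gen (permute_list p us ! \<sigma> i) = weyl_gen (us ! (p \<circ> \<sigma>) i)"
      by (simp add: permute_list_nth[OF p])
  qed
  also have "\<dots> = (\<Sum>\<sigma> | \<sigma> permutes {..<?n}. ?f \<sigma>)"
    using setum_permutations_compose_left[OF p, of ?f] by simp
  finally show ?thesis by (simp add: symmetrized_def)
qed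

lemma prod_list_split_nth:
  assumes "j < n"
  shows "prod_list (map f [0..<n]) =
    prod_list (map f [0..<j]) * (f j * prod_list (map f [Suc j..<n]) :: 'a::monoid_mult)"
proof -
  have "[0..<n] = [0..<j] @ j # [Suc j..<n]"
    using assms upt_add_eq_append[of 0 j "n - j"] upt_conv_Cons[of j n] by simp
  then show ?thesis by simp
qed

text \<open>Each permuted product contains the letter in a given position exactly once.\<close>

lemma symmetrized_letter:
  assumes "\<sigma> permutes {..<length (us @ x # vs)}"
  shows "\<exists>A C. \<forall>y. prod_list (map (\<lambda>i. weyl_gen ((us @ y # vs) ! \<sigma> i)) [0..<length (us @ y # vs)])
                    = A * weyl_gen y * C"
proof -
  let ?n = "length (us @ x # vs)" and ?j = "inv \<sigma> (length us)"
  have j: "?j < ?n"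
    using permutes_in_image[OF permutes_inv[OF assms], of "length us"] by simp
  have sj: "\<sigma> ?j = length us" using permutes_inverses(1)[OF assms] by simp
  have other: "(us @ y # vs) ! \<sigma> i = (us @ x # vs) ! \<sigma> i" if "i \<noteq> ?j" for i y
  proof -
    have "\<sigma> i \<noteq> length us" using that permutes_inverses(2)[OF assms] by metis
    then show ?thesis by (auto simp: nth_append nth_Cons')
  qed
  have "prod_list (map (\<lambda>i. weyl_gen ((us @ y # vs) ! \<sigma> i)) [0..<?n]) =
     prod_list (map (\<lambda>i. weyl_gen ((us @ x # vs) ! \<sigma> i)) [0..<?j]) * weyl_gen y *
     prod_list (map (\<lambda>i. weyl_gen ((us @ x # vs) ! \<sigma> i)) [Suc ?j..<?n])" for y
  proof -
    have 1: "map (\<lambda>i. weyl_gen ((us @ y # vs) ! \<sigma> i)) [0..<?j] = map (\<lambda>i. weyl_gen ((us @ x # vs) ! \<sigma> i)) [0..<?j]"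
      by (rule map_cong) (auto simp: other[of _ y])
    have 2: "map (\<lambda>i. weyl_gen ((us @ y # vs) ! \<sigma> i)) [Suc ?j..<?n] = map (\<lambda>i. weyl_gen ((us @ x # vs) ! \<sigma> i)) [Suc ?j..<?n]"
      by (rule map_cong) (auto simp: other[of _ y])
    have 3: "(us @ y # vs) ! \<sigma> ?j = y" by (simp add: sj)
    show ?thesis by (subst prod_list_split_nth[OF j]) (simp only: 1 2 3 mult.assoc)
  qed
  then show ?thesis by (simp only: length_append length_Cons) blast
qed

lemma symmetrized_linear:
  "symmetrized (us @ (x + y) # vs) = symmetrized (us @ x # vs) + symmetrized (us @ y # vs)"
  "symmetrized (us @ phase_scale c x # vs) = weyl_scale c (symmetrized (us @ x # vs))"
proof -
  let ?n = "length (us @ x # vs)"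
  let ?t = "\<lambda>y \<sigma>. prod_list (map (\<lambda>i. weyl_gen ((us @ y # vs) ! \<sigma> i)) [0..<?n])"
  have sym: "symmetrized (us @ z # vs) =
      weyl_scale (1 / fact ?n) (\<Sum>\<sigma> | \<sigma> permutes {..<?n}. ?t z \<sigma>)" for z
    by (simp add: symmetrized_def)
  have letter: "\<exists>A C. \<forall>y. ?t y \<sigma> = A * weyl_gen y * C" if "\<sigma> permutes {..<?n}" for \<sigma>
    using symmetrized_letter[OF that] by simp
  have "?t (x + y) \<sigma> = ?t x \<sigma> + ?t y \<sigma>" if "\<sigma> permutes {..<?n}" for \<sigma>
  proof -
    note \<sigma> = that
    obtain A C where "\<forall>z. ?t z \<sigma> = A * weyl_gen z * C" using letter[OF \<sigma>] by blast
    then have AC: "?t z \<sigma> = A * weyl_gen z * C" for z by blast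
    show ?thesis unfolding AC weyl_gen_add by (simp add: algebra_simps)
  qed
  then have "(\<Sum>\<sigma> | \<sigma> permutes {..<?n}. ?t (x + y) \<sigma>)
      = (\<Sum>\<sigma> | \<sigma> permutes {..<?n}. ?t x \<sigma> + ?t y \<sigma>)"
    by (intro sum.cong refl) blast
  then show "symmetrized (us @ (x + y) # vs) = symmetrized (us @ x # vs) + symmetrized (us @ y # vs)"
    by (simp only: sym sum.distrib weyl_scale_add)
  have "?t (phase_scale c x) \<sigma> = weyl_scale c (?t x \<sigma>)" if "\<sigma> permutes {..<?n}" for \<sigma>
  proof -
    note \<sigma> = that
    obtain A C where "\<forall>z. ?t z \<sigma> = A * weyl_gen z * C" using letter[OF \<sigma>] by blast
    then have AC: "?t z \<sigma> = A * weyl_gen z * C" for z by blast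
    show ?thesis unfolding AC weyl_gen_scale by (simp add: weyl_scale_mult_left weyl_scale_mult_right)
  qed
  then have "(\<Sum>\<sigma> | \<sigma> permutes {..<?n}. ?t (phase_scale c x) \<sigma>)
      = (\<Sum>\<sigma> | \<sigma> permutes {..<?n}. weyl_scale c (?t x \<sigma>))"
    by (intro sum.cong refl) blast
  then show "symmetrized (us @ phase_scale c x # vs) = weyl_scale c (symmetrized (us @ x # vs))"
    by (simp only: sym weyl_scale_sum[symmetric] weyl_scale_scale mult.commute)
qed

lemma symmetrized_swap: "symmetrized (us @ x # y # vs) = symmetrized (us @ y # x # vs)"
proof -
  have "mset (us @ x # y # vs) = mset (us @ y # x # vs)" by simp
  then obtain p where "p permutes {..<length (us @ y # x # vs)}"
      "permute_list p (us @ y # x # vs) = us @ x # y # vs"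
    by (rule mset_eq_permutation)
  then show ?thesis by (metis symmetrized_permute)
qed

lemma free_symmetrize_sym_ideal:
  assumes "p \<in> sym_ideal"
  shows "free_symmetrize p = 0"
proof -
  define K where "K = {p :: 'a phase free_alg. \<forall>u a v b.
    free_symmetrize (Poly_Mapping.single u a * p * Poly_Mapping.single v b) = 0}"
  have left: "Poly_Mapping.single w c * p \<in> K" if "p \<in> K" for p w c
    using that unfolding K_def by (simp add: mult_single flip: mult.assoc)
  have right: "p * Poly_Mapping.single w c \<in> K" if "p \<in> K" for p w c
    using that unfolding K_def by (simp add: mult_single mult.assoc)
  have K_add: "p + q \<in> K" if "p \<in> K" "q \<in> K" for p q
    using that unfolding K_def by (simp add: algebra_simps free_symmetrize_add)
  have "two_sided_ideal K"
    unfolding two_sided_ideal_def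
  proof (intro conjI ballI allI)
    show "0 \<in> K" by (simp add: K_def free_symmetrize_0)
    show "p - q \<in> K" if "p \<in> K" "q \<in> K" for p q
      using that unfolding K_def by (simp add: algebra_simps free_symmetrize_diff)
    show "a * p \<in> K" if "p \<in> K" for a p
      by (induction a rule: poly_mapping_single_induct) (auto simp: left that distrib_right intro: K_add)
    show "p * a \<in> K" if "p \<in> K" for a p
      by (induction a rule: poly_mapping_single_induct) (auto simp: right that distrib_left intro: K_add)
  qed
  moreover have "linearity_relations \<union> {fgen u * fgen v - fgen v * fgen u | u v. True} \<subseteq> K"
  proof -
    note expand = left_diff_distrib right_diff_distrib mult_single free_symmetrize_diff
      free_symmetrize_single plus_list_def append_assoc append_Cons append_Nil mult_1_left mult_1_right
    have "fgen (x + y) - fgen x - fgen y \<in> K" for x y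
      unfolding K_def fgen_def mem_Collect_eq expand symmetrized_linear weyl_scale_add by simp
    moreover have "fgen (phase_scale c x) - fconst c * fgen x \<in> K" for c x
      unfolding K_def fgen_def fconst_def mem_Collect_eq expand symmetrized_linear weyl_scale_scale
      by (simp add: mult.commute mult.left_commute)
    moreover have "fgen x * fgen y - fgen y * fgen x \<in> K" for x y
    proof -
      have "symmetrized (us @ x # y # vs) = symmetrized (us @ y # x # vs)" for us vs
        by (rule symmetrized_swap)
      then show ?thesis unfolding K_def fgen_def mem_Collect_eq expand by simp
    qed
    ultimately show ?thesis unfolding linearity_relations_def by blast
  qed
  ultimately have "p \<in> K"
    using assms ideal_generated_minimal unfolding sym_ideal_def by blast
  then have "free_symmetrize (Poly_Mapping.single 0 1 * p * Poly_Mapping.single 0 1) = 0"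
    unfolding K_def by blast
  then show ?thesis by simp
qed

lift_definition symmetrization :: "'n::finite sym_alg \<Rightarrow> 'n weyl_alg" is free_symmetrize
proof -
  fix p q :: "'n phase free_alg" assume "ideal_cong sym_ideal p q"
  then show "free_symmetrize p = free_symmetrize q"
    using free_symmetrize_sym_ideal[of "p - q"] by (simp add: ideal_cong_def free_symmetrize_diff)
qed

lemma fgen_prod_list: "prod_list (map fgen us) = Poly_Mapping.single us 1"
proof (induction us)
  case Nil
  show ?case by (simp add: fconst_1[unfolded fconst_def])
next
  case (Cons u us)
  then show ?case by (simp add: fgen_def mult_single plus_list_def)
qed

lemma symmetrization_prod_list: "symmetrization (prod_list (map sym_gen us)) = symmetrized us"
proof -
  have "prod_list (map sym_gen us) = abs_sym_alg (prod_list (map fgen us))"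
    by (induction us) (simp_all add: one_sym_alg_def times_sym_alg.abs_eq sym_gen.abs_eq)
  then show ?thesis
    by (simp add: fgen_prod_list symmetrization.abs_eq free_symmetrize_single weyl_scale_1)
qed

definition eta :: "'n::finite weyl_alg \<Rightarrow> 'n sym_alg" where
  "eta = inv symmetrization"

text \<open>
  The relations of the symmetric algebra are homogeneous for word length, so word length induces
  its grading. The degree 0 component is the coefficient of the empty word.
\<close>

lemma lookup_mult_empty:
  "Poly_Mapping.lookup (p * q) [] = Poly_Mapping.lookup p [] * Poly_Mapping.lookup (q :: 'u free_alg) []"
proof (induction p rule: poly_mapping_single_induct)
  case (single u a)
  show ?case
    by (induction q rule: poly_mapping_single_induct)
      (auto simp: mult_single lookup_single when_def plus_list_def lookup_add distrib_left)
qed (simp add: distrib_right lookup_add)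

lift_definition sym_degree0 :: "'n::finite sym_alg \<Rightarrow> complex" is "\<lambda>p. Poly_Mapping.lookup p []"
proof -
  fix p q :: "'n phase free_alg" assume pq: "ideal_cong sym_ideal p q"
  let ?K = "{p :: 'n phase free_alg. Poly_Mapping.lookup p [] = 0}"
  have "two_sided_ideal ?K"
    by (simp add: two_sided_ideal_def lookup_mult_empty lookup_minus)
  moreover have "linearity_relations \<union> {fgen u * fgen v - fgen v * fgen u | u v. True} \<subseteq> ?K"
    by (auto simp: linearity_relations_def lookup_mult_empty lookup_minus fgen_def lookup_single)
  ultimately have "sym_ideal \<subseteq> ?K"
    unfolding sym_ideal_def by (rule ideal_generated_minimal)
  then show "Poly_Mapping.lookup p [] = Poly_Mapping.lookup q []"
    using pq by (auto simp: ideal_cong_def lookup_minus)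
qed

definition degree0 :: "'n::finite weyl_alg \<Rightarrow> complex" where
  "degree0 x = sym_degree0 (eta x)"

section \<open>The element \<open>\<nu>'(\<Omega>'\<^sub>W)\<close>\<close>

definition cvec :: "real^'n \<Rightarrow> complex^'n" where
  "cvec v = (\<chi> i. complex_of_real (v $ i))"

text \<open>The complex-linear extension of \<^const>\<open>refl\<close> to \<open>V\<close>.\<close>

definition crefl :: "(real^'n \<Rightarrow> real^'n) \<Rightarrow> real^'n \<Rightarrow> complex^'n \<Rightarrow> complex^'n" where
  "crefl co a v = v - cpair (cvec a) v *s cvec (co a)"

definition commutator :: "(complex^'n \<Rightarrow> complex^'n) \<Rightarrow> (complex^'n \<Rightarrow> complex^'n) \<Rightarrow> complex^'n \<Rightarrow> complex^'n" where
  "commutator f g v = f (g v) - g (f v)"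

text \<open>
  Defined for every endomorphism of \<open>V\<close>, and used only on \<open>\<ss>\<oo>(V, B)\<close>. The standard basis is its
  own dual basis for \<^const>\<open>cpair\<close>; the sum does not depend on the basis.
\<close>

definition nu' :: "(complex^'n::finite \<Rightarrow> complex^'n) \<Rightarrow> 'n weyl_alg" where
  "nu' f = (\<Sum>i\<in>UNIV. weyl_gen (f (axis i 1), 0) * weyl_gen (0, axis i 1))"

text \<open>Pairs with \<open>B (co a) (co b) = 0\<close> contribute 0, because \<open>1 / 0 = 0\<close>.\<close>

definition nu'_Omega ::
    "(real^'n::finite) set \<Rightarrow> (real^'n \<Rightarrow> real^'n) \<Rightarrow> (real^'n \<Rightarrow> real^'n \<Rightarrow> real) \<Rightarrow>
     (real^'n \<Rightarrow> complex) \<Rightarrow> 'n weyl_alg" where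
  "nu'_Omega P co B k = weyl_scale (1 / 16)
     (\<Sum>a\<in>P. \<Sum>b\<in>P. weyl_scale (k a * k b * (1 / complex_of_real (B (co a) (co b))))
        ((nu' (commutator (crefl co a) (crefl co b)))\<^sup>2))"

end

theory Submission
  imports Defs
begin

text \<open>
  The degree 0 component is a vacuum expectation: on a word of generators it is the sum over all
  complete contractions of the letters, two letters contracting to half their symplectic product. This
  functional is well defined on the Weyl algebra and vanishes on symmetrized words of positive length.
  For the square of \<open>\<nu>'([s\<^sub>a, s\<^sub>b])\<close> it gives \<open>p (4 - p) / 2\<close> with \<open>p = a(b\<^sup>\<or>) b(a\<^sup>\<or>)\<close>, so the number
  sought is \<open>1/32\<close> times the sum of \<open>k\<^sub>a k\<^sub>b B(a, b) (4 - p)\<close> over the pairs of positive roots.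

  This sum does not depend on the positive system. The pairs at a fixed acute angle are permuted by a
  rotation of their plane, along each orbit of which the product of the signs of the two roots has
  average \<open>1/3\<close>, \<open>1/2\<close> or \<open>2/3\<close> according to \<open>p = 1, 2, 3\<close>. What remains is to count the pairs at each
  angle. Since the sum of \<open>B(b, u) B(b, v)\<close> over the roots \<open>b\<close> of one length is an invariant form,
  Schur's lemma reduces this to the numbers of short and of long roots, and these numbers follow from
  the Cartan matrix by evaluating \<open>B(R, R)\<close> for the sum \<open>R\<close> of the positive roots of one length.
\<close>

text \<open>\<open>eta\<close> is an inverse picked by choice, so it is never computed: the
  functional satisfies \<open>vacuum (symmetrization y) = sym_degree0 y\<close>, and surjectivity of
  \<open>symmetrization\<close> then determines degree 0 of whatever preimage \<open>eta\<close>
  returns. The other obstacle is that the roots are known only through a base and its Cartan matrix;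
  no list of roots is ever formed. One formula for weighted sums over pairs of positive roots serves
  twice. With weight (4 - p) / 32 it gives the answer: the pairs a = b (p = 4) drop out, and the
  factors 3, 2, 1 times the averages become 1, 1, 2/3, so that only type G2 has an exceptional
  coefficient. With weight 1, restricted to one length, it evaluates B(R, R) and yields 12 * (sum of
  the coordinates of R / 2 at the simple roots of that length) = N (1 + N / r) for the number N of
  those roots; in the simply laced case, with Coxeter number N / r, this is the strange formula of
  Freudenthal and de Vries. Since N is its only nonnegative solution, each type needs just a
  coordinate vector and a guess for N, both checked against the Cartan matrix.\<close>

section \<open>The vacuum functional\<close>

text \<open>The list without the contracted letter is handed to a continuation \<open>f\<close>, and
  letters already passed are put back by wrapping \<open>f\<close>. So the value is the sum over
  positions j of \<open>omega x (vs ! j)\<close> times \<open>f\<close> of \<open>vs\<close> without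
  position j.\<close>

fun contract :: "'n::finite phase \<Rightarrow> ('n phase list \<Rightarrow> complex) \<Rightarrow> 'n phase list \<Rightarrow> complex" where
  "contract x f [] = 0"
| "contract x f (v # vs) = omega x v * f vs + contract x (\<lambda>ws. f (v # ws)) vs"

text \<open>Tells the function package that \<open>f\<close> is applied only to lists shorter than
  the argument, on which termination of the nested recursion in \<open>wick\<close> rests.\<close>

lemma contract_cong [fundef_cong]:
  assumes "x = y" "vs = ws" and "\<And>us. length us < length ws \<Longrightarrow> f us = g us"
  shows "contract x f vs = contract y g ws"
  using assms(3) unfolding assms(1,2)
proof (induction ws arbitrary: f g)
  case (Cons w ws)
  have "contract y (\<lambda>us. f (w # us)) ws = contract y (\<lambda>us. g (w # us)) ws"
    by (rule Cons.IH) (simp add: Cons.prems)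
  then show ?case by (simp add: Cons.prems)
qed simp

text \<open>The sum over all perfect matchings of the letters. The half is forced:
  \<open>omega x y / 2\<close> is the antisymmetric choice whose values at (x, y) and (y, x) differ
  by \<open>omega x y\<close>.\<close>

function wick :: "'n::finite phase list \<Rightarrow> complex" where
  "wick [] = 1"
| "wick (u # us) = contract u wick us / 2"
  by pat_completeness auto
termination by (relation "Wellfounded.measure length") auto

lemma omega_add: "omega (x + y) u = omega x u + omega y u" "omega u (x + y) = omega u x + omega u y"
  by (simp_all add: omega_def cpair_def algebra_simps sum.distrib)

lemma omega_scale: "omega (phase_scale c x) u = c * omega x u" "omega u (phase_scale c x) = c * omega u x"
  by (simp_all add: omega_def cpair_def phase_scale_def algebra_simps sum_distrib_left)

lemma omega_flip: "omega y x = - omega x y"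
  by (simp add: omega_def)

lemma contract_combine:
  "contract x (\<lambda>ws. c * f ws + d * g ws) vs = c * contract x f vs + d * contract x g vs"
  by (induction vs arbitrary: f g) (simp_all add: algebra_simps)

lemma contract_combine_left:
  assumes "\<And>v. omega z v = c * omega x v + d * omega y v"
  shows "contract z f vs = c * contract x f vs + d * contract y f vs"
  by (induction vs arbitrary: f) (simp_all add: algebra_simps assms)

text \<open>Both sides run over the ordered pairs of distinct positions of \<open>vs\<close>. This
  is the part of \<open>wick (x # y # vs)\<close> that is symmetric in the two leading
  letters.\<close>

lemma contract_commute:
  "contract x (contract y f) vs = contract y (contract x f) vs"
proof (induction vs arbitrary: f)
  case (Cons v vs)
  have *: "contract x (\<lambda>ws. omega y v * f ws + contract y (\<lambda>us. f (v # us)) ws) vs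
     = omega y v * contract x f vs + contract x (contract y (\<lambda>us. f (v # us))) vs" for x y
    using contract_combine[of x "omega y v" f 1 "contract y (\<lambda>us. f (v # us))" vs] by simp
  show ?case using Cons.IH[of "\<lambda>us. f (v # us)"] by (simp add: *)
qed simp

lemma contract_append:
  "contract x f (us @ vs) =
    contract x (\<lambda>ws. f (ws @ vs)) us + contract x (\<lambda>ws. f (us @ ws)) vs"
  by (induction us arbitrary: f) simp_all

text \<open>If x and y lead the word, only their own contraction changes, by omega x y / 2 - omega y
  x / 2. Otherwise the first letter u is contracted: with x or y it gives two terms that the swap
  exchanges, and with any other letter the induction hypothesis applies to the shorter word.\<close>

lemma wick_swap: "wick (us @ x # y # vs) = wick (us @ y # x # vs) + omega x y * wick (us @ vs)"
proof (induction "length us + length vs" arbitrary: us vs rule: less_induct)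
  case less
  have half: "contract x (\<lambda>ws. contract y wick ws / 2) vs = contract x (contract y wick) vs / 2" for x y
    using contract_combine[of x "1/2" "contract y wick" 0 "\<lambda>_. 0" vs] by simp
  show ?case
  proof (cases us)
    case Nil
    show ?thesis
      using contract_commute[of x y wick vs] omega_flip[of x y]
      by (simp add: Nil half add_divide_distrib)
  next
    case (Cons u ws)
    have IH: "wick (us' @ x # y # vs') = 1 * wick (us' @ y # x # vs') + omega x y * wick (us' @ vs')"
      if "length us' + length vs' < length us + length vs" for us' vs'
      using less[OF that] by simp
    have 1: "contract u (\<lambda>zs. wick (zs @ x # y # vs)) ws =
        contract u (\<lambda>zs. wick (zs @ y # x # vs)) ws + omega x y * contract u (\<lambda>zs. wick (zs @ vs)) ws"
    proof -
      have "contract u (\<lambda>zs. wick (zs @ x # y # vs)) ws =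
          contract u (\<lambda>zs. 1 * wick (zs @ y # x # vs) + omega x y * wick (zs @ vs)) ws"
        by (rule contract_cong[OF refl refl IH]) (simp add: Cons)
      then show ?thesis unfolding contract_combine by simp
    qed
    have 2: "contract u (\<lambda>zs. wick (ws @ x # y # zs)) vs =
        contract u (\<lambda>zs. wick (ws @ y # x # zs)) vs + omega x y * contract u (\<lambda>zs. wick (ws @ zs)) vs"
    proof -
      have "contract u (\<lambda>zs. wick (ws @ x # y # zs)) vs =
          contract u (\<lambda>zs. 1 * wick (ws @ y # x # zs) + omega x y * wick (ws @ zs)) vs"
        by (rule contract_cong[OF refl refl IH]) (simp add: Cons)
      then show ?thesis unfolding contract_combine by simp
    qed
    show ?thesis
      unfolding Cons append_Cons wick.simps contract_append contract.simps 1 2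
      by (simp add: algebra_simps add_divide_distrib)
  qed
qed

text \<open>\<open>wick\<close> sees a letter only through \<open>omega\<close>, so one hypothesis
  on \<open>omega\<close> covers sums and scalar multiples. At the front linearity is visible;
  \<open>wick_swap\<close> moves the letter there, with corrections that are themselves linear in
  it.\<close>

lemma wick_combine:
  assumes "\<And>v. omega z v = c * omega x v + d * omega y v"
  shows "wick (us @ z # vs) = c * wick (us @ x # vs) + d * wick (us @ y # vs)"
proof (induction us arbitrary: vs rule: rev_induct)
  case Nil
  show ?case by (simp add: contract_combine_left[OF assms] add_divide_distrib)
next
  case (snoc u us)
  have "omega u z = c * omega u x + d * omega u y"
    using assms[of u] omega_flip[of u z] omega_flip[of u x] omega_flip[of u y] by simp
  then show ?case
    using snoc[of "u # vs"] by (simp add: wick_swap[of us u] algebra_simps)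
qed

text \<open>Letters are addressed through a distinct list of indices, so that the removed position
  has a name even when letters repeat.\<close>

lemma contract_map:
  assumes "distinct xs"
  shows "contract x f (map g xs) = (\<Sum>j\<in>set xs. omega x (g j) * f (map g (remove1 j xs)))"
  using assms
proof (induction xs arbitrary: f)
  case (Cons a xs)
  have "(\<Sum>j\<in>set xs. omega x (g j) * f (g a # map g (remove1 j xs))) =
      (\<Sum>j\<in>set xs. omega x (g j) * f (map g (remove1 j (a # xs))))"
    using Cons.prems by (intro sum.cong) auto
  then show ?case using Cons by simp
qed simp

text \<open>
  The contraction of the first letter with the \<open>j\<close>-th one changes sign when the permutation is
  composed with the transposition of \<open>0\<close> and \<open>j\<close>, and so cancels in the sum.
\<close>

lemma sum_permutations_wick:
  assumes "us \<noteq> []"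
  shows "(\<Sum>\<sigma> | \<sigma> permutes {..<length us}. wick (map (\<lambda>i. us ! \<sigma> i) [0..<length us])) = 0"
proof -
  define n where "n = length us"
  have n: "[0..<n] = 0 # [1..<n]" using assms by (simp add: n_def upt_conv_Cons)
  let ?t = "\<lambda>\<sigma> j. omega (us ! \<sigma> 0) (us ! \<sigma> j) * wick (map (\<lambda>i. us ! \<sigma> i) (remove1 j [1..<n]))"
  have 0: "(\<Sum>\<sigma> | \<sigma> permutes {..<n}. ?t \<sigma> j) = 0" if j: "j \<in> {1..<n}" for j
  proof -
    let ?\<tau> = "Transposition.transpose 0 j"
    have \<tau>: "?\<tau> permutes {..<n}" using j by (intro permutes_swap_id) auto
    have "(\<Sum>\<sigma> | \<sigma> permutes {..<n}. ?t \<sigma> j) = (\<Sum>\<sigma> | \<sigma> permutes {..<n}. ?t (\<sigma> \<circ> ?\<tau>) j)"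
      using sum_permutations_compose_right[OF \<tau>, of "\<lambda>\<sigma>. ?t \<sigma> j"] by simp
    also have "\<dots> = (\<Sum>\<sigma> | \<sigma> permutes {..<n}. - ?t \<sigma> j)"
    proof (rule sum.cong[OF refl])
      fix \<sigma>
      have "map (\<lambda>i. us ! (\<sigma> \<circ> ?\<tau>) i) (remove1 j [1..<n]) = map (\<lambda>i. us ! \<sigma> i) (remove1 j [1..<n])"
        by (rule map_cong) (auto simp: transpose_def)
      moreover have "omega (us ! (\<sigma> \<circ> ?\<tau>) 0) (us ! (\<sigma> \<circ> ?\<tau>) j) = - omega (us ! \<sigma> 0) (us ! \<sigma> j)"
        using omega_flip[of "us ! \<sigma> j" "us ! \<sigma> 0"] by simp
      ultimately show "?t (\<sigma> \<circ> ?\<tau>) j = - ?t \<sigma> j" by (simp only: mult_minus_left)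
    qed
    finally show ?thesis by (simp add: sum_negf)
  qed
  have "(\<Sum>\<sigma> | \<sigma> permutes {..<n}. wick (map (\<lambda>i. us ! \<sigma> i) [0..<n]))
      = (\<Sum>\<sigma> | \<sigma> permutes {..<n}. \<Sum>j\<in>{1..<n}. ?t \<sigma> j) / 2"
    unfolding n list.map wick.simps by (simp add: contract_map[of "[1..<n]"] sum_divide_distrib del: One_nat_def)
  also have "\<dots> = 0" by (subst sum.swap) (simp add: 0 del: One_nat_def)
  finally show ?thesis by (simp add: n_def)
qed


section \<open>Descent of the contraction functional to the Weyl algebra\<close>

definition free_wick :: "'n::finite phase free_alg \<Rightarrow> complex" where
  "free_wick p = (\<Sum>us\<in>Poly_Mapping.keys p. Poly_Mapping.lookup p us * wick us)"

lemma free_wick_superset: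
  assumes "finite S" "Poly_Mapping.keys p \<subseteq> S"
  shows "free_wick p = (\<Sum>us\<in>S. Poly_Mapping.lookup p us * wick us)"
  unfolding free_wick_def
  by (rule sum.mono_neutral_left) (use assms in \<open>auto simp: in_keys_iff\<close>)

lemma free_wick_add: "free_wick (p + q) = free_wick p + free_wick q"
proof -
  let ?S = "Poly_Mapping.keys p \<union> Poly_Mapping.keys q"
  have "Poly_Mapping.keys (p + q) \<subseteq> ?S" by (rule Poly_Mapping.keys_add)
  then show ?thesis
    by (simp add: free_wick_superset[of ?S] lookup_add distrib_right sum.distrib)
qed

lemma free_wick_0: "free_wick 0 = 0"
  by (simp add: free_wick_def)

lemma free_wick_diff: "free_wick (p - q) = free_wick p - free_wick q"
  using free_wick_add[of "p - q" q] by simp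

lemma free_wick_single: "free_wick (Poly_Mapping.single us c) = c * wick us"
  by (subst free_wick_superset[of "{us}"]) auto

text \<open>The kernel of \<open>free_wick\<close> need not be an ideal, but \<open>K\<close>, the
  elements all of whose two-sided monomial multiples lie in it, is one. It contains the linearity
  relations by \<open>wick_combine\<close> and the commutation relations by
  \<open>wick_swap\<close>.\<close>

lemma free_wick_weyl_ideal:
  assumes "p \<in> weyl_ideal"
  shows "free_wick p = 0"
proof -
  define K where "K = {p :: 'a phase free_alg. \<forall>u a v b.
    free_wick (Poly_Mapping.single u a * p * Poly_Mapping.single v b) = 0}"
  have left: "Poly_Mapping.single w c * p \<in> K" if "p \<in> K" for p w c
    using that unfolding K_def by (simp add: mult_single flip: mult.assoc)
  have right: "p * Poly_Mapping.single w c \<in> K" if "p \<in> K" for p w c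
    using that unfolding K_def by (simp add: mult_single mult.assoc)
  have K_add: "p + q \<in> K" if "p \<in> K" "q \<in> K" for p q
    using that unfolding K_def by (simp add: algebra_simps free_wick_add)
  have "two_sided_ideal K"
    unfolding two_sided_ideal_def
  proof (intro conjI ballI allI)
    show "0 \<in> K" by (simp add: K_def free_wick_0)
    show "p - q \<in> K" if "p \<in> K" "q \<in> K" for p q
      using that unfolding K_def by (simp add: algebra_simps free_wick_diff)
    show "a * p \<in> K" if "p \<in> K" for a p
      by (induction a rule: poly_mapping_single_induct) (auto simp: left that distrib_right intro: K_add)
    show "p * a \<in> K" if "p \<in> K" for a p
      by (induction a rule: poly_mapping_single_induct) (auto simp: right that distrib_left intro: K_add)
  qed
  moreover have "linearity_relations \<union> {fgen u * fgen v - fgen v * fgen u - fconst (omega u v) | u v. True} \<subseteq> K"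
  proof -
    note expand = left_diff_distrib right_diff_distrib mult_single free_wick_diff
      free_wick_single plus_list_def append_assoc append_Cons append_Nil mult_1_left mult_1_right
    have "fgen (x + y) - fgen x - fgen y \<in> K" for x y
      unfolding K_def fgen_def mem_Collect_eq expand
      using wick_combine[of "x + y" 1 x 1 y] by (simp add: omega_add algebra_simps)
    moreover have "fgen (phase_scale c x) - fconst c * fgen x \<in> K" for c x
      unfolding K_def fgen_def fconst_def mem_Collect_eq expand
      using wick_combine[of "phase_scale c x" c x 0 x] by (simp add: omega_scale algebra_simps)
    moreover have "fgen x * fgen y - fgen y * fgen x - fconst (omega x y) \<in> K" for x y
      unfolding K_def fgen_def fconst_def mem_Collect_eq expand
      by (simp add: wick_swap[of _ x y] algebra_simps)
    ultimately show ?thesis unfolding linearity_relations_def by blast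
  qed
  ultimately have "p \<in> K"
    using assms ideal_generated_minimal unfolding weyl_ideal_def by blast
  then have "free_wick (Poly_Mapping.single 0 1 * p * Poly_Mapping.single 0 1) = 0"
    unfolding K_def by blast
  then show ?thesis by simp
qed

lift_definition vacuum :: "'n::finite weyl_alg \<Rightarrow> complex" is free_wick
proof -
  fix p q :: "'n phase free_alg" assume "ideal_cong weyl_ideal p q"
  then show "free_wick p = free_wick q"
    using free_wick_weyl_ideal[of "p - q"] by (simp add: ideal_cong_def free_wick_diff)
qed

lemma vacuum_add: "vacuum (x + y) = vacuum x + vacuum y"
  by transfer (rule free_wick_add)

lemma vacuum_0: "vacuum 0 = 0"
  by transfer (rule free_wick_0)

lemma vacuum_sum: "vacuum (sum f A) = (\<Sum>a\<in>A. vacuum (f a))"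
  by (induction A rule: infinite_finite_induct) (simp_all add: vacuum_add vacuum_0)

lemma vacuum_scale: "vacuum (weyl_scale c x) = c * vacuum x"
proof transfer
  fix c and x :: "'a phase free_alg"
  show "free_wick (fconst c * x) = c * free_wick x"
    by (induction x rule: poly_mapping_single_induct)
      (simp_all add: fconst_def mult_single free_wick_single plus_list_def distrib_left free_wick_add)
qed

lemma weyl_word: "prod_list (map weyl_gen us) = abs_weyl_alg (Poly_Mapping.single us 1)"
proof -
  have "prod_list (map weyl_gen us) = abs_weyl_alg (prod_list (map fgen us))"
    by (induction us) (simp_all add: one_weyl_alg_def times_weyl_alg.abs_eq weyl_gen.abs_eq)
  then show ?thesis by (simp add: fgen_prod_list)
qed

lemma vacuum_prod_list: "vacuum (prod_list (map weyl_gen us)) = wick us"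
  by (simp add: weyl_word vacuum.abs_eq free_wick_single)

lemma vacuum_symmetrized: "vacuum (symmetrized us) = (if us = [] then 1 else 0)"
proof -
  have "vacuum (symmetrized us) = (\<Sum>\<sigma> | \<sigma> permutes {..<length us}.
      wick (map (\<lambda>i. us ! \<sigma> i) [0..<length us])) / fact (length us)"
    using vacuum_prod_list[of "map (\<lambda>i. us ! _ i) [0..<length us]"]
    by (simp add: symmetrized_def vacuum_scale vacuum_sum o_def)
  then show ?thesis using sum_permutations_wick[of us] by auto
qed

lemma symmetrization_add: "symmetrization (x + y) = symmetrization x + symmetrization y"
  by transfer (rule free_symmetrize_add)

lemma symmetrization_0: "symmetrization 0 = 0"
  by transfer (rule free_symmetrize_0)

lemma symmetrization_scale: "symmetrization (sym_scale c x) = weyl_scale c (symmetrization x)"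
proof transfer
  fix c and x :: "'a phase free_alg"
  show "free_symmetrize (fconst c * x) = weyl_scale c (free_symmetrize x)"
    by (induction x rule: poly_mapping_single_induct)
      (simp_all add: fconst_def mult_single free_symmetrize_single plus_list_def distrib_left
        free_symmetrize_add weyl_scale_scale weyl_scale_add)
qed

text \<open>Degree 0 becomes readable in the Weyl algebra: only the empty word survives, on both
  sides.\<close>

lemma vacuum_symmetrization: "vacuum (symmetrization y) = sym_degree0 y"
proof transfer
  fix p :: "'a phase free_alg"
  show "vacuum (free_symmetrize p) = Poly_Mapping.lookup p []"
  proof (induction p rule: poly_mapping_single_induct)
    case (single w c)
    show ?case by (simp add: free_symmetrize_single vacuum_scale vacuum_symmetrized lookup_single when_def)
  qed (simp add: free_symmetrize_add vacuum_add lookup_add)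
qed

section \<open>Surjectivity of symmetrization, by induction on word length\<close>

lemma weyl_gen_commute:
  "weyl_gen x * weyl_gen y = weyl_gen y * weyl_gen x + weyl_scale (omega x y) 1"
proof transfer
  fix x y :: "'a phase"
  have "fgen x * fgen y - fgen y * fgen x - fconst (omega x y) \<in> weyl_ideal"
    unfolding weyl_ideal_def by (rule subsetD[OF ideal_generated_superset]) blast
  then show "ideal_cong weyl_ideal (fgen x * fgen y) (fgen y * fgen x + fconst (omega x y) * 1)"
    by (simp add: ideal_cong_def diff_diff_eq)
qed


lemma range_symmetrization_add:
  "x \<in> range symmetrization \<Longrightarrow> y \<in> range symmetrization \<Longrightarrow> x + y \<in> range symmetrization"
  by (auto simp flip: symmetrization_add)

lemma range_symmetrization_scale:
  "x \<in> range symmetrization \<Longrightarrow> weyl_scale c x \<in> range symmetrization"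
  by (auto simp flip: symmetrization_scale)

lemma range_symmetrization_sum:
  "(\<And>a. a \<in> A \<Longrightarrow> f a \<in> range symmetrization) \<Longrightarrow> sum f A \<in> range symmetrization"
proof (induction A rule: infinite_finite_induct)
  case (insert a A)
  then show ?case by (simp add: range_symmetrization_add)
qed (use symmetrization_0 in \<open>auto intro: range_eqI[of _ _ 0]\<close>)

lemma weyl_scale_minus_one: "weyl_scale (- 1) x = - x"
proof -
  have "weyl_scale (- 1) x + x = 0"
    using weyl_scale_add_left[of "-1" 1 x] by (simp add: weyl_scale_1 weyl_scale_0)
  then show ?thesis by (simp add: eq_neg_iff_add_eq_0)
qed

lemma weyl_scale_diff: "weyl_scale c (x - y) = weyl_scale c x - weyl_scale c y"
  using weyl_scale_add[of c "x - y" y] by simp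

lemma weyl_sum_const: "finite A \<Longrightarrow> (\<Sum>a\<in>A. x) = weyl_scale (of_nat (card A)) x"
  by (induction A rule: finite_induct) (simp_all add: weyl_scale_0 weyl_scale_add_left weyl_scale_1)

lemma range_symmetrization_diff:
  "x \<in> range symmetrization \<Longrightarrow> y \<in> range symmetrization \<Longrightarrow> x - y \<in> range symmetrization"
  using range_symmetrization_add[of x "weyl_scale (-1) y"] range_symmetrization_scale[of y "-1"]
  by (simp add: weyl_scale_minus_one)

context
  fixes n :: nat
  assumes shorter: "\<And>us :: 'n::finite phase list. length us < n \<Longrightarrow>
    prod_list (map weyl_gen us) \<in> range symmetrization"
begin

text \<open>Each exchange of neighbours costs a multiple of a word two letters shorter, which lies
  in the range by \<open>shorter\<close>.\<close>

lemma word_move_front: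
  "length (us @ x # vs) \<le> n \<Longrightarrow>
    prod_list (map weyl_gen (us @ x # vs)) - prod_list (map weyl_gen (x # us @ vs))
      \<in> range (symmetrization :: 'n sym_alg \<Rightarrow> _)"
proof (induction us arbitrary: vs rule: rev_induct)
  case Nil
  show ?case using symmetrization_0 by (auto intro: range_eqI[of _ _ 0])
next
  case (snoc u us)
  have "prod_list (map weyl_gen ((us @ [u]) @ x # vs)) - prod_list (map weyl_gen (x # (us @ [u]) @ vs))
     = (prod_list (map weyl_gen (us @ x # u # vs)) - prod_list (map weyl_gen (x # us @ u # vs)))
       + weyl_scale (omega u x) (prod_list (map weyl_gen (us @ vs)))"
  proof -
    have "weyl_gen u * (weyl_gen x * z) = weyl_gen x * (weyl_gen u * z) + weyl_scale (omega u x) z" for z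
      using arg_cong[OF weyl_gen_commute[of u x], of "\<lambda>t. t * z"]
      by (simp add: distrib_right weyl_scale_mult_left mult.assoc)
    then show ?thesis by (simp add: distrib_left weyl_scale_mult_right)
  qed
  moreover have "prod_list (map weyl_gen (us @ x # u # vs)) - prod_list (map weyl_gen (x # us @ u # vs))
      \<in> range (symmetrization :: 'n sym_alg \<Rightarrow> _)"
    by (rule snoc.IH) (use snoc.prems in simp)
  moreover have "prod_list (map weyl_gen (us @ vs)) \<in> range (symmetrization :: 'n sym_alg \<Rightarrow> _)"
    by (rule shorter) (use snoc.prems in simp)
  ultimately show ?case
    by (simp only: range_symmetrization_add range_symmetrization_scale)
qed

text \<open>With the prefix \<open>us\<close> settled, the head x of \<open>xs\<close> is matched
  with its occurrence in \<open>ys\<close>: the tails are compared under the longer prefix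
  \<open>us @ [x]\<close>, and the two places of x through the word in which x comes first.\<close>

lemma word_permute:
  "mset xs = mset ys \<Longrightarrow> length (us @ xs) \<le> n \<Longrightarrow>
    prod_list (map weyl_gen (us @ xs)) - prod_list (map weyl_gen (us @ ys))
      \<in> range (symmetrization :: 'n sym_alg \<Rightarrow> _)"
proof (induction xs arbitrary: us ys)
  case Nil
  then show ?case using symmetrization_0 by (auto intro: range_eqI[of _ _ 0])
next
  case (Cons x xs)
  have "x \<in> set ys" using Cons.prems(1) by (metis list.set_intros(1) mset_eq_setD)
  then obtain as bs where ys: "ys = as @ x # bs" by (meson split_list)
  have ms: "mset xs = mset (as @ bs)" using Cons.prems(1) ys by simp
  have len: "length xs = length as + length bs"
    using arg_cong[OF ms, of size] by simp
  have a: "prod_list (map weyl_gen ((us @ [x]) @ xs)) - prod_list (map weyl_gen ((us @ [x]) @ as @ bs))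
      \<in> range (symmetrization :: 'n sym_alg \<Rightarrow> _)"
    by (rule Cons.IH[OF ms]) (use Cons.prems in simp)
  have b: "prod_list (map weyl_gen ((us @ as) @ x # bs)) - prod_list (map weyl_gen (x # (us @ as) @ bs))
      \<in> range (symmetrization :: 'n sym_alg \<Rightarrow> _)"
    by (rule word_move_front) (use Cons.prems len in simp)
  have c: "prod_list (map weyl_gen (us @ x # as @ bs)) - prod_list (map weyl_gen (x # us @ as @ bs))
      \<in> range (symmetrization :: 'n sym_alg \<Rightarrow> _)"
    by (rule word_move_front) (use Cons.prems len in simp)
  have "prod_list (map weyl_gen (us @ x # xs)) - prod_list (map weyl_gen (us @ ys)) =
    (prod_list (map weyl_gen ((us @ [x]) @ xs)) - prod_list (map weyl_gen ((us @ [x]) @ as @ bs)))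
    - ((prod_list (map weyl_gen ((us @ as) @ x # bs)) - prod_list (map weyl_gen (x # (us @ as) @ bs)))
      - (prod_list (map weyl_gen (us @ x # as @ bs)) - prod_list (map weyl_gen (x # us @ as @ bs))))"
    by (simp add: ys mult.assoc)
  then show ?case using a b c range_symmetrization_diff by metis
qed

end

text \<open>A word minus its symmetrization is the mean of its differences from its rearrangements;
  these lie in the range by \<open>word_permute\<close>, and so does the symmetrization.\<close>

lemma word_in_range_symmetrization: "prod_list (map weyl_gen us) \<in> range symmetrization"
proof (induction "length us" arbitrary: us rule: less_induct)
  case (less us)
  let ?n = "length us" and ?w = "\<lambda>us. prod_list (map weyl_gen us)"
  let ?p = "\<lambda>\<sigma>. map (\<lambda>i. us ! \<sigma> i) [0..<length us]"
  have p: "mset us = mset (?p \<sigma>)" if "\<sigma> permutes {..<?n}" for \<sigma>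
    using mset_permute_list[OF that] by (simp add: permute_list_def)
  have "?w us - ?w (?p \<sigma>) \<in> range symmetrization" if "\<sigma> permutes {..<?n}" for \<sigma>
    using word_permute[of ?n us "?p \<sigma>" "[]"] less p[OF that] by simp
  then have "(\<Sum>\<sigma> | \<sigma> permutes {..<?n}. ?w us - ?w (?p \<sigma>)) \<in> range symmetrization"
    by (intro range_symmetrization_sum) blast
  then have "weyl_scale (1 / fact ?n) (\<Sum>\<sigma> | \<sigma> permutes {..<?n}. ?w us - ?w (?p \<sigma>)) \<in> range symmetrization"
    by (rule range_symmetrization_scale)
  moreover have "weyl_scale (1 / fact ?n) (\<Sum>\<sigma> | \<sigma> permutes {..<?n}. ?w us - ?w (?p \<sigma>))
      = ?w us - symmetrized us"
  proof -
    have "(\<Sum>\<sigma> | \<sigma> permutes {..<?n}. ?w us) = weyl_scale (fact ?n) (?w us)"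
      by (simp add: weyl_sum_const finite_permutations card_permutations)
    then show ?thesis
      by (simp only: sum_subtractf weyl_scale_diff weyl_scale_scale symmetrized_def map_map o_def)
        (simp add: weyl_scale_1)
  qed
  moreover have "symmetrized us \<in> range symmetrization"
    by (metis rangeI symmetrization_prod_list)
  ultimately show ?case
    using range_symmetrization_add[of "?w us - symmetrized us" "symmetrized us"] by simp
qed

lemma symmetrization_surj: "surj symmetrization"
proof (intro equalityI subset_UNIV subsetI)
  fix x :: "'a weyl_alg"
  have "abs_weyl_alg p \<in> range symmetrization" for p :: "'a phase free_alg"
  proof (induction p rule: poly_mapping_single_induct)
    case (single w c)
    have "abs_weyl_alg (Poly_Mapping.single w c) = weyl_scale c (prod_list (map weyl_gen w))"
      by (simp add: weyl_word weyl_scale.abs_eq fconst_def mult_single plus_list_def)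
    then show ?case by (simp add: word_in_range_symmetrization range_symmetrization_scale)
  next
    case (add p q)
    then show ?case by (simp add: range_symmetrization_add flip: plus_weyl_alg.abs_eq)
  qed
  then show "x \<in> range symmetrization"
    by (rule weyl_alg.abs_induct[of "\<lambda>x. x \<in> range symmetrization"])
qed

text \<open>By surjectivity \<open>eta x\<close> is some preimage of \<open>x\<close>, and all
  preimages have the same degree 0 by \<open>vacuum_symmetrization\<close>.\<close>

lemma degree0_eq_vacuum: "degree0 x = vacuum x"
proof -
  have "symmetrization (eta x) = x"
    unfolding eta_def by (rule surj_f_inv_f[OF symmetrization_surj])
  then show ?thesis
    using vacuum_symmetrization[of "eta x"] by (simp add: degree0_def)
qed


section \<open>The functional on squares of commutators of reflections\<close>

lemma cpair_axis: "cpair (axis i 1) v = v $ i" "cpair l (axis i 1) = l $ i"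
  by (simp_all add: cpair_def axis_def if_distrib if_distribR sum.delta cong: if_cong)

lemma cpair_0: "cpair 0 v = 0" "cpair l 0 = 0"
  by (simp_all add: cpair_def)

text \<open>Of the three matchings the one joining x with y vanishes by isotropy. A vector before a
  covector contracts with a minus sign; the matching x-l, y-m has two such signs, the nested one
  x-m, l-y only one.\<close>

lemma vacuum_quartic:
  "vacuum (weyl_gen (x, 0) * weyl_gen (0, l) * (weyl_gen (y, 0) * weyl_gen (0, m)))
    = (cpair l x * cpair m y - cpair m x * cpair l y) / 4"
proof -
  have "vacuum (weyl_gen (x, 0) * weyl_gen (0, l) * (weyl_gen (y, 0) * weyl_gen (0, m)))
      = wick [(x, 0), (0, l), (y, 0), (0, m)]"
    using vacuum_prod_list[of "[(x, 0), (0, l), (y, 0), (0, m)]"] by (simp add: mult.assoc)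
  then show ?thesis by (simp add: omega_def cpair_0 field_simps)
qed

text \<open>For linear \<open>f\<close> this is ((tr f)^2 - tr (f^2)) / 4, written in matrix
  entries.\<close>

lemma vacuum_nu'_square:
  "vacuum ((nu' f)\<^sup>2) =
    ((\<Sum>i\<in>UNIV. f (axis i 1) $ i)\<^sup>2 - (\<Sum>i\<in>UNIV. \<Sum>j\<in>UNIV. f (axis i 1) $ j * f (axis j 1) $ i)) / 4"
  unfolding power2_eq_square nu'_def sum_product vacuum_sum vacuum_quartic cpair_axis
  by (simp add: sum_subtractf diff_divide_distrib sum_divide_distrib)

lemma cpair_cvec: "cpair (cvec a) (cvec v) = complex_of_real (a \<bullet> v)"
  by (simp add: cpair_def cvec_def inner_vec_def)

lemma sum_cvec: "(\<Sum>i\<in>UNIV. complex_of_real (v $ i) * complex_of_real (a $ i)) = complex_of_real (a \<bullet> v)"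
  by (simp add: inner_vec_def mult.commute)

text \<open>The identity and the terms from a single reflection cancel, so the commutator has rank
  at most two and its traces reduce to the pairings of two roots with two coroots.\<close>

lemma commutator_crefl:
  assumes "a \<bullet> co a = 2" "b \<bullet> co b = 2"
  shows "commutator (crefl co a) (crefl co b) (axis j 1) $ i =
    complex_of_real (a \<bullet> co b) * complex_of_real (b $ j) * complex_of_real (co a $ i) -
    complex_of_real (b \<bullet> co a) * complex_of_real (a $ j) * complex_of_real (co b $ i)"
proof -
  have lin: "cpair l (x - y) = cpair l x - cpair l y" "cpair l (c *s x) = c * cpair l x" for l x y :: "complex^'n" and c
    by (simp_all add: cpair_def algebra_simps sum_subtractf sum_distrib_left)
  show ?thesis
    unfolding commutator_def crefl_def
    by (simp add: lin cpair_cvec cpair_axis) (simp add: cvec_def algebra_simps)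
qed

text \<open>The commutator has trace 0, and its square has trace 2 p (p - 4): the four products of
  rank one terms contribute p^2, -4 p, -4 p and p^2.\<close>

lemma vacuum_commutator:
  assumes "a \<bullet> co a = 2" "b \<bullet> co b = 2"
  defines "p \<equiv> (a \<bullet> co b) * (b \<bullet> co a)"
  shows "vacuum ((nu' (commutator (crefl co a) (crefl co b)))\<^sup>2) = complex_of_real (p * (4 - p) / 2)"
proof -
  define A where "A = complex_of_real (a \<bullet> co b)"
  define B where "B = complex_of_real (b \<bullet> co a)"
  have s: "(\<Sum>i\<in>UNIV. complex_of_real (b $ i) * complex_of_real (co a $ i)) = B"
    "(\<Sum>i\<in>UNIV. complex_of_real (a $ i) * complex_of_real (co b $ i)) = A"
    "(\<Sum>i\<in>UNIV. complex_of_real (b $ i) * complex_of_real (co b $ i)) = 2"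
    "(\<Sum>i\<in>UNIV. complex_of_real (a $ i) * complex_of_real (co a $ i)) = 2"
    using sum_cvec[of "co a" b] sum_cvec[of "co b" a] sum_cvec[of "co b" b] sum_cvec[of "co a" a] assms(1,2)
    by (simp_all add: A_def B_def mult.commute)
  let ?f = "\<lambda>i j. A * complex_of_real (b $ i) * complex_of_real (co a $ j) -
    B * complex_of_real (a $ i) * complex_of_real (co b $ j)"
  have tr: "(\<Sum>i\<in>UNIV. ?f i i) = 0"
  proof -
    have "(\<Sum>i\<in>UNIV. ?f i i) = A * (\<Sum>i\<in>UNIV. b $ i * co a $ i) - B * (\<Sum>i\<in>UNIV. a $ i * co b $ i)"
      by (simp add: sum_subtractf sum_distrib_left mult.assoc)
    then show ?thesis by (simp add: s)
  qed
  have "(\<Sum>i\<in>UNIV. \<Sum>j\<in>UNIV. ?f i j * ?f j i) =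
     A\<^sup>2 * ((\<Sum>i\<in>UNIV. b $ i * co a $ i) * (\<Sum>i\<in>UNIV. b $ i * co a $ i))
     - A * B * ((\<Sum>i\<in>UNIV. b $ i * co b $ i) * (\<Sum>i\<in>UNIV. a $ i * co a $ i))
     - A * B * ((\<Sum>i\<in>UNIV. a $ i * co a $ i) * (\<Sum>i\<in>UNIV. b $ i * co b $ i))
     + B\<^sup>2 * ((\<Sum>i\<in>UNIV. a $ i * co b $ i) * (\<Sum>i\<in>UNIV. a $ i * co b $ i))"
    unfolding sum_product
    by (simp add: sum_distrib_left flip: sum_subtractf sum.distrib)
      (intro sum.cong refl, simp add: algebra_simps power2_eq_square)
  also have "\<dots> = 2 * (A * B) * (A * B - 4)"
    by (simp add: s) (simp add: power2_eq_square algebra_simps)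
  finally have sq: "(\<Sum>i\<in>UNIV. \<Sum>j\<in>UNIV. ?f i j * ?f j i) = 2 * (A * B) * (A * B - 4)" .
  have p: "complex_of_real p = A * B" by (simp add: p_def A_def B_def)
  show ?thesis
    unfolding vacuum_nu'_square commutator_crefl[where co = co, OF assms(1,2)] A_def[symmetric] B_def[symmetric] tr sq
    by (simp add: p field_simps)
qed

lemma degree0_nu'_Omega:
  assumes "\<And>a. a \<in> P \<Longrightarrow> a \<bullet> co a = 2"
  shows "degree0 (nu'_Omega P co B k) = (\<Sum>a\<in>P. \<Sum>b\<in>P. k a * k b *
     complex_of_real ((a \<bullet> co b) * (b \<bullet> co a) * (4 - (a \<bullet> co b) * (b \<bullet> co a)) / (32 * B (co a) (co b))))"
  unfolding degree0_eq_vacuum nu'_Omega_def vacuum_scale vacuum_sum sum_distrib_left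
  by (intro sum.cong refl) (simp add: vacuum_commutator[where co = co] assms field_simps)


section \<open>Pairs of roots\<close>

text \<open>Coroots are eliminated: \<open>2 * D a b / D b b\<close> stands for the pairing of
  \<open>a\<close> with the coroot of \<open>b\<close>. \<open>D\<close> is kept apart from the
  inner product of the type, whose standard basis later serves to take a trace.\<close>

locale euclidean_root_system =
  fixes \<Phi> :: "'a::euclidean_space set" and D :: "'a \<Rightarrow> 'a \<Rightarrow> real"
  assumes bilinear_D: "bilinear D"
    and D_sym: "D u v = D v u"
    and D_pos: "v \<noteq> 0 \<Longrightarrow> D v v > 0"
    and finite_roots: "finite \<Phi>"
    and zero_not_root: "0 \<notin> \<Phi>"
    and span_roots: "span \<Phi> = UNIV"
    and reflect_root: "a \<in> \<Phi> \<Longrightarrow> b \<in> \<Phi> \<Longrightarrow> a - (2 * D a b / D b b) *\<^sub>R b \<in> \<Phi>"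
    and cartan_Ints: "a \<in> \<Phi> \<Longrightarrow> b \<in> \<Phi> \<Longrightarrow> 2 * D a b / D b b \<in> \<int>"
    and reduced: "a \<in> \<Phi> \<Longrightarrow> c *\<^sub>R a \<in> \<Phi> \<Longrightarrow> c = 1 \<or> c = -1"
begin

definition cartan :: "'a \<Rightarrow> 'a \<Rightarrow> real" where
  "cartan a b = 2 * D a b / D b b"

definition reflect :: "'a \<Rightarrow> 'a \<Rightarrow> 'a" where
  "reflect b a = a - cartan a b *\<^sub>R b"

lemma D_simps:
  "D (u + v) w = D u w + D v w" "D u (v + w) = D u v + D u w"
  "D (u - v) w = D u w - D v w" "D u (v - w) = D u v - D u w"
  "D (c *\<^sub>R u) v = c * D u v" "D u (c *\<^sub>R v) = c * D u v"
  "D (- u) v = - D u v" "D u (- v) = - D u v" "D 0 v = 0" "D u 0 = 0"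
  using bilinear_D
  by (simp_all add: bilinear_ladd bilinear_radd bilinear_lsub bilinear_rsub bilinear_lmul bilinear_rmul
      bilinear_lneg bilinear_rneg bilinear_lzero bilinear_rzero)

lemma D_sum_left: "D (sum f A) v = (\<Sum>i\<in>A. D (f i) v)"
  by (induction A rule: infinite_finite_induct) (simp_all add: D_simps)

lemma D_sum_right: "D v (sum f A) = (\<Sum>i\<in>A. D v (f i))"
  by (induction A rule: infinite_finite_induct) (simp_all add: D_simps)

lemma root_nonzero: "a \<in> \<Phi> \<Longrightarrow> a \<noteq> 0"
  using zero_not_root by auto

lemma D_root_pos: "a \<in> \<Phi> \<Longrightarrow> D a a > 0"
  using D_pos root_nonzero by blast

lemma reflect_in_roots: "a \<in> \<Phi> \<Longrightarrow> b \<in> \<Phi> \<Longrightarrow> reflect b a \<in> \<Phi>"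
  using reflect_root by (simp add: reflect_def cartan_def)

lemma reflect_self: "b \<in> \<Phi> \<Longrightarrow> reflect b b = - b"
  using D_root_pos[of b] by (simp add: reflect_def cartan_def scaleR_2)

lemma uminus_root: "a \<in> \<Phi> \<Longrightarrow> - a \<in> \<Phi>"
  using reflect_in_roots[of a a] by (simp add: reflect_self)

lemma D_reflect:
  assumes "b \<in> \<Phi>" shows "D (reflect b u) (reflect b v) = D u v"
  using D_root_pos[OF assms] D_sym[of b u] D_sym[of b v]
  by (simp add: reflect_def cartan_def D_simps field_simps)

lemma reflect_reflect: "b \<in> \<Phi> \<Longrightarrow> reflect b (reflect b u) = u"
  using D_root_pos[of b] by (simp add: reflect_def cartan_def D_simps field_simps)

lemma linear_reflect: "linear (reflect b)"
  by (rule linearI) (simp_all add: reflect_def cartan_def D_simps algebra_simps add_divide_distrib)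

lemma cartan_product: "cartan a b * cartan b a = 4 * (D a b)\<^sup>2 / (D a a * D b b)"
  using D_sym[of a b] by (simp add: cartan_def power2_eq_square)

text \<open>Strict Cauchy-Schwarz, from the squared length of the part of \<open>a\<close>
  orthogonal to \<open>b\<close>; equality would make \<open>a\<close> a positive multiple of
  \<open>b\<close>, hence \<open>b\<close> itself by reducedness.\<close>

lemma cartan_product_less_4:
  assumes ab: "a \<in> \<Phi>" "b \<in> \<Phi>" "D a b > 0" "a \<noteq> b"
  shows "cartan a b * cartan b a < 4"
proof -
  define c where "c = D a b / D b b"
  have Dbb: "D b b > 0" and Daa: "D a a > 0" using ab D_root_pos by auto
  have "a \<noteq> c *\<^sub>R b"
  proof
    assume a: "a = c *\<^sub>R b"
    then have "c = 1 \<or> c = -1" using reduced ab by metis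
    moreover have "c > 0" using ab Dbb by (simp add: c_def)
    ultimately show False using a ab by auto
  qed
  then have "0 < D (a - c *\<^sub>R b) (a - c *\<^sub>R b)" by (intro D_pos) simp
  also have "\<dots> = D a a - (D a b)\<^sup>2 / D b b"
    using Dbb D_sym[of b a] by (simp add: D_simps c_def power2_eq_square field_simps)
  finally have "(D a b)\<^sup>2 < D a a * D b b" using Dbb by (simp add: field_simps)
  then show ?thesis using Daa Dbb by (simp add: cartan_product divide_simps)
qed

text \<open>Two positive integers with product below 4: one of them is 1 and the other at most
  3.\<close>

lemma acute_cases:
  assumes ab: "a \<in> \<Phi>" "b \<in> \<Phi>" "D a b > 0" "a \<noteq> b"
  obtains "cartan a b = 1" "cartan b a = 1" | "cartan a b = 1" "cartan b a = 2"
    | "cartan a b = 2" "cartan b a = 1" | "cartan a b = 1" "cartan b a = 3"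
    | "cartan a b = 3" "cartan b a = 1"
proof -
  obtain m where m: "cartan a b = of_int m" using cartan_Ints[OF ab(1,2)] by (auto simp: cartan_def elim: Ints_cases)
  obtain m' where m': "cartan b a = of_int m'" using cartan_Ints[OF ab(2,1)] by (auto simp: cartan_def elim: Ints_cases)
  have "cartan a b > 0" "cartan b a > 0"
    using ab D_root_pos D_sym[of a b] by (auto simp: cartan_def)
  then have pos: "m \<ge> 1" "m' \<ge> 1" using m m' by auto
  have "real_of_int (m * m') < 4" using cartan_product_less_4[OF ab] m m' by simp
  then have lt: "m * m' < 4" by linarith
  have "m * 1 \<le> m * m'" "1 * m' \<le> m * m'" using pos by (intro mult_mono; simp)+
  then have "m < 4" "m' < 4" using lt by linarith+
  then have "m = 1 \<or> m = 2 \<or> m = 3" "m' = 1 \<or> m' = 2 \<or> m' = 3" using pos by linarith+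
  then show ?thesis using m m' lt that by auto
qed

definition acute :: "real \<Rightarrow> ('a \<times> 'a) set" where
  "acute p = {(a, b). a \<in> \<Phi> \<and> b \<in> \<Phi> \<and> D a b > 0 \<and> cartan a b * cartan b a = p}"

text \<open>The pair \<open>(a, b)\<close> is sent to \<open>(b, c)\<close> with \<open>c\<close> the mirror image of \<open>a\<close> in the line of \<open>b\<close>.\<close>

definition turn :: "'a \<times> 'a \<Rightarrow> 'a \<times> 'a" where
  "turn x = (snd x, - reflect (snd x) (fst x))"

lemma finite_acute: "finite (acute p)"
  by (rule finite_subset[of _ "\<Phi> \<times> \<Phi>"]) (auto simp: acute_def finite_roots)

lemma turn_data:
  assumes "b \<in> \<Phi>"
  shows "D b (- reflect b a) = D a b" "cartan b (- reflect b a) = cartan b a"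
    "cartan (- reflect b a) b = cartan a b"
proof -
  have 1: "D b (- reflect b a) = D a b"
    using D_root_pos[OF assms] D_sym[of a b] by (simp add: reflect_def cartan_def D_simps field_simps)
  have 2: "D (- reflect b a) (- reflect b a) = D a a"
    using D_reflect[OF assms] by (simp add: D_simps)
  show "D b (- reflect b a) = D a b" by fact
  show "cartan b (- reflect b a) = cartan b a" "cartan (- reflect b a) b = cartan a b"
    using 1 2 D_sym[of a b] D_sym[of b "- reflect b a"] by (simp_all only: cartan_def)
qed

lemma turn_acute: "x \<in> acute p \<Longrightarrow> turn x \<in> acute p"
  by (cases x) (auto simp: acute_def turn_def turn_data uminus_root reflect_in_roots mult.commute)

lemma bij_betw_turn: "bij_betw turn (acute p) (acute p)"
proof -
  have "inj_on turn (acute p)"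
  proof (rule inj_onI)
    fix x y assume "x \<in> acute p" "y \<in> acute p" and eq: "turn x = turn y"
    then have "snd x \<in> \<Phi>" by (auto simp: acute_def)
    then show "x = y" using eq reflect_reflect by (metis turn_def neg_equal_iff_equal prod.collapse prod.inject)
  qed
  then show ?thesis
    using finite_acute turn_acute by (simp add: bij_betw_def endo_inj_surj image_subset_iff)
qed

text \<open>This is (m - 2) / m, with m = 3, 4, 6 turns to a half rotation: m - 1 pairs of sign 1
  and one of sign -1.\<close>

definition kappa :: "real \<Rightarrow> real" where
  "kappa p = (if p = 1 then 1/3 else if p = 2 then 1/2 else 2/3)"

context
  fixes l :: "'a \<Rightarrow> real"
  assumes linear_l: "linear l" and l_nonzero: "a \<in> \<Phi> \<Longrightarrow> l a \<noteq> 0"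
begin

definition pair_sign :: "'a \<times> 'a \<Rightarrow> real" where
  "pair_sign x = sgn (l (fst x)) * sgn (l (snd x))"

lemma l_simps: "l (u - v) = l u - l v" "l (- u) = - l u" "l (c *\<^sub>R u) = c * l u"
  using linear_l by (simp_all add: linear_diff linear_neg linear_scale)

text \<open>
  Turning \<open>m\<close> times leads from \<open>(a, b)\<close> to \<open>(- a, - b)\<close> with \<open>m\<close> = 3, 4, 6, and exactly one of the \<open>m\<close>
  pairs passed is separated by the hyperplane \<open>l = 0\<close>.
\<close>

lemma turn_sign_sum:
  assumes x: "x \<in> acute p" and "p = 1 \<and> m = 3 \<or> p = 2 \<and> m = 4 \<or> p = 3 \<and> m = 6"
  shows "(\<Sum>i<m. pair_sign ((turn ^^ i) x)) = real m - 2"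
proof -
  obtain a b where ab: "x = (a, b)" by (cases x)
  have "(turn ^^ i) x \<in> acute p" for i
    using x by (induction i) (auto intro: turn_acute)
  then have nz: "l (fst ((turn ^^ i) x)) \<noteq> 0" for i
    using l_nonzero by (metis (no_types, lifting) acute_def case_prodE fst_conv mem_Collect_eq)
  have a: "a \<in> \<Phi>" "b \<in> \<Phi>" "D a b > 0" "cartan a b * cartan b a = p"
    using x by (auto simp: ab acute_def)
  have "a \<noteq> b" using a assms(2) D_root_pos[of b] by (auto simp: cartan_def)
  define f where "f i = l (fst ((turn ^^ i) x))" for i
  have sign: "pair_sign ((turn ^^ i) x) = sgn (f i) * sgn (f (Suc i))" for i
    by (simp add: pair_sign_def f_def turn_def)
  have f0: "f 0 = l a" and f1: "f (Suc 0) = l b" by (simp_all add: f_def ab turn_def)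
  define c where "c i = cartan (fst ((turn ^^ i) x)) (snd ((turn ^^ i) x))" for i
  have inphi: "snd ((turn ^^ i) x) \<in> \<Phi>" for i
    using \<open>(turn ^^ i) x \<in> acute p\<close> by (auto simp: acute_def)
  \<comment> \<open>The mirror image of a in the line of b is \<open>cartan a b\<close> times b,
    minus a. So the values of \<open>l\<close> along the orbit obey a recurrence whose coefficients
    alternate between the two Cartan integers, and each case below is a sign check in
    \<open>l a\<close> and \<open>l b\<close> alone.\<close>
  have step: "f (Suc (Suc i)) = c i * f (Suc i) - f i" for i
    by (simp add: f_def c_def turn_def reflect_def l_simps)
  have c_eq: "c (i + 2) = c i \<and> c (Suc i) = cartan (snd ((turn ^^ i) x)) (fst ((turn ^^ i) x))" for i
    using inphi[of i] inphi[of "Suc i"] by (simp add: c_def turn_def turn_data)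
  have c: "c 0 = cartan a b" "c (Suc 0) = cartan b a" "\<And>i. c (Suc (Suc i)) = c i"
    using c_eq[of 0] c_eq by (auto simp: c_def ab turn_def)
  have nzf: "f i \<noteq> 0" for i using nz by (simp add: f_def)
  note fs = step c f0 f1 numeral_eq_Suc
  have nz': "f 0 \<noteq> 0" "f (Suc 0) \<noteq> 0" "f (Suc (Suc 0)) \<noteq> 0" "f (Suc (Suc (Suc 0))) \<noteq> 0" 
     "f (Suc (Suc (Suc (Suc 0)))) \<noteq> 0" "f (Suc (Suc (Suc (Suc (Suc 0))))) \<noteq> 0"
    using nzf by auto
  show ?thesis
  proof (rule acute_cases[OF a(1-3) \<open>a \<noteq> b\<close>])
    assume cc: "cartan a b = 1" "cartan b a = 1"
    then have "m = 3" using assms(2) a(4) by auto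
    then show ?thesis using nz' unfolding sign
      by (simp add: fs cc) (auto simp: sgn_if)
  next
    assume cc: "cartan a b = 1" "cartan b a = 2"
    then have "m = 4" using assms(2) a(4) by auto
    then show ?thesis using nz' unfolding sign
      by (simp add: fs cc) (auto simp: sgn_if)
  next
    assume cc: "cartan a b = 2" "cartan b a = 1"
    then have "m = 4" using assms(2) a(4) by auto
    then show ?thesis using nz' unfolding sign
      by (simp add: fs cc) (auto simp: sgn_if)
  next
    assume cc: "cartan a b = 1" "cartan b a = 3"
    then have "m = 6" using assms(2) a(4) by auto
    then show ?thesis using nz' unfolding sign
      by (simp add: fs cc) (auto simp: sgn_if)
  next
    assume cc: "cartan a b = 3" "cartan b a = 1"
    then have "m = 6" using assms(2) a(4) by auto
    then show ?thesis using nz' unfolding sign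
      by (simp add: fs cc) (auto simp: sgn_if)
  qed
qed

text \<open>\<open>turn\<close> permutes \<open>acute p\<close> and preserves \<open>F\<close>, so
  the sign of x may be replaced by that of any later pair on its orbit; averaging over the first m
  of them leaves the constant (m - 2) / m.\<close>

lemma acute_sign_sum:
  fixes F :: "'a \<times> 'a \<Rightarrow> complex"
  assumes "p \<in> {1, 2, 3}" and F: "\<And>x. x \<in> acute p \<Longrightarrow> F (turn x) = F x"
  shows "(\<Sum>x\<in>acute p. F x * pair_sign x) = kappa p * (\<Sum>x\<in>acute p. F x)"
proof -
  define m :: nat where "m = (if p = 1 then 3 else if p = 2 then 4 else 6)"
  have m: "p = 1 \<and> m = 3 \<or> p = 2 \<and> m = 4 \<or> p = 3 \<and> m = 6" using assms(1) by (auto simp: m_def)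
  have "(\<Sum>x\<in>acute p. F x * pair_sign ((turn ^^ i) x)) = (\<Sum>x\<in>acute p. F x * pair_sign x)" for i
  proof (induction i)
    case (Suc i)
    have "(\<Sum>x\<in>acute p. F x * pair_sign ((turn ^^ Suc i) x))
        = (\<Sum>x\<in>acute p. F (turn x) * pair_sign ((turn ^^ i) (turn x)))"
      by (intro sum.cong refl) (simp add: F funpow_swap1)
    also have "\<dots> = (\<Sum>x\<in>acute p. F x * pair_sign ((turn ^^ i) x))"
      by (rule sum.reindex_bij_betw[OF bij_betw_turn])
    finally show ?case using Suc by simp
  qed simp
  then have "of_nat m * (\<Sum>x\<in>acute p. F x * pair_sign x)
      = (\<Sum>i<m. \<Sum>x\<in>acute p. F x * pair_sign ((turn ^^ i) x))"
    by simp
  also have "\<dots> = (\<Sum>x\<in>acute p. F x * complex_of_real (\<Sum>i<m. pair_sign ((turn ^^ i) x)))"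
    by (subst sum.swap) (simp add: sum_distrib_left)
  also have "\<dots> = (\<Sum>x\<in>acute p. F x * complex_of_real (real m - 2))"
    by (intro sum.cong refl) (simp only: turn_sign_sum[OF _ m])
  also have "\<dots> = (\<Sum>x\<in>acute p. F x) * complex_of_real (real m - 2)"
    by (simp only: sum_distrib_right)
  finally show ?thesis using m by (auto simp: kappa_def field_simps)
qed

end
end


section \<open>Sums over pairs of positive roots\<close>

context euclidean_root_system
begin

lemma sum_acute_pairs:
  fixes F :: "'a \<times> 'a \<Rightarrow> 'b::comm_ring_1"
  shows "(\<Sum>x | x \<in> \<Phi> \<times> \<Phi> \<and> D (fst x) (snd x) > 0. F x)
    = (\<Sum>a\<in>\<Phi>. F (a, a)) + (\<Sum>p\<in>{1,2,3}. \<Sum>x\<in>acute p. F x)"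
proof -
  let ?\<Delta> = "(\<lambda>a. (a, a)) ` \<Phi>"
  have diag: "cartan a a = 2" if "a \<in> \<Phi>" for a
    using D_root_pos[OF that] by (simp add: cartan_def)
  have "{x. x \<in> \<Phi> \<times> \<Phi> \<and> D (fst x) (snd x) > 0} = ?\<Delta> \<union> (\<Union>p\<in>{1,2,3}. acute p)"
  proof (intro equalityI subsetI)
    fix x assume "x \<in> {x. x \<in> \<Phi> \<times> \<Phi> \<and> D (fst x) (snd x) > 0}"
    then obtain a b where x: "x = (a, b)" "a \<in> \<Phi>" "b \<in> \<Phi>" "D a b > 0" by auto
    show "x \<in> ?\<Delta> \<union> (\<Union>p\<in>{1,2,3}. acute p)"
    proof (cases "a = b")
      case False
      show ?thesis by (rule acute_cases[OF x(2-4) False]) (use x in \<open>auto simp: acute_def\<close>)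
    qed (use x in auto)
  qed (use D_root_pos in \<open>auto simp: acute_def\<close>)
  moreover have "?\<Delta> \<inter> (\<Union>p\<in>{1,2,3}. acute p) = {}"
    using diag by (auto simp: acute_def)
  moreover have "(\<Sum>x\<in>(\<Union>p\<in>{1,2,3}. acute p). F x) = (\<Sum>p\<in>{1,2,3}. \<Sum>x\<in>acute p. F x)"
    by (rule sum.UNION_disjoint) (auto simp: finite_acute, auto simp: acute_def)
  ultimately have "(\<Sum>x | x \<in> \<Phi> \<times> \<Phi> \<and> D (fst x) (snd x) > 0. F x) =
      (\<Sum>x\<in>?\<Delta>. F x) + (\<Sum>p\<in>{1,2,3}. \<Sum>x\<in>acute p. F x)"
    by (simp only: sum.union_disjoint finite_roots finite_acute finite_imageI finite_UN_I finite.intros)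
  also have "(\<Sum>x\<in>?\<Delta>. F x) = (\<Sum>a\<in>\<Phi>. F (a, a))"
    by (subst sum.reindex) (auto simp: inj_on_def)
  finally show ?thesis .
qed

text \<open>Negating the first root exchanges acute and obtuse pairs, which gives the factor 2, and
  carries (a, a) to (- a, a).\<close>

lemma sum_root_pairs:
  fixes F :: "'a \<times> 'a \<Rightarrow> 'b::comm_ring_1"
  assumes "\<And>a b. F (- a, b) = F (a, b)" and "\<And>a b. D a b = 0 \<Longrightarrow> F (a, b) = 0"
  shows "(\<Sum>x\<in>\<Phi> \<times> \<Phi>. F x)
    = 2 * ((\<Sum>a\<in>\<Phi>. F (a, a)) + (\<Sum>p\<in>{1,2,3}. \<Sum>x\<in>acute p. F x))"
proof -
  let ?A = "{x. x \<in> \<Phi> \<times> \<Phi> \<and> D (fst x) (snd x) > 0}"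
  let ?N = "{x. x \<in> \<Phi> \<times> \<Phi> \<and> D (fst x) (snd x) < 0}"
  have fin: "finite (\<Phi> \<times> \<Phi>)" using finite_roots by simp
  have "(\<Sum>x\<in>\<Phi> \<times> \<Phi>. F x) = (\<Sum>x\<in>?A \<union> ?N. F x)"
    by (rule sum.mono_neutral_right[OF fin]) (use assms(2) in \<open>auto simp: not_less_iff_gr_or_eq\<close>)
  also have "\<dots> = (\<Sum>x\<in>?A. F x) + (\<Sum>x\<in>?N. F x)"
    by (rule sum.union_disjoint) (auto intro: finite_subset[OF _ fin])
  also have "(\<Sum>x\<in>?N. F x) = (\<Sum>x\<in>?A. F x)"
    by (rule sum.reindex_bij_witness[of _ "\<lambda>x. (- fst x, snd x)" "\<lambda>x. (- fst x, snd x)"])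
      (auto simp: D_simps uminus_root assms(1))
  finally show ?thesis by (simp add: sum_acute_pairs)
qed

lemma cartan_uminus: "cartan (- a) b = - cartan a b" "cartan a (- b) = - cartan a b"
  by (simp_all add: cartan_def D_simps)

text \<open>\<open>F\<close> is odd in each root because of the factor \<open>D\<close>; multiplied
  by the signs of \<open>l\<close> it becomes even, so four times the sum over \<open>P\<close> is a
  sum over all pairs of roots, and on \<open>P\<close> the signs are 1. The signs are then averaged
  away by \<open>acute_sign_sum\<close>.\<close>

lemma positive_pair_sum:
  fixes w :: "'a \<Rightarrow> complex" and h :: "real \<Rightarrow> real" and F :: "'a \<times> 'a \<Rightarrow> complex"
    and l :: "'a \<Rightarrow> real"
  assumes l: "linear l" "\<And>a. a \<in> \<Phi> \<Longrightarrow> l a \<noteq> 0"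
    and w: "\<And>a b. a \<in> \<Phi> \<Longrightarrow> b \<in> \<Phi> \<Longrightarrow> w (reflect b a) = w a"
  defines "P \<equiv> {a \<in> \<Phi>. l a > 0}"
    and "F \<equiv> \<lambda>x. w (fst x) * w (snd x) * complex_of_real
        (D (fst x) (snd x) * h (cartan (fst x) (snd x) * cartan (snd x) (fst x)))"
  shows "(\<Sum>a\<in>P. \<Sum>b\<in>P. F (a, b)) =
    ((\<Sum>a\<in>\<Phi>. F (a, a)) + (\<Sum>p\<in>{1,2,3}. kappa p * (\<Sum>x\<in>acute p. F x))) / 2"
proof -
  have w_uminus: "w (- a) = w a" if "a \<in> \<Phi>" for a
    using w[OF that that] by (simp add: reflect_self that)
  have l_uminus: "l (- a) = - l a" for a using l(1) by (rule linear_neg)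
  \<comment> \<open>Set to 0 off the roots because \<open>sum_root_pairs\<close> asks for evenness
    at all vectors, whereas \<open>w\<close> is controlled only on roots.\<close>
  define G where "G x = (if fst x \<in> \<Phi> \<and> snd x \<in> \<Phi> then F x * pair_sign l x else 0)" for x
  have mem: "- a \<in> \<Phi> \<longleftrightarrow> a \<in> \<Phi>" for a using uminus_root[of a] uminus_root[of "- a"] by auto
  have G_uminus: "G (- a, b) = G (a, b)" "G (a, - b) = G (a, b)" for a b
    by (auto simp: G_def F_def mem pair_sign_def[OF l] l_uminus w_uminus D_simps cartan_uminus sgn_minus)
  have G0: "G (a, b) = 0" if "D a b = 0" for a b using that by (simp add: G_def F_def)
  have split: "(\<Sum>a\<in>\<Phi>. f a) = 2 * (\<Sum>a\<in>P. f a)" if "\<And>a. f (- a) = f a" for f :: "'a \<Rightarrow> complex"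
  proof -
    have "\<Phi> = P \<union> {a \<in> \<Phi>. l a < 0}" using l(2) by (auto simp: P_def neq_iff)
    moreover have "P \<inter> {a \<in> \<Phi>. l a < 0} = {}" by (auto simp: P_def)
    ultimately have "(\<Sum>a\<in>\<Phi>. f a) = (\<Sum>a\<in>P. f a) + (\<Sum>a | a \<in> \<Phi> \<and> l a < 0. f a)"
      using sum.union_disjoint[of P "{a \<in> \<Phi>. l a < 0}" f] finite_roots
      by (metis (no_types, lifting) finite_Un)
    also have "(\<Sum>a | a \<in> \<Phi> \<and> l a < 0. f a) = (\<Sum>a\<in>P. f a)"
      by (rule sum.reindex_bij_witness[of _ uminus uminus]) (auto simp: P_def mem l_uminus that)
    finally show ?thesis by simp
  qed
  have "(\<Sum>x\<in>\<Phi> \<times> \<Phi>. G x) = (\<Sum>a\<in>\<Phi>. \<Sum>b\<in>\<Phi>. G (a, b))"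
    by (simp add: sum.cartesian_product)
  also have "\<dots> = 4 * (\<Sum>a\<in>P. \<Sum>b\<in>P. G (a, b))"
    by (simp add: split G_uminus flip: sum_distrib_left)
  also have "(\<Sum>a\<in>P. \<Sum>b\<in>P. G (a, b)) = (\<Sum>a\<in>P. \<Sum>b\<in>P. F (a, b))"
    by (intro sum.cong refl) (auto simp: G_def P_def pair_sign_def[OF l])
  finally have "4 * (\<Sum>a\<in>P. \<Sum>b\<in>P. F (a, b)) =
      2 * ((\<Sum>a\<in>\<Phi>. G (a, a)) + (\<Sum>p\<in>{1,2,3}. \<Sum>x\<in>acute p. G x))"
    using sum_root_pairs[of G] G_uminus G0 by simp
  moreover have "(\<Sum>a\<in>\<Phi>. G (a, a)) = (\<Sum>a\<in>\<Phi>. F (a, a))"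
    using l(2) by (intro sum.cong refl) (auto simp: G_def pair_sign_def[OF l] sgn_if)
  moreover have "(\<Sum>x\<in>acute p. G x) = kappa p * (\<Sum>x\<in>acute p. F x)" if "p \<in> {1,2,3}" for p
  proof -
    have "(\<Sum>x\<in>acute p. G x) = (\<Sum>x\<in>acute p. F x * pair_sign l x)"
      by (intro sum.cong refl) (auto simp: G_def acute_def)
    also have "\<dots> = kappa p * (\<Sum>x\<in>acute p. F x)"
    proof (rule acute_sign_sum[OF l that])
      fix x assume "x \<in> acute p"
      then obtain a b where x: "x = (a, b)" "a \<in> \<Phi>" "b \<in> \<Phi>" by (auto simp: acute_def)
      then have "w (- reflect b a) = w a" using w w_uminus reflect_in_roots by simp
      then show "F (turn x) = F x"
        using turn_data[OF x(3), of a] x(2,3) by (simp add: F_def x(1) turn_def mult.commute)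
    qed
    finally show ?thesis .
  qed
  ultimately have eq: "4 * (\<Sum>a\<in>P. \<Sum>b\<in>P. F (a, b)) =
      2 * ((\<Sum>a\<in>\<Phi>. F (a, a)) + (\<Sum>p\<in>{1,2,3}. kappa p * (\<Sum>x\<in>acute p. F x)))"
    by simp
  have "y = z / 2" if "4 * y = 2 * z" for y z :: complex
    using that by (simp add: field_simps)
  from this[OF eq] show ?thesis .
qed

end


section \<open>Bases and root lengths\<close>

locale based_root_system = euclidean_root_system \<Phi> D
  for \<Phi> :: "'a::euclidean_space set" and D +
  fixes r :: nat and \<alpha> :: "nat \<Rightarrow> 'a" and \<xi> :: "nat \<Rightarrow> 'a \<Rightarrow> real"
  assumes simple_root: "i \<in> {1..r} \<Longrightarrow> \<alpha> i \<in> \<Phi>"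
    and linear_coord: "linear (\<xi> i)"
    and coord_expansion: "v = (\<Sum>i=1..r. \<xi> i v *\<^sub>R \<alpha> i)"
    and coord_simple: "i \<in> {1..r} \<Longrightarrow> j \<in> {1..r} \<Longrightarrow> \<xi> i (\<alpha> j) = (if i = j then 1 else 0)"
    and coord_sign: "b \<in> \<Phi> \<Longrightarrow> (\<forall>i\<in>{1..r}. \<xi> i b \<ge> 0) \<or> (\<forall>i\<in>{1..r}. \<xi> i b \<le> 0)"
begin

definition height :: "'a \<Rightarrow> real" where
  "height v = (\<Sum>i=1..r. \<xi> i v)"

lemma linear_height: "linear height"
  unfolding height_def by (intro linear_compose_sum ballI linear_coord)

lemma height_simple: "i \<in> {1..r} \<Longrightarrow> height (\<alpha> i) = 1"
  by (simp add: height_def coord_simple sum.delta)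

lemma root_coord_nonzero:
  assumes "b \<in> \<Phi>" obtains i where "i \<in> {1..r}" "\<xi> i b \<noteq> 0"
proof -
  have "\<exists>i\<in>{1..r}. \<xi> i b \<noteq> 0"
  proof (rule ccontr)
    assume "\<not> ?thesis"
    then have "b = 0" using coord_expansion[of b] by simp
    then show False using assms zero_not_root by simp
  qed
  then show ?thesis using that by blast
qed

lemma height_pos_iff:
  assumes b: "b \<in> \<Phi>"
  shows "height b > 0 \<longleftrightarrow> (\<forall>i\<in>{1..r}. \<xi> i b \<ge> 0)"
    and "height b \<noteq> 0"
proof -
  obtain i where i: "i \<in> {1..r}" "\<xi> i b \<noteq> 0" using root_coord_nonzero[OF b] .
  have 1: "height b > 0" if "\<forall>i\<in>{1..r}. \<xi> i b \<ge> 0"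
    unfolding height_def using that i by (intro sum_pos2[of _ i]) (auto simp: less_le)
  have 2: "height b < 0" if "\<forall>i\<in>{1..r}. \<xi> i b \<le> 0"
  proof -
    have "(\<Sum>i=1..r. - \<xi> i b) > 0" using that i by (intro sum_pos2[of _ i]) (auto simp: less_le)
    then show ?thesis by (simp add: height_def sum_negf)
  qed
  show "height b > 0 \<longleftrightarrow> (\<forall>i\<in>{1..r}. \<xi> i b \<ge> 0)" using 1 2 coord_sign[OF b] by fastforce
  show "height b \<noteq> 0" using 1 2 coord_sign[OF b] by fastforce
qed

text \<open>By reducedness \<open>b\<close> has a positive coordinate at some j other than i. The
  reflection leaves that coordinate alone, and the coordinates of a root never have mixed
  signs.\<close>

lemma reflect_simple_height:
  assumes i: "i \<in> {1..r}" and b: "b \<in> \<Phi>" "height b > 0" "b \<noteq> \<alpha> i"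
  shows "height (reflect (\<alpha> i) b) > 0"
proof -
  have nonneg: "\<forall>j\<in>{1..r}. \<xi> j b \<ge> 0" using b height_pos_iff by blast
  have "\<exists>j\<in>{1..r}. j \<noteq> i \<and> \<xi> j b \<noteq> 0"
  proof (rule ccontr)
    assume "\<not> ?thesis"
    then have "b = (\<Sum>j=1..r. if j = i then \<xi> i b *\<^sub>R \<alpha> i else 0)"
      by (subst coord_expansion[of b]) (intro sum.cong, auto)
    then have bi: "b = \<xi> i b *\<^sub>R \<alpha> i" using i by (simp add: sum.delta)
    then have "\<xi> i b = 1 \<or> \<xi> i b = -1" using reduced simple_root[OF i] b(1) by metis
    then show False using bi b(3) nonneg i by force
  qed
  then obtain j where j: "j \<in> {1..r}" "j \<noteq> i" "\<xi> j b > 0" using nonneg by (force simp: less_le)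
  have "\<xi> j (reflect (\<alpha> i) b) = \<xi> j b"
    using j i linear_coord[of j] by (simp add: reflect_def linear_diff linear_scale coord_simple)
  moreover have root: "reflect (\<alpha> i) b \<in> \<Phi>" using i b simple_root reflect_in_roots by blast
  ultimately show ?thesis using coord_sign[OF root] j height_pos_iff(1)[OF root] by fastforce
qed

text \<open>Every root is conjugate to a simple root: a positive root of minimal height in its orbit is simple.\<close>

lemma root_induct [consumes 1, case_names simple reflect]:
  assumes "b \<in> \<Phi>"
    and simple: "\<And>i. i \<in> {1..r} \<Longrightarrow> Q (\<alpha> i)"
    and reflect: "\<And>c d. c \<in> \<Phi> \<Longrightarrow> d \<in> \<Phi> \<Longrightarrow> Q c \<Longrightarrow> Q (reflect d c)"
  shows "Q b"
proof -
  have positive: "Q b" if "b \<in> \<Phi>" "height b > 0" for b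
    using that
  \<comment> \<open>Heights are real numbers, so the induction runs on the number of lower
    roots.\<close>
  proof (induction "card {c \<in> \<Phi>. height c < height b}" arbitrary: b rule: less_induct)
    case less
    \<comment> \<open>As the coordinates of b are nonnegative, positivity of \<open>D b b\<close>
      forces \<open>D b (\<alpha> i)\<close> to be positive for some i; reflecting in that simple
      root lowers the height.\<close>
    have "0 < D b b" by (rule D_root_pos[OF less.prems(1)])
    also have "D b b = (\<Sum>i=1..r. \<xi> i b * D b (\<alpha> i))"
      by (subst (2) coord_expansion[of b]) (simp add: D_sum_right D_simps)
    finally obtain i where i: "i \<in> {1..r}" "\<xi> i b * D b (\<alpha> i) > 0"
      by (metis (no_types, lifting) not_le sum_nonpos)
    then have Db: "D b (\<alpha> i) > 0"
      using less.prems height_pos_iff(1) by (metis zero_less_mult_pos less_le mult_zero_left)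
    show ?case
    proof (cases "b = \<alpha> i")
      case False
      define c where "c = reflect (\<alpha> i) b"
      have c: "c \<in> \<Phi>" "height c > 0"
        using less.prems i simple_root reflect_in_roots reflect_simple_height False by (auto simp: c_def)
      have "cartan b (\<alpha> i) > 0" using Db D_root_pos[OF simple_root[OF i(1)]] by (simp add: cartan_def)
      then have lt: "height c < height b"
        using i by (simp add: c_def reflect_def linear_diff[OF linear_height]
            linear_scale[OF linear_height] height_simple)
      have "{d \<in> \<Phi>. height d < height c} \<subset> {d \<in> \<Phi>. height d < height b}"
        using lt c by auto
      then have "card {d \<in> \<Phi>. height d < height c} < card {d \<in> \<Phi>. height d < height b}"
        by (intro psubset_card_mono) (auto simp: finite_roots)
      then have "Q c" using less.hyps c by blast
      then have "Q (reflect (\<alpha> i) c)" using reflect c simple_root i by blast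
      then show ?thesis using simple_root i by (simp add: c_def reflect_reflect)
    qed (use simple i in simp)
  qed
  show ?thesis
  proof (cases "height b > 0")
    case False
    then have "height (- b) > 0"
      using height_pos_iff(2)[OF assms(1)] by (simp add: linear_neg[OF linear_height])
    then have "Q (- b)" using positive uminus_root assms(1) by blast
    then have "Q (reflect (- b) (- b))" using reflect uminus_root assms(1) by blast
    then show ?thesis using uminus_root[OF assms(1)] by (simp add: reflect_self)
  qed (use positive assms(1) in blast)
qed

end

text \<open>Connectedness of the Dynkin diagram is stated as: a real function equal at the ends of
  every edge is constant. This is the form in which Schur's argument uses it, applied to the
  eigenvalues at the simple roots.\<close>

locale irreducible_root_system = based_root_system \<Phi> D r \<alpha> \<xi>
  for \<Phi> :: "'a::euclidean_space set" and D r \<alpha> \<xi> +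
  assumes connected: "(\<And>i j. i \<in> {1..r} \<Longrightarrow> j \<in> {1..r} \<Longrightarrow> cartan (\<alpha> i) (\<alpha> j) \<noteq> 0 \<Longrightarrow> g i = g j) \<Longrightarrow>
      i \<in> {1..r} \<Longrightarrow> j \<in> {1..r} \<Longrightarrow> g i = (g j :: real)"
    and dimension: "DIM('a) = r"
begin

definition of_length :: "real \<Rightarrow> 'a set" where
  "of_length s = {a \<in> \<Phi>. D a a = s}"

lemma finite_of_length: "finite (of_length s)"
  using finite_roots by (simp add: of_length_def)

lemma bij_betw_reflect_of_length:
  assumes "b \<in> \<Phi>" shows "bij_betw (reflect b) (of_length s) (of_length s)"
  by (rule bij_betw_byWitness[where f' = "reflect b"])
    (use assms in \<open>auto simp: of_length_def reflect_reflect reflect_in_roots D_reflect\<close>)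

text \<open>
  The form on the left is invariant, so by irreducibility it is a multiple of \<open>D\<close>; the factor is found
  by taking traces.
\<close>

lemma sum_of_length:
  "(\<Sum>b\<in>of_length s. D b u * D b v) = s * card (of_length s) / r * D u v"
proof -
  let ?X = "of_length s"
  define M where "M u v = (\<Sum>b\<in>?X. D b u * D b v)" for u v
  have M_left: "M (x + y) v = M x v + M y v" "M (x - y) v = M x v - M y v" "M (c *\<^sub>R x) v = c * M x v"
    "M (- x) v = - M x v" for x y v c
    by (simp_all add: M_def D_simps algebra_simps sum.distrib sum_subtractf sum_distrib_left sum_negf)
  have M_sym: "M u v = M v u" for u v by (simp add: M_def mult.commute)
  have M_right: "M v (x - y) = M v x - M v y" "M v (c *\<^sub>R x) = c * M v x" for x y v c
    by (simp_all add: M_def D_simps algebra_simps sum_subtractf sum_distrib_left)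
  have M_sum: "M (sum f A) v = (\<Sum>i\<in>A. M (f i) v)" for f v and A :: "nat set"
    by (induction A rule: infinite_finite_induct) (simp_all add: M_left, simp_all add: M_def D_simps)
  have M_reflect: "M (reflect b u) (reflect b v) = M u v" if "b \<in> \<Phi>" for b u v
  proof -
    have "M (reflect b u) (reflect b v) = (\<Sum>c\<in>?X. D (reflect b c) (reflect b u) * D (reflect b c) (reflect b v))"
      unfolding M_def by (rule sum.reindex_bij_betw[OF bij_betw_reflect_of_length[OF that], symmetric])
    then show ?thesis by (simp add: D_reflect that M_def)
  qed
  define g where "g i = M (\<alpha> i) (\<alpha> i) / D (\<alpha> i) (\<alpha> i)" for i
  \<comment> \<open>The reflection in \<open>\<alpha> i\<close> negates \<open>\<alpha> i\<close>;
    invariance of \<open>M\<close> under it makes \<open>\<alpha> i\<close> an eigenvector of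
    \<open>M\<close> relative to \<open>D\<close>. Nonzero Cartan entries then force equal
    eigenvalues.\<close>
  have M_simple: "M (\<alpha> i) v = g i * D (\<alpha> i) v" if i: "i \<in> {1..r}" for i v
  proof -
    note a = simple_root[OF i]
    have "M (\<alpha> i) v = M (- \<alpha> i) (reflect (\<alpha> i) v)"
      using M_reflect[OF a, of "\<alpha> i" v] a by (simp add: reflect_self)
    also have "\<dots> = - M (\<alpha> i) v + cartan v (\<alpha> i) * M (\<alpha> i) (\<alpha> i)"
      by (simp add: M_left M_right reflect_def)
    finally have "2 * M (\<alpha> i) v = cartan v (\<alpha> i) * M (\<alpha> i) (\<alpha> i)" by simp
    then show ?thesis
      using D_root_pos[OF a] D_sym[of v "\<alpha> i"] by (simp add: cartan_def g_def field_simps)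
  qed
  have "g i = g j" if "i \<in> {1..r}" "j \<in> {1..r}" for i j
  proof (rule connected[OF _ that])
    fix i j assume ij: "i \<in> {1..r}" "j \<in> {1..r}" "cartan (\<alpha> i) (\<alpha> j) \<noteq> 0"
    then have "D (\<alpha> i) (\<alpha> j) \<noteq> 0" by (auto simp: cartan_def)
    moreover have "g i * D (\<alpha> i) (\<alpha> j) = g j * D (\<alpha> i) (\<alpha> j)"
      using M_simple[OF ij(1), of "\<alpha> j"] M_simple[OF ij(2), of "\<alpha> i"]
      by (simp add: M_sym[of "\<alpha> j" "\<alpha> i"] D_sym[of "\<alpha> j" "\<alpha> i"])
    ultimately show "g i = g j" by simp
  qed
  then obtain c where c: "\<And>i. i \<in> {1..r} \<Longrightarrow> g i = c" by metis
  have M: "M u v = c * D u v" for u v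
  proof -
    have "M u v = M (\<Sum>i=1..r. \<xi> i u *\<^sub>R \<alpha> i) v" using coord_expansion[of u] by simp
    also have "\<dots> = (\<Sum>i=1..r. c * (\<xi> i u * D (\<alpha> i) v))"
      unfolding M_sum M_left by (intro sum.cong refl) (simp add: M_simple c)
    also have "\<dots> = c * D (\<Sum>i=1..r. \<xi> i u *\<^sub>R \<alpha> i) v"
      by (simp add: D_sum_left D_simps sum_distrib_left)
    also have "(\<Sum>i=1..r. \<xi> i u *\<^sub>R \<alpha> i) = u" using coord_expansion[of u] by simp
    finally show ?thesis .
  qed
  \<comment> \<open>Passing from forms to operators permits the trace in the standard basis,
    although \<open>D\<close> is a different form; each b contributes
    \<open>D b b = s\<close>.\<close>
  have T: "(\<Sum>b\<in>?X. D b u *\<^sub>R b) = c *\<^sub>R u" for u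
  proof -
    let ?d = "(\<Sum>b\<in>?X. D b u *\<^sub>R b) - c *\<^sub>R u"
    have "D ?d v = M u v - c * D u v" for v
      by (simp add: M_def D_simps D_sum_left)
    then have "D ?d ?d = 0" by (simp only: M)
    then show ?thesis using D_pos[of ?d] by fastforce
  qed
  have "c * r = (\<Sum>e\<in>(Basis :: 'a set). (c *\<^sub>R e) \<bullet> e)"
    by (simp add: dimension)
  also have "\<dots> = (\<Sum>e\<in>Basis. \<Sum>b\<in>?X. D b e * (b \<bullet> e))"
    by (simp add: inner_sum_left flip: T)
  also have "\<dots> = (\<Sum>b\<in>?X. \<Sum>e\<in>Basis. D b e * (b \<bullet> e))" by (rule sum.swap)
  also have "\<dots> = (\<Sum>b\<in>?X. D b (\<Sum>e\<in>Basis. (b \<bullet> e) *\<^sub>R e))"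
    by (simp add: D_sum_right D_simps mult.commute)
  also have "\<dots> = (\<Sum>b\<in>?X. s)"
    by (intro sum.cong refl) (simp add: euclidean_representation of_length_def)
  finally have "c * r = s * card ?X" by simp
  moreover have "r > 0" using dimension DIM_positive by metis
  ultimately have "c = s * card ?X / r" by (simp add: field_simps)
  then show ?thesis using M[of u v] by (simp add: M_def)
qed

end


section \<open>Numbers of root pairs with given angle and lengths\<close>

context irreducible_root_system
begin

lemma rank_pos: "real r > 0"
  using dimension DIM_positive[where 'a = 'a] by simp

definition acute_between :: "real \<Rightarrow> real \<Rightarrow> real \<Rightarrow> ('a \<times> 'a) set" where
  "acute_between p L M = {x \<in> acute p. D (fst x) (fst x) = L \<and> D (snd x) (snd x) = M}"

lemma finite_acute_between: "finite (acute_between p L M)"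
  using finite_acute by (simp add: acute_between_def)

text \<open>At equal lengths the two Cartan integers coincide, so both are 1 and the angle is 60
  degrees.\<close>

lemma acute_between_same:
  assumes "p \<in> {1, 2, 3}" "x \<in> acute_between p L L"
  shows "p = 1" "D (fst x) (snd x) = L / 2"
proof -
  obtain a b where x: "x = (a, b)" by (cases x)
  have ab: "a \<in> \<Phi>" "b \<in> \<Phi>" "D a b > 0" "cartan a b * cartan b a = p" "D a a = L" "D b b = L"
    using assms(2) by (auto simp: x acute_between_def acute_def)
  have L: "L > 0" using D_root_pos ab by auto
  have same: "cartan a b = cartan b a" using D_sym[of a b] by (simp add: cartan_def ab)
  have "a \<noteq> b" using ab assms(1) L by (auto simp: cartan_def)
  have "cartan a b = 1"
    by (rule acute_cases[OF ab(1-3) \<open>a \<noteq> b\<close>]) (use same in auto)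
  then show "p = 1" "D (fst x) (snd x) = L / 2"
    using same ab L by (auto simp: x cartan_def)
qed

text \<open>The ratio of the two Cartan integers is the ratio q of the squared lengths, which leaves
  only 1 and q.\<close>

lemma acute_between_different:
  assumes "p \<in> {1, 2, 3}" "q \<in> {2, 3}" "x \<in> acute_between p s (q * s)"
  shows "p = q" "D (fst x) (snd x) = q * s / 2"
proof -
  obtain a b where x: "x = (a, b)" by (cases x)
  have ab: "a \<in> \<Phi>" "b \<in> \<Phi>" "D a b > 0" "cartan a b * cartan b a = p" "D a a = s" "D b b = q * s"
    using assms(3) by (auto simp: x acute_between_def acute_def)
  have s: "s > 0" using D_root_pos ab by auto
  have ratio: "cartan b a = q * cartan a b" using D_sym[of a b] assms(2) s by (auto simp: cartan_def ab)
  have "a \<noteq> b" using ab assms(1) s by (auto simp: cartan_def)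
  have "cartan a b = 1"
    by (rule acute_cases[OF ab(1-3) \<open>a \<noteq> b\<close>]) (use ratio assms(2) in auto)
  then show "p = q" "D (fst x) (snd x) = q * s / 2"
    using ratio ab s assms(2) by (auto simp: x cartan_def)
qed

text \<open>The sum of squares of \<open>D a b\<close> over roots a of length L and b of length M,
  evaluated once by \<open>sum_of_length\<close> and once by angle. Since the value of
  \<open>D a b\<close> is fixed by the lengths, this counts the acute pairs.\<close>

lemma sum_acute_between:
  fixes L M :: real
  defines "N \<equiv> \<lambda>L. real (card (of_length L))"
  shows "L * N L * (M * N M) / r = 2 * ((if L = M then N L * L\<^sup>2 else 0) +
    (\<Sum>p\<in>{1,2,3}. \<Sum>x\<in>acute_between p L M. (D (fst x) (snd x))\<^sup>2))"
proof -
  define F where "F x = (if D (fst x) (fst x) = L \<and> D (snd x) (snd x) = M then (D (fst x) (snd x))\<^sup>2 else 0)"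
    for x :: "'a \<times> 'a"
  have acute_F: "(\<Sum>x\<in>acute p. F x) = (\<Sum>x\<in>acute_between p L M. (D (fst x) (snd x))\<^sup>2)" for p
    unfolding F_def acute_between_def by (rule sum.inter_filter[OF finite_acute, symmetric])
  have set: "{x \<in> \<Phi> \<times> \<Phi>. D (fst x) (fst x) = L \<and> D (snd x) (snd x) = M} = of_length L \<times> of_length M"
    by (auto simp: of_length_def)
  have "(\<Sum>x\<in>\<Phi> \<times> \<Phi>. F x) = (\<Sum>x\<in>of_length L \<times> of_length M. (D (fst x) (snd x))\<^sup>2)"
    unfolding F_def set[symmetric] by (simp add: sum.inter_filter finite_roots)
  also have "\<dots> = (\<Sum>b\<in>of_length M. \<Sum>a\<in>of_length L. D a b * D a b)"
    by (subst sum.swap) (simp add: sum.cartesian_product power2_eq_square split_def)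
  also have "\<dots> = (\<Sum>b\<in>of_length M. L * N L / r * M)"
    by (intro sum.cong refl) (simp add: sum_of_length N_def, simp add: of_length_def)
  also have "\<dots> = L * N L * (M * N M) / r" by (simp add: N_def)
  finally have "L * N L * (M * N M) / r = (\<Sum>x\<in>\<Phi> \<times> \<Phi>. F x)" by simp
  also have "\<dots> = 2 * ((\<Sum>a\<in>\<Phi>. F (a, a)) + (\<Sum>p\<in>{1,2,3}. \<Sum>x\<in>acute p. F x))"
    by (rule sum_root_pairs) (auto simp: F_def D_simps)
  also have "(\<Sum>a\<in>\<Phi>. F (a, a)) = (\<Sum>a\<in>\<Phi>. if D a a = L then (if L = M then L\<^sup>2 else 0) else 0)"
    by (intro sum.cong refl) (auto simp: F_def)
  also have "\<dots> = (\<Sum>a\<in>of_length L. if L = M then L\<^sup>2 else 0)"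
    unfolding of_length_def by (rule sum.inter_filter[OF finite_roots, symmetric])
  also have "\<dots> = (if L = M then N L * L\<^sup>2 else 0)" by (simp add: N_def)
  finally show ?thesis by (simp only: acute_F)
qed

lemma card_acute_between_same:
  assumes "L > 0"
  shows "real (card (acute_between 1 L L)) = 2 * real (card (of_length L)) * (card (of_length L) / r - 2)"
proof -
  let ?N = "real (card (of_length L))"
  have "acute_between 2 L L = {}" "acute_between 3 L L = {}"
    using acute_between_same[of 2 _ L] acute_between_same[of 3 _ L] by auto
  moreover have "(\<Sum>x\<in>acute_between 1 L L. (D (fst x) (snd x))\<^sup>2) = (\<Sum>x\<in>acute_between 1 L L. (L / 2)\<^sup>2)"
    by (intro sum.cong refl) (simp add: acute_between_same(2)[of 1])
  ultimately have "L * ?N * (L * ?N) / r = 2 * (?N * L\<^sup>2 + card (acute_between 1 L L) * (L / 2)\<^sup>2)"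
    using sum_acute_between[of L L] by simp
  then have "L\<^sup>2 * (?N * ?N / r) = L\<^sup>2 * (2 * ?N + card (acute_between 1 L L) / 2)"
    by (simp add: power2_eq_square algebra_simps)
  then have "?N * ?N / r = 2 * ?N + card (acute_between 1 L L) / 2"
    unfolding mult_cancel_left using assms by simp
  then show ?thesis by (simp add: algebra_simps)
qed

lemma card_acute_between_different:
  assumes "s > 0" "q \<in> {2, 3}"
  shows "real (card (acute_between q s (q * s))) =
    2 * real (card (of_length s)) * real (card (of_length (q * s))) / (q * r)"
proof -
  let ?N = "real (card (of_length s))" and ?M = "real (card (of_length (q * s)))"
  have "acute_between p s (q * s) = {}" if "p \<in> {1,2,3} - {q}" for p
    using acute_between_different[of p q _ s] that assms(2) by auto
  then have "(\<Sum>p\<in>{1,2,3}. \<Sum>x\<in>acute_between p s (q * s). (D (fst x) (snd x))\<^sup>2)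
      = (\<Sum>x\<in>acute_between q s (q * s). (D (fst x) (snd x))\<^sup>2)"
    using assms(2) by auto
  also have "\<dots> = (\<Sum>x\<in>acute_between q s (q * s). (q * s / 2)\<^sup>2)"
    by (intro sum.cong refl, subst acute_between_different(2)[of q q _ s]) (use assms(2) in auto)
  finally have "s * ?N * (q * s * ?M) / r = 2 * (card (acute_between q s (q * s)) * (q * s / 2)\<^sup>2)"
    using sum_acute_between[of s "q * s"] assms by auto
  then have "(q * s\<^sup>2) * (?N * ?M / r) = (q * s\<^sup>2) * (card (acute_between q s (q * s)) * q / 2)"
    by (simp add: power2_eq_square algebra_simps)
  then have "?N * ?M / r = card (acute_between q s (q * s)) * q / 2"
    unfolding mult_cancel_left using assms by auto
  then show ?thesis using assms(2) by (auto simp: field_simps)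
qed

lemma acute_between_swap: "prod.swap ` acute_between p L M = acute_between p M L"
proof -
  have "prod.swap ` acute_between p L M \<subseteq> acute_between p M L" for L M
    by (auto simp: acute_between_def acute_def mult.commute D_sym)
  from this[of M L] this[of L M] show ?thesis
    by (auto intro!: image_eqI[of _ prod.swap "prod.swap _"])
qed

text \<open>Inserts the pair counts into \<open>positive_pair_sum\<close>; the factor 2 in the mixed
  term stands for the two orders of a short and a long root. The case y = 0 is allowed and covers
  the systems with one root length.\<close>

lemma two_length_sum:
  fixes ks kl :: complex and h :: "real \<Rightarrow> real" and l :: "'a \<Rightarrow> real"
  assumes s: "s > 0" and q: "q \<in> {2, 3}" and lengths: "\<And>a. a \<in> \<Phi> \<Longrightarrow> D a a = s \<or> D a a = q * s"
    and l: "linear l" "\<And>a. a \<in> \<Phi> \<Longrightarrow> l a \<noteq> 0"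
  defines "w \<equiv> \<lambda>a. if D a a = s then ks else kl"
    and "P \<equiv> {a \<in> \<Phi>. l a > 0}"
    and "x \<equiv> card (of_length s)" and "y \<equiv> card (of_length (q * s))"
  shows "(\<Sum>a\<in>P. \<Sum>b\<in>P. w a * w b * complex_of_real (D a b * h (cartan a b * cartan b a))) =
    (ks\<^sup>2 * s * x * (h 4 + h 1 / 3 * (x / r - 2)) + kl\<^sup>2 * (q * s) * y * (h 4 + h 1 / 3 * (y / r - 2))
     + 2 * ks * kl * (kappa q * h q) * s * x * y / r) / 2"
proof -
  define F where "F x = w (fst x) * w (snd x) * complex_of_real
        (D (fst x) (snd x) * h (cartan (fst x) (snd x) * cartan (snd x) (fst x)))" for x
  have ne: "q * s \<noteq> s" using s q by auto
  have "(\<Sum>a\<in>P. \<Sum>b\<in>P. F (a, b)) =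
    ((\<Sum>a\<in>\<Phi>. F (a, a)) + (\<Sum>p\<in>{1,2,3}. kappa p * (\<Sum>x\<in>acute p. F x))) / 2"
  proof -
    have "w (reflect b a) = w a" if "a \<in> \<Phi>" "b \<in> \<Phi>" for a b
      using that by (simp add: w_def D_reflect)
    from positive_pair_sum[OF l(1), of w h, OF l(2) this] show ?thesis unfolding F_def P_def .
  qed
  moreover have diag: "(\<Sum>a\<in>\<Phi>. F (a, a)) = ks\<^sup>2 * s * x * h 4 + kl\<^sup>2 * (q * s) * y * h 4"
  proof -
    have "of_length s \<union> of_length (q * s) = \<Phi>"
      unfolding of_length_def using lengths by blast
    moreover have "of_length s \<inter> of_length (q * s) = {}"
      unfolding of_length_def using ne by auto
    ultimately have "(\<Sum>a\<in>\<Phi>. F (a, a)) = (\<Sum>a\<in>of_length s. F (a, a)) + (\<Sum>a\<in>of_length (q * s). F (a, a))"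
      using sum.union_disjoint[OF finite_of_length finite_of_length, of s "q * s" "\<lambda>a. F (a, a)"] by simp
    moreover have "F (a, a) = ks\<^sup>2 * s * h 4" if "a \<in> of_length s" for a
    proof -
      have "D a a = s" "cartan a a = 2" using that s by (simp_all add: of_length_def cartan_def)
      then show ?thesis by (simp add: F_def w_def power2_eq_square)
    qed
    moreover have "F (a, a) = kl\<^sup>2 * (q * s) * h 4" if "a \<in> of_length (q * s)" for a
    proof -
      have "D a a = q * s" "cartan a a = 2" using that s q by (auto simp: of_length_def cartan_def)
      then show ?thesis using ne by (simp add: F_def w_def power2_eq_square)
    qed
    ultimately show ?thesis by (simp add: x_def y_def)
  qed
  moreover have split: "(\<Sum>x\<in>acute p. F x) =
      (\<Sum>x\<in>acute_between p s s. F x) + (\<Sum>x\<in>acute_between p (q * s) (q * s). F x)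
      + (\<Sum>x\<in>acute_between p s (q * s). F x) + (\<Sum>x\<in>acute_between p (q * s) s. F x)" for p
  proof -
    have "acute p = (acute_between p s s \<union> acute_between p (q * s) (q * s))
        \<union> (acute_between p s (q * s) \<union> acute_between p (q * s) s)"
    proof -
      have "(D (fst x) (fst x) = s \<or> D (fst x) (fst x) = q * s)
          \<and> (D (snd x) (snd x) = s \<or> D (snd x) (snd x) = q * s)" if "x \<in> acute p" for x
      proof -
        have "fst x \<in> \<Phi>" "snd x \<in> \<Phi>" using that by (auto simp: acute_def)
        then show ?thesis using lengths by blast
      qed
      then show ?thesis unfolding acute_between_def by blast
    qed
    moreover have "(acute_between p s s \<union> acute_between p (q * s) (q * s))
        \<inter> (acute_between p s (q * s) \<union> acute_between p (q * s) s) = {}"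
      "acute_between p s s \<inter> acute_between p (q * s) (q * s) = {}"
      "acute_between p s (q * s) \<inter> acute_between p (q * s) s = {}"
      using ne by (auto simp: acute_between_def)
    ultimately show ?thesis
      by (simp add: sum.union_disjoint finite_acute_between)
  qed
  have same: "(\<Sum>x\<in>acute_between p L L. F x) =
      (if p = 1 then (if L = s then ks else kl)\<^sup>2 * complex_of_real (L * card (of_length L) * (card (of_length L) / r - 2) * h 1) else 0)"
    if p: "p \<in> {1,2,3}" and L: "L > 0" for p L :: real
  proof (cases "p = 1")
    case True
    have "(\<Sum>x\<in>acute_between p L L. F x) =
       (\<Sum>x\<in>acute_between p L L. (if L = s then ks else kl)\<^sup>2 * complex_of_real (L / 2 * h 1))"
    proof (intro sum.cong refl)
      fix x assume x: "x \<in> acute_between p L L"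
      have "cartan (fst x) (snd x) * cartan (snd x) (fst x) = p"
        and "D (fst x) (fst x) = L" "D (snd x) (snd x) = L"
        using x by (auto simp: acute_between_def acute_def)
      then show "F x = (if L = s then ks else kl)\<^sup>2 * complex_of_real (L / 2 * h 1)"
        by (simp only: F_def w_def acute_between_same[OF p x] power2_eq_square)
    qed
    also have "\<dots> = of_real (card (acute_between 1 L L)) * ((if L = s then ks else kl)\<^sup>2 * complex_of_real (L / 2 * h 1))"
      by (simp only: True sum_constant of_real_of_nat_eq)
    also have "\<dots> = (if L = s then ks else kl)\<^sup>2 * complex_of_real (L * card (of_length L) * (card (of_length L) / r - 2) * h 1)"
      unfolding card_acute_between_same[OF L] by (simp add: algebra_simps)
    finally show ?thesis using True by simp
  next
    case False
    then have "acute_between p L L = {}" using acute_between_same(1)[OF p] by blast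
    then show ?thesis using False by simp
  qed
  have diff: "(\<Sum>x\<in>acute_between p s (q * s). F x) =
      (if p = q then ks * kl * complex_of_real (s * x * y / r * h q) else 0)"
    if p: "p \<in> {1,2,3}" for p
  proof (cases "p = q")
    case True
    have "(\<Sum>x\<in>acute_between p s (q * s). F x) =
       (\<Sum>x\<in>acute_between p s (q * s). ks * kl * complex_of_real (q * s / 2 * h q))"
    proof (intro sum.cong refl)
      fix x assume x: "x \<in> acute_between p s (q * s)"
      have "cartan (fst x) (snd x) * cartan (snd x) (fst x) = p"
        and "D (fst x) (fst x) = s" "D (snd x) (snd x) = q * s"
        using x by (auto simp: acute_between_def acute_def)
      then show "F x = ks * kl * complex_of_real (q * s / 2 * h q)"
        using ne by (simp only: F_def w_def acute_between_different[OF p q x] if_True if_False simp_thms)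
    qed
    also have "\<dots> = of_real (card (acute_between q s (q * s))) * (ks * kl * complex_of_real (q * s / 2 * h q))"
      by (simp only: True sum_constant of_real_of_nat_eq)
    also have "\<dots> = ks * kl * complex_of_real (s * x * y / r * h q)"
      unfolding card_acute_between_different[OF s q] x_def y_def using q by auto
    finally show ?thesis using True by simp
  next
    case False
    then have "acute_between p s (q * s) = {}" using acute_between_different(1)[OF p q] by blast
    then show ?thesis using False by simp
  qed
  have flip: "(\<Sum>x\<in>acute_between p (q * s) s. F x) = (\<Sum>x\<in>acute_between p s (q * s). F x)" for p
  proof -
    have F_swap: "F (prod.swap z) = F z" for z by (simp add: F_def D_sym[of "snd z" "fst z"] mult.commute)
    show ?thesis
      unfolding acute_between_swap[of p s "q * s", symmetric]
      by (subst sum.reindex) (auto simp: F_swap)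
  qed
  have "q * s > 0" using s q by auto
  then have acute: "(\<Sum>x\<in>acute p. F x) =
     (if p = 1 then ks\<^sup>2 * complex_of_real (s * x * (x / r - 2) * h 1) + kl\<^sup>2 * complex_of_real (q * s * y * (y / r - 2) * h 1) else 0)
     + (if p = q then 2 * ks * kl * complex_of_real (s * x * y / r * h q) else 0)"
    if p: "p \<in> {1,2,3}" for p
    unfolding split flip using same[OF p s] same[OF p, of "q * s"] diff[OF p] ne by (simp add: x_def y_def)
  have sum_acute: "(\<Sum>p\<in>{1,2,3}. kappa p * (\<Sum>x\<in>acute p. F x)) =
      (ks\<^sup>2 * complex_of_real (s * x * (x / r - 2) * h 1) + kl\<^sup>2 * complex_of_real (q * s * y * (y / r - 2) * h 1)) / 3
      + kappa q * (2 * ks * kl * complex_of_real (s * x * y / r * h q))"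
  proof -
    have "complex_of_real (kappa 1) = 1/3" by (simp add: kappa_def)
    then show ?thesis using q by (auto simp: acute)
  qed
  have "(\<Sum>a\<in>P. \<Sum>b\<in>P. F (a, b)) =
    (ks\<^sup>2 * s * x * (h 4 + h 1 / 3 * (x / r - 2)) + kl\<^sup>2 * (q * s) * y * (h 4 + h 1 / 3 * (y / r - 2))
     + 2 * ks * kl * (kappa q * h q) * s * x * y / r) / 2"
    unfolding calculation(1) diag sum_acute
    by (simp add: algebra_simps add_divide_distrib diff_divide_distrib)
  then show ?thesis by (simp add: F_def)
qed

end


section \<open>Numbers of roots of each length\<close>

context irreducible_root_system
begin

text \<open>
  The sum \<open>R\<close> of the positive roots of length \<open>L\<close> pairs to 2 with the simple coroots of that length
  and to 0 with the others, so its half has the coordinates \<open>c\<close>. Evaluating \<open>D R R\<close> in two ways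
  gives an equation for the number of roots of length \<open>L\<close>.
\<close>

lemma card_of_length_equation:
  fixes c :: "nat \<Rightarrow> real"
  assumes s: "s > 0" and q: "q \<in> {2, 3}" and lengths: "\<And>a. a \<in> \<Phi> \<Longrightarrow> D a a = s \<or> D a a = q * s"
    and L: "L \<in> {s, q * s}"
    and c: "\<And>i. i \<in> {1..r} \<Longrightarrow> (\<Sum>j=1..r. c j * cartan (\<alpha> j) (\<alpha> i)) = (if D (\<alpha> i) (\<alpha> i) = L then 1 else 0)"
  defines "N \<equiv> real (card (of_length L))"
  shows "12 * (\<Sum>j=1..r. if D (\<alpha> j) (\<alpha> j) = L then c j else 0) = N * (1 + N / r)"
proof -
  define P where "P = {a \<in> \<Phi>. height a > 0}"
  define R where "R = (\<Sum>a\<in>P. if D a a = L then a else 0)"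
  define Q where "Q = (\<Sum>j=1..r. c j *\<^sub>R \<alpha> j)"
  have ne: "q * s \<noteq> s" and Lpos: "L > 0" using s q L by auto
  have finP: "finite P" using finite_roots by (simp add: P_def)
  have R_simple: "cartan R (\<alpha> i) = (if D (\<alpha> i) (\<alpha> i) = L then 2 else 0)" if i: "i \<in> {1..r}" for i
  proof -
    note a = simple_root[OF i]
    have aP: "\<alpha> i \<in> P" using a height_simple[OF i] by (simp add: P_def)
    let ?f = "\<lambda>a. if D a a = L then a else 0"
    \<comment> \<open>The simple reflection permutes the other positive roots and keeps lengths, so
      it affects only the summand of \<open>\<alpha> i\<close> in \<open>R\<close>.\<close>
    have "reflect (\<alpha> i) c \<in> P - {\<alpha> i}" if "c \<in> P - {\<alpha> i}" for c
    proof -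
      have "reflect (\<alpha> i) c \<in> P"
        using that reflect_simple_height[OF i] reflect_in_roots[OF _ a] by (auto simp: P_def)
      moreover have "reflect (\<alpha> i) c \<noteq> \<alpha> i"
      proof
        assume "reflect (\<alpha> i) c = \<alpha> i"
        then have "c = - \<alpha> i" using reflect_reflect[OF a, of c] reflect_self[OF a] by simp
        then show False using that height_simple[OF i] by (simp add: P_def linear_neg[OF linear_height])
      qed
      ultimately show ?thesis by simp
    qed
    then have bij: "bij_betw (reflect (\<alpha> i)) (P - {\<alpha> i}) (P - {\<alpha> i})"
      by (intro bij_betw_byWitness[where f' = "reflect (\<alpha> i)"]) (auto simp: reflect_reflect[OF a])
    have R: "R = ?f (\<alpha> i) + (\<Sum>a\<in>P - {\<alpha> i}. ?f a)"
      unfolding R_def by (rule sum.remove[OF finP aP])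
    have "reflect (\<alpha> i) R = reflect (\<alpha> i) (?f (\<alpha> i)) + (\<Sum>a\<in>P - {\<alpha> i}. reflect (\<alpha> i) (?f a))"
      unfolding R linear_add[OF linear_reflect] linear_sum[OF linear_reflect] ..
    also have "(\<Sum>a\<in>P - {\<alpha> i}. reflect (\<alpha> i) (?f a)) = (\<Sum>a\<in>P - {\<alpha> i}. ?f (reflect (\<alpha> i) a))"
      by (intro sum.cong refl) (simp add: D_reflect[OF a] linear_0[OF linear_reflect])
    also have "\<dots> = (\<Sum>a\<in>P - {\<alpha> i}. ?f a)" by (rule sum.reindex_bij_betw[OF bij])
    also have "reflect (\<alpha> i) (?f (\<alpha> i)) = - ?f (\<alpha> i)"
      by (simp add: reflect_self[OF a] linear_0[OF linear_reflect])
    finally have "cartan R (\<alpha> i) *\<^sub>R \<alpha> i = 2 *\<^sub>R ?f (\<alpha> i)"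
      using R by (simp add: reflect_def scaleR_2 algebra_simps)
    then show ?thesis using root_nonzero[OF a] by (auto split: if_splits)
  qed
  have D_simple: "D R (\<alpha> i) = (if D (\<alpha> i) (\<alpha> i) = L then L else 0)" if "i \<in> {1..r}" for i
    using R_simple[OF that] D_root_pos[OF simple_root[OF that]] by (auto simp: cartan_def field_simps)
  have "D (R - 2 *\<^sub>R Q) (\<alpha> i) = 0" if i: "i \<in> {1..r}" for i
  proof -
    have pos: "D (\<alpha> i) (\<alpha> i) > 0" using D_root_pos[OF simple_root[OF i]] .
    have "2 * D Q (\<alpha> i) = (\<Sum>j=1..r. c j * cartan (\<alpha> j) (\<alpha> i)) * D (\<alpha> i) (\<alpha> i)"
      using pos by (simp add: Q_def D_sum_left D_simps sum_distrib_left sum_distrib_right cartan_def mult_ac)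
    then show ?thesis using D_simple[OF i] c[OF i] by (auto simp: D_simps)
  qed
  then have "D (R - 2 *\<^sub>R Q) v = 0" for v
    by (subst coord_expansion[of v]) (simp add: D_sum_right D_simps(6))
  then have RQ: "R = 2 *\<^sub>R Q" using D_pos[of "R - 2 *\<^sub>R Q"] by force
  have "D R R = 2 * D R Q" by (subst (2) RQ) (simp add: D_simps)
  also have "D R Q = (\<Sum>j=1..r. c j * D R (\<alpha> j))" by (simp add: Q_def D_sum_right D_simps)
  also have "\<dots> = L * (\<Sum>j=1..r. if D (\<alpha> j) (\<alpha> j) = L then c j else 0)"
    unfolding sum_distrib_left by (intro sum.cong refl) (auto simp: D_simple)
  finally have RR: "D R R = 2 * L * (\<Sum>j=1..r. if D (\<alpha> j) (\<alpha> j) = L then c j else 0)" by simp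
  have "D R R = (\<Sum>a\<in>P. \<Sum>b\<in>P. if D a a = L \<and> D b b = L then D a b else 0)"
    unfolding R_def D_sum_left D_sum_right by (intro sum.cong refl) (auto simp: D_simps D_sym)
  then have "complex_of_real (D R R) = (\<Sum>a\<in>P. \<Sum>b\<in>P. if D a a = L \<and> D b b = L then complex_of_real (D a b) else 0)"
    by (simp add: if_distrib of_real_sum cong: if_cong)
  also have "\<dots> = L * N * (1 + 1 / 3 * (N / r - 2)) / 2"
  proof -
    \<comment> \<open>Weights 1 and 0 that select the roots of length L, so that
      \<open>two_length_sum\<close> with h = 1 evaluates \<open>D R R\<close>.\<close>
    define ks :: complex where "ks = (if L = s then 1 else 0)"
    define kl :: complex where "kl = (if L = s then 0 else 1)"
    have "(if D a a = s then ks else kl) * (if D b b = s then ks else kl) * complex_of_real (D a b * 1)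
        = (if D a a = L \<and> D b b = L then complex_of_real (D a b) else 0)" if "a \<in> P" "b \<in> P" for a b
    proof -
      have "a \<in> \<Phi>" "b \<in> \<Phi>" using that by (auto simp: P_def)
      then have "D a a = s \<or> D a a = q * s" "D b b = s \<or> D b b = q * s" using lengths by auto
      then show ?thesis using L ne by (auto simp: ks_def kl_def)
    qed
    then have "(\<Sum>a\<in>P. \<Sum>b\<in>P. if D a a = L \<and> D b b = L then complex_of_real (D a b) else 0) =
        (\<Sum>a\<in>P. \<Sum>b\<in>P. (if D a a = s then ks else kl) * (if D b b = s then ks else kl) * complex_of_real (D a b * 1))"
      by (intro sum.cong refl) simp
    also have "\<dots> = (ks\<^sup>2 * s * card (of_length s) * complex_of_real (1 + 1 / 3 * (card (of_length s) / r - 2))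
        + kl\<^sup>2 * (q * s) * card (of_length (q * s)) * complex_of_real (1 + 1 / 3 * (card (of_length (q * s)) / r - 2))
        + 2 * ks * kl * complex_of_real (kappa q * 1) * s * card (of_length s) * card (of_length (q * s)) / r) / 2"
      using two_length_sum[OF s q lengths linear_height height_pos_iff(2), where ks = ks and kl = kl and h = "\<lambda>_. 1"]
      unfolding P_def by (simp only: of_real_mult)
    also have "\<dots> = complex_of_real (L * N * (1 + 1 / 3 * (N / r - 2)) / 2)"
      using L ne by (auto simp: ks_def kl_def N_def)
    finally show ?thesis .
  qed
  finally have "D R R = L * N * (1 + 1 / 3 * (N / r - 2)) / 2"
    by (simp only: of_real_eq_iff)
  with RR have "L * (12 * (\<Sum>j=1..r. if D (\<alpha> j) (\<alpha> j) = L then c j else 0)) = L * (N * (1 + N / r))"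
    by (simp add: algebra_simps)
  then show ?thesis unfolding mult_cancel_left using Lpos by simp
qed

text \<open>The function t (1 + t / r) is injective for t >= 0, so exhibiting a nonnegative solution
  identifies the number of roots.\<close>

lemma card_of_length:
  fixes c :: "nat \<Rightarrow> real"
  assumes "s > 0" "q \<in> {2, 3}" "\<And>a. a \<in> \<Phi> \<Longrightarrow> D a a = s \<or> D a a = q * s" "L \<in> {s, q * s}"
    and "\<And>i. i \<in> {1..r} \<Longrightarrow> (\<Sum>j=1..r. c j * cartan (\<alpha> j) (\<alpha> i)) = (if D (\<alpha> i) (\<alpha> i) = L then 1 else 0)"
    and N: "N \<ge> 0" "12 * (\<Sum>j=1..r. if D (\<alpha> j) (\<alpha> j) = L then c j else 0) = N * (1 + N / r)"
  shows "real (card (of_length L)) = N"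
proof -
  let ?x = "real (card (of_length L))"
  have "?x * (1 + ?x / r) = N * (1 + N / r)"
    using card_of_length_equation[OF assms(1-5)] N(2) by simp
  then have "(?x - N) * (1 + (?x + N) / r) = 0"
    using rank_pos by (simp add: field_simps)
  moreover have "1 + (?x + N) / r > 0" using N(1) rank_pos by (intro add_pos_nonneg) auto
  ultimately show ?thesis by simp
qed

end


section \<open>The dual form and the coroots\<close>

context
  fixes \<Phi> :: "(real^'n::finite) set" and co :: "real^'n \<Rightarrow> real^'n" and B :: "real^'n \<Rightarrow> real^'n \<Rightarrow> real"
  assumes form: "invariant_form \<Phi> co B" and roots: "root_system \<Phi> co"
begin

lemma bilinear_B: "bilinear B"
  and B_sym: "B u v = B v u"
  and B_pos: "v \<noteq> 0 \<Longrightarrow> B v v > 0"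
  using form by (auto simp: invariant_form_def)

lemma B_simps:
  "B (u + v) w = B u w + B v w" "B u (v + w) = B u v + B u w"
  "B (u - v) w = B u w - B v w" "B u (v - w) = B u v - B u w"
  "B (c *\<^sub>R u) v = c * B u v" "B u (c *\<^sub>R v) = c * B u v"
  "B (- u) v = - B u v" "B u (- v) = - B u v" "B 0 v = 0" "B u 0 = 0"
  using bilinear_B
  by (simp_all add: bilinear_ladd bilinear_radd bilinear_lsub bilinear_rsub bilinear_lmul bilinear_rmul
      bilinear_lneg bilinear_rneg bilinear_lzero bilinear_rzero)

lemma B_unique: "(\<And>v. B u v = B u' v) \<Longrightarrow> u = u'"
  using B_pos[of "u - u'"] by (force simp: B_simps)

text \<open>Shows that the description in \<open>riesz\<close> denotes: the operator
  \<open>T\<close> representing \<open>B\<close> is injective by definiteness, hence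
  surjective.\<close>

lemma B_riesz: "B (riesz B l) v = l \<bullet> v"
proof -
  define T where "T u = (\<Sum>i\<in>Basis. B u i *\<^sub>R i)" for u :: "real^'n"
  have T: "T u \<bullet> v = B u v" for u v
  proof -
    have "B u v = B u (\<Sum>i\<in>Basis. (v \<bullet> i) *\<^sub>R i)" by (simp add: euclidean_representation)
    also have "\<dots> = (\<Sum>i\<in>Basis. (v \<bullet> i) * B u i)"
      using bilinear_B by (subst linear_sum) (auto simp: bilinear_def B_simps)
    also have "\<dots> = T u \<bullet> v" by (simp add: T_def inner_sum_left inner_commute[of v] mult.commute)
    finally show ?thesis by simp
  qed
  have "linear T" by (rule linearI) (simp_all add: T_def B_simps scaleR_add_left sum.distrib scaleR_sum_right)
  moreover have "inj T"
  proof (rule injI)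
    fix u u' assume "T u = T u'"
    then show "u = u'" using T by (intro B_unique) metis
  qed
  ultimately have "surj T" by (rule linear_inj_imp_surj)
  then obtain u where u: "T u = l" by (metis surjD)
  have "riesz B l = u"
    unfolding riesz_def by (rule the_equality) (use T u B_unique in \<open>metis+\<close>)
  then show ?thesis using T u by metis
qed

lemma riesz_eqI: "(\<And>v. B u v = l \<bullet> v) \<Longrightarrow> riesz B l = u"
  by (rule B_unique) (simp add: B_riesz)

lemma dual_form_inner: "dual_form B l m = l \<bullet> riesz B m"
  by (simp add: dual_form_def B_riesz)

lemma linear_riesz: "linear (riesz B)"
  by (rule linearI) (rule riesz_eqI, simp add: B_simps B_riesz inner_add_left)+

lemma dual_form_sym: "dual_form B l m = dual_form B m l"
  using B_sym by (simp add: dual_form_def)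

lemma bilinear_dual_form: "bilinear (dual_form B)"
  unfolding bilinear_def dual_form_def
  by (auto intro!: linearI simp: linear_add[OF linear_riesz] linear_scale[OF linear_riesz] B_simps)

lemma dual_form_pos: "l \<noteq> 0 \<Longrightarrow> dual_form B l l > 0"
proof -
  assume "l \<noteq> 0"
  have "riesz B l \<noteq> 0"
  proof
    assume "riesz B l = 0"
    then have "l \<bullet> l = 0" using B_riesz[of l l] by (simp add: B_simps)
    then show False using \<open>l \<noteq> 0\<close> by simp
  qed
  then show ?thesis unfolding dual_form_def by (rule B_pos)
qed

text \<open>The reflection negates \<open>co a\<close>, so invariance makes \<open>B (co a)\<close>
  a multiple of the functional \<open>a\<close>; pairing with \<open>co a\<close> fixes the
  multiple.\<close>

lemma riesz_root:
  assumes a: "a \<in> \<Phi>"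
  shows "riesz B a = (dual_form B a a / 2) *\<^sub>R co a" and "dual_form B a a > 0"
proof -
  have 2: "a \<bullet> co a = 2" using roots a by (simp add: root_system_def)
  then have "co a \<noteq> 0" by auto
  then have pos: "B (co a) (co a) > 0" by (rule B_pos)
  have "refl co a \<in> weyl_group \<Phi> co"
    using weyl_group_refl[OF weyl_group_id a] by simp
  then have inv: "B (refl co a u) (refl co a v) = B u v" for u v
    using form by (simp add: invariant_form_def)
  have "B (co a) v = (a \<bullet> v) * B (co a) (co a) / 2" for v
    using inv[of "co a" v] by (simp add: refl_def 2 scaleR_2 B_simps algebra_simps)
  then have r: "riesz B a = (2 / B (co a) (co a)) *\<^sub>R co a"
    using pos by (intro riesz_eqI) (simp add: B_simps field_simps)
  then have "dual_form B a a = 4 / B (co a) (co a)"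
    by (simp add: dual_form_inner 2)
  then show "riesz B a = (dual_form B a a / 2) *\<^sub>R co a" "dual_form B a a > 0" using r pos by simp_all
qed

lemma inner_co:
  assumes "a \<in> \<Phi>" shows "b \<bullet> co a = 2 * dual_form B b a / dual_form B a a"
proof -
  have "dual_form B b a = dual_form B a a / 2 * (b \<bullet> co a)"
    unfolding dual_form_inner[of b] riesz_root(1)[OF assms] by simp
  then show ?thesis using riesz_root(2)[OF assms] by (simp add: field_simps)
qed

lemma B_co_co:
  assumes "a \<in> \<Phi>" "b \<in> \<Phi>"
  shows "B (co a) (co b) = 4 * dual_form B a b / (dual_form B a a * dual_form B b b)"
  using riesz_root[OF assms(1)] riesz_root[OF assms(2)]
  by (simp add: dual_form_def[of B a b] B_simps)

lemma dual_refl_eq: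
  assumes "b \<in> \<Phi>"
  shows "dual_refl co b a = a - (2 * dual_form B a b / dual_form B b b) *\<^sub>R b"
  using assms by (simp add: dual_refl_def inner_co)

lemma euclidean_dual_form: "euclidean_root_system \<Phi> (dual_form B)"
proof
  show "bilinear (dual_form B)" by (rule bilinear_dual_form)
  show "dual_form B u v = dual_form B v u" for u v by (rule dual_form_sym)
  show "v \<noteq> 0 \<Longrightarrow> dual_form B v v > 0" for v by (rule dual_form_pos)
  show "finite \<Phi>" "0 \<notin> \<Phi>" "span \<Phi> = UNIV" using roots by (simp_all add: root_system_def)
  show "a \<in> \<Phi> \<Longrightarrow> c *\<^sub>R a \<in> \<Phi> \<Longrightarrow> c = 1 \<or> c = - 1" for a c
    using roots by (simp add: root_system_def)
  show "a - (2 * dual_form B a b / dual_form B b b) *\<^sub>R b \<in> \<Phi>" if "a \<in> \<Phi>" "b \<in> \<Phi>" for a b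
  proof -
    have "dual_refl co b ` \<Phi> = \<Phi>" using roots that by (simp add: root_system_def)
    then have "dual_refl co b a \<in> \<Phi>" using that by blast
    then show ?thesis using that by (simp add: dual_refl_eq)
  qed
  show "2 * dual_form B a b / dual_form B b b \<in> \<int>" if "a \<in> \<Phi>" "b \<in> \<Phi>" for a b
  proof -
    have "a \<bullet> co b \<in> \<int>" using roots that unfolding root_system_def by blast
    then show ?thesis by (simp add: inner_co that)
  qed
qed

text \<open>Dividing p by \<open>B (co a) (co b)\<close> gives exactly
  \<open>dual_form B a b\<close>, since p has the square of that number as a factor. For orthogonal
  roots both sides are 0.\<close>

lemma degree0_nu'_Omega_dual_form:
  assumes "P \<subseteq> \<Phi>"
  shows "degree0 (nu'_Omega P co B k) = (\<Sum>a\<in>P. \<Sum>b\<in>P. k a * k b * complex_of_real (dual_form B a b *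
    ((4 - (2 * dual_form B a b / dual_form B b b) * (2 * dual_form B b a / dual_form B a a)) / 32)))"
proof -
  have "degree0 (nu'_Omega P co B k) = (\<Sum>a\<in>P. \<Sum>b\<in>P. k a * k b *
     complex_of_real ((a \<bullet> co b) * (b \<bullet> co a) * (4 - (a \<bullet> co b) * (b \<bullet> co a)) / (32 * B (co a) (co b))))"
    using roots assms by (intro degree0_nu'_Omega) (auto simp: root_system_def)
  also have "\<dots> = (\<Sum>a\<in>P. \<Sum>b\<in>P. k a * k b * complex_of_real (dual_form B a b *
    ((4 - (2 * dual_form B a b / dual_form B b b) * (2 * dual_form B b a / dual_form B a a)) / 32)))"
  proof (intro sum.cong refl)
    fix a b assume "a \<in> P" "b \<in> P"
    then have ab: "a \<in> \<Phi>" "b \<in> \<Phi>" using assms by auto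
    then have pos: "dual_form B a a > 0" "dual_form B b b > 0" using riesz_root(2) by auto
    have sym: "dual_form B b a = dual_form B a b" by (rule dual_form_sym)
    let ?d = "dual_form B a b" and ?p = "(a \<bullet> co b) * (b \<bullet> co a)"
    have "?p * (4 - ?p) / (32 * B (co a) (co b)) = ?d * ((4 - ?p) / 32)"
    proof (cases "?d = 0")
      case False
      then have "?p / B (co a) (co b) = ?d"
        using pos by (simp add: inner_co ab B_co_co sym divide_simps)
      then show ?thesis by (metis (no_types, lifting) mult.commute times_divide_times_eq)
    qed (simp add: inner_co ab sym)
    then show "k a * k b * complex_of_real (?p * (4 - ?p) / (32 * B (co a) (co b))) =
      k a * k b * complex_of_real (?d * ((4 - (2 * ?d / dual_form B b b) * (2 * dual_form B b a / dual_form B a a)) / 32))"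
      by (simp only: inner_co ab)
  qed
  finally show ?thesis .
qed

lemma parameter_invariant:
  assumes "invariant_parameter \<Phi> co k" "a \<in> \<Phi>" "b \<in> \<Phi>"
  shows "k (a - (2 * dual_form B a b / dual_form B b b) *\<^sub>R b) = k a"
proof -
  have "dual_refl co b \<in> dual_weyl_group \<Phi> co"
    using dual_weyl_group_refl[OF dual_weyl_group_id assms(3)] by simp
  then have "k (dual_refl co b a) = k a" using assms by (simp add: invariant_parameter_def)
  then show ?thesis using assms by (simp add: dual_refl_eq)
qed

lemma based_dual_form:
  assumes base: "root_base \<Phi> r \<alpha>"
  shows "\<exists>\<xi>. based_root_system \<Phi> (dual_form B) r \<alpha> \<xi>" and "CARD('n) = r"
proof -
  let ?A = "\<alpha> ` {1..r}"
  have inj: "inj_on \<alpha> {1..r}" and sub: "?A \<subseteq> \<Phi>" and ind: "independent ?A"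
    and comb: "\<And>b. b \<in> \<Phi> \<Longrightarrow> \<exists>c :: nat \<Rightarrow> nat.
        b = (\<Sum>i=1..r. real (c i) *\<^sub>R \<alpha> i) \<or> b = - (\<Sum>i=1..r. real (c i) *\<^sub>R \<alpha> i)"
    using base unfolding root_base_def by blast+
  have "\<Phi> \<subseteq> span ?A"
  proof
    fix b assume "b \<in> \<Phi>"
    have in_span: "(\<Sum>i=1..r. real (c i) *\<^sub>R \<alpha> i) \<in> span ?A" for c :: "nat \<Rightarrow> nat"
    proof (rule span_sum)
      fix i assume "i \<in> {1..r}"
      then have "\<alpha> i \<in> ?A" by blast
      then show "real (c i) *\<^sub>R \<alpha> i \<in> span ?A" by (rule span_scale[OF span_base])
    qed
    from comb[OF \<open>b \<in> \<Phi>\<close>] obtain c :: "nat \<Rightarrow> nat"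
      where "b = (\<Sum>i=1..r. real (c i) *\<^sub>R \<alpha> i) \<or> b = - (\<Sum>i=1..r. real (c i) *\<^sub>R \<alpha> i)" ..
    then show "b \<in> span ?A" using in_span[of c] span_neg[OF in_span[of c]] by (elim disjE) simp_all
  qed
  then have "span \<Phi> \<subseteq> span ?A" by (rule span_minimal[OF _ subspace_span])
  moreover have "span \<Phi> = UNIV" using roots unfolding root_system_def by (elim conjE)
  ultimately have span: "span ?A = UNIV" by (simp only: top.extremum_unique)
  have "card ?A = DIM(real^'n)"
    using dim_eq_card_independent[OF ind] dim_span[of ?A] unfolding span dim_UNIV by simp
  then show "CARD('n) = r" using inj by (simp add: card_image)
  have "\<exists>f. linear f \<and> (\<forall>j\<in>{1..r}. f (\<alpha> j) = (if i = j then 1 else 0 :: real))" if "i \<in> {1..r}" for i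
  proof -
    obtain f where f: "linear f" "\<forall>x\<in>?A. f x = (if x = \<alpha> i then 1 else 0 :: real)"
      using linear_independent_extend[OF ind, of "\<lambda>x. if x = \<alpha> i then 1 else 0 :: real"] by (elim exE conjE)
    have "f (\<alpha> j) = (if i = j then 1 else 0)" if "j \<in> {1..r}" for j
    proof -
      have "\<alpha> j = \<alpha> i \<longleftrightarrow> j = i" by (rule inj_on_eq_iff[OF inj that \<open>i \<in> {1..r}\<close>])
      then show ?thesis using f(2) that by auto
    qed
    then show ?thesis using f(1) by blast
  qed
  \<comment> \<open>The locale asks for linearity of \<open>\<xi> i\<close> at every index, so the
    zero map stands in outside \<open>{1..r}\<close>.\<close>
  then have "\<exists>f. linear f \<and> (i \<in> {1..r} \<longrightarrow> (\<forall>j\<in>{1..r}. f (\<alpha> j) = (if i = j then 1 else 0 :: real)))" for i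
  proof (cases "i \<in> {1..r}")
    case False
    have "linear (\<lambda>_ :: real^'n. 0 :: real)" by (rule linearI) simp_all
    then show ?thesis using False by blast
  qed blast
  then have "\<exists>\<xi>. \<forall>i. linear (\<xi> i) \<and>
      (i \<in> {1..r} \<longrightarrow> (\<forall>j\<in>{1..r}. \<xi> i (\<alpha> j) = (if i = j then 1 else 0 :: real)))"
    by (intro choice allI)
  then obtain \<xi> where \<xi>: "\<And>i. linear (\<xi> i)"
      "\<And>i j. i \<in> {1..r} \<Longrightarrow> j \<in> {1..r} \<Longrightarrow> \<xi> i (\<alpha> j) = (if i = j then 1 else 0 :: real)"
    by blast
  have expansion: "v = (\<Sum>i=1..r. \<xi> i v *\<^sub>R \<alpha> i)" for v
  proof (rule linear_eq_on_span[of "\<lambda>v. v" "\<lambda>v. \<Sum>i=1..r. \<xi> i v *\<^sub>R \<alpha> i" ?A])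
    show "linear (\<lambda>v. \<Sum>i=1..r. \<xi> i v *\<^sub>R \<alpha> i)"
      by (rule linearI) (simp_all add: linear_add[OF \<xi>(1)] linear_scale[OF \<xi>(1)] scaleR_add_left sum.distrib scaleR_sum_right)
    fix x assume "x \<in> ?A"
    then obtain j where j: "j \<in> {1..r}" "x = \<alpha> j" by auto
    have "(\<Sum>i=1..r. \<xi> i x *\<^sub>R \<alpha> i) = (\<Sum>i=1..r. if i = j then \<alpha> j else 0)"
      using j by (intro sum.cong refl) (auto simp: \<xi>(2))
    then show "x = (\<Sum>i=1..r. \<xi> i x *\<^sub>R \<alpha> i)" using j by (simp add: sum.delta)
  next
    show "v \<in> span ?A" unfolding span by (rule UNIV_I)
  qed (rule linear_ident)
  have coord_sum: "\<xi> i (\<Sum>j=1..r. real (c j) *\<^sub>R \<alpha> j) = real (c i)" if "i \<in> {1..r}" for i c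
  proof -
    have "\<xi> i (\<Sum>j=1..r. real (c j) *\<^sub>R \<alpha> j) = (\<Sum>j=1..r. if j = i then real (c i) else 0)"
      unfolding linear_sum[OF \<xi>(1)] linear_scale[OF \<xi>(1)]
      using that by (intro sum.cong refl) (auto simp: \<xi>(2))
    then show ?thesis using that by (simp add: sum.delta)
  qed
  have "based_root_system \<Phi> (dual_form B) r \<alpha> \<xi>"
  proof (intro based_root_system.intro based_root_system_axioms.intro euclidean_dual_form)
    show "i \<in> {1..r} \<Longrightarrow> \<alpha> i \<in> \<Phi>" for i using sub by auto
    show "(\<forall>i\<in>{1..r}. \<xi> i b \<ge> 0) \<or> (\<forall>i\<in>{1..r}. \<xi> i b \<le> 0)" if "b \<in> \<Phi>" for b
    proof -
      from comb[OF that] obtain c :: "nat \<Rightarrow> nat"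
        where "b = (\<Sum>i=1..r. real (c i) *\<^sub>R \<alpha> i) \<or> b = - (\<Sum>i=1..r. real (c i) *\<^sub>R \<alpha> i)" ..
      then show ?thesis
      proof
        assume "b = (\<Sum>i=1..r. real (c i) *\<^sub>R \<alpha> i)"
        then have "\<xi> i b = real (c i)" if "i \<in> {1..r}" for i using coord_sum[OF that] by blast
        then show ?thesis by simp
      next
        assume "b = - (\<Sum>i=1..r. real (c i) *\<^sub>R \<alpha> i)"
        then have "\<xi> i b = - real (c i)" if "i \<in> {1..r}" for i
          using coord_sum[OF that] linear_neg[OF \<xi>(1)] by simp
        then show ?thesis by simp
      qed
    qed
  qed (fact \<xi> expansion)+
  then show "\<exists>\<xi>. based_root_system \<Phi> (dual_form B) r \<alpha> \<xi>" by blast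
qed

end


section \<open>Evaluation from the Cartan matrix\<close>

text \<open>
  \<open>t\<close> lists the squared lengths of the simple roots, the shortest being 1 and the longest \<open>q\<close>; \<open>cs\<close> and
  \<open>cl\<close> are the coordinates of half the sum of the positive roots of length 1 and \<open>q\<close>, and \<open>x\<close> and \<open>y\<close> the
  numbers of roots of length 1 and \<open>q\<close>. In the simply laced types no root has length \<open>q\<close>, and \<open>y = 0\<close>.
\<close>

definition cartan_data ::
    "cartan_type \<Rightarrow> real \<Rightarrow> (nat \<Rightarrow> real) \<Rightarrow> (nat \<Rightarrow> real) \<Rightarrow> (nat \<Rightarrow> real) \<Rightarrow> real \<Rightarrow> real \<Rightarrow> bool" where
  "cartan_data X q t cs cl x y \<longleftrightarrow> (let r = type_rank X; A = (\<lambda>i j. real_of_int (cartan_entry X i j)) in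
     q \<in> {2, 3} \<and> (\<forall>i\<in>{1..r}. t i = 1 \<or> t i = q) \<and> (\<exists>i\<in>{1..r}. t i = 1) \<and>
     (\<forall>i\<in>{1..r}. \<forall>j\<in>{1..r}. A i j * t j = A j i * t i) \<and>
     (\<forall>i\<in>{1..r}. (\<Sum>j=1..r. cs j * A j i) = (if t i = 1 then 1 else 0)) \<and>
     (\<forall>i\<in>{1..r}. (\<Sum>j=1..r. cl j * A j i) = (if t i = q then 1 else 0)) \<and>
     x \<ge> 0 \<and> 12 * (\<Sum>j=1..r. if t j = 1 then cs j else 0) = x * (1 + x / r) \<and>
     y \<ge> 0 \<and> 12 * (\<Sum>j=1..r. if t j = q then cl j else 0) = y * (1 + y / r) \<and>
     (\<forall>g :: nat \<Rightarrow> real. (\<forall>i\<in>{1..r}. \<forall>j\<in>{1..r}. A i j \<noteq> 0 \<longrightarrow> g i = g j) \<longrightarrow>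
        (\<forall>i\<in>{1..r}. \<forall>j\<in>{1..r}. g i = g j)) \<and>
     (\<forall>g :: nat \<Rightarrow> complex. (\<forall>i\<in>{1..r}. \<forall>j\<in>{1..r}. A i j = -1 \<and> A j i = -1 \<longrightarrow> g i = g j) \<longrightarrow>
        (\<forall>i\<in>{1..r}. \<forall>j\<in>{1..r}. t i = t j \<longrightarrow> g i = g j)))"

text \<open>For h p = (4 - p) / 32 the diagonal value h 4 is 0 and \<open>kappa p * h p\<close> is
  1/32, 1/32, 1/48 for p = 1, 2, 3; hence the common 1/64 and the extra 2/3 when q = 3. If y = 0,
  the terms with \<open>k b\<close> vanish and \<open>b\<close> may be arbitrary.\<close>

lemma degree0_cartan_data:
  fixes \<Phi> P :: "(real^'n::finite) set" and k :: "real^'n \<Rightarrow> complex"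
  assumes roots: "root_system \<Phi> co" and type: "has_type \<Phi> co X"
    and positive: "positive_system \<Phi> P" and form: "invariant_form \<Phi> co B"
    and k: "invariant_parameter \<Phi> co k" and data: "cartan_data X q t cs cl x y"
    and a: "a \<in> short_roots \<Phi> B" and b: "y = 0 \<or> b \<in> long_roots \<Phi> B"
    and s: "dual_form B a a = s"
  shows "degree0 (nu'_Omega P co B k) =
    ((k a)\<^sup>2 * complex_of_real (s * x * (x / type_rank X - 2))
     + (k b)\<^sup>2 * complex_of_real (q * s * y * (y / type_rank X - 2))
     + 2 * k a * k b * complex_of_real ((if q = 2 then 1 else 2 / 3) * s * x * y / type_rank X)) / 64"
proof -
  define r where "r = type_rank X"
  define A where "A i j = real_of_int (cartan_entry X i j)" for i j
  let ?D = "dual_form B"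
  obtain \<alpha> where base: "root_base \<Phi> r \<alpha>"
    and entries: "\<And>i j. i \<in> {1..r} \<Longrightarrow> j \<in> {1..r} \<Longrightarrow> \<alpha> i \<bullet> co (\<alpha> j) = A i j"
    using type by (auto simp: has_type_def r_def A_def)
  have q: "q \<in> {2, 3}" and t: "\<And>i. i \<in> {1..r} \<Longrightarrow> t i = 1 \<or> t i = q"
    and short: "\<exists>i\<in>{1..r}. t i = 1"
    and sym: "\<And>i j. i \<in> {1..r} \<Longrightarrow> j \<in> {1..r} \<Longrightarrow> A i j * t j = A j i * t i"
    and cs: "\<And>i. i \<in> {1..r} \<Longrightarrow> (\<Sum>j=1..r. cs j * A j i) = (if t i = 1 then 1 else 0)"
    and cl: "\<And>i. i \<in> {1..r} \<Longrightarrow> (\<Sum>j=1..r. cl j * A j i) = (if t i = q then 1 else 0)"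
    and x: "x \<ge> 0" "12 * (\<Sum>j=1..r. if t j = 1 then cs j else 0) = x * (1 + x / r)"
    and y: "y \<ge> 0" "12 * (\<Sum>j=1..r. if t j = q then cl j else 0) = y * (1 + y / r)"
    using data unfolding cartan_data_def Let_def r_def[symmetric] A_def[symmetric] by blast+
  have conn: "\<forall>g :: nat \<Rightarrow> real. (\<forall>i\<in>{1..r}. \<forall>j\<in>{1..r}. A i j \<noteq> 0 \<longrightarrow> g i = g j) \<longrightarrow>
        (\<forall>i\<in>{1..r}. \<forall>j\<in>{1..r}. g i = g j)"
    and conn_length: "\<forall>g :: nat \<Rightarrow> complex.
        (\<forall>i\<in>{1..r}. \<forall>j\<in>{1..r}. A i j = -1 \<and> A j i = -1 \<longrightarrow> g i = g j) \<longrightarrow>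
        (\<forall>i\<in>{1..r}. \<forall>j\<in>{1..r}. t i = t j \<longrightarrow> g i = g j)"
    using data unfolding cartan_data_def Let_def r_def[symmetric] A_def[symmetric] by blast+
  obtain \<xi> where based: "based_root_system \<Phi> ?D r \<alpha> \<xi>"
    using based_dual_form(1)[OF form roots base] ..
  interpret based_root_system \<Phi> ?D r \<alpha> \<xi> by (rule based)
  have cartan_simple: "cartan (\<alpha> i) (\<alpha> j) = A i j" if "i \<in> {1..r}" "j \<in> {1..r}" for i j
    using inner_co[OF form roots simple_root[OF that(2)], of "\<alpha> i"] entries[OF that] by (simp add: cartan_def)
  interpret irreducible_root_system \<Phi> ?D r \<alpha> \<xi>
  proof
    show "DIM(real^'n) = r" using based_dual_form(2)[OF form roots base] by simp
    fix g :: "nat \<Rightarrow> real" and i j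
    assume g: "\<And>i j. i \<in> {1..r} \<Longrightarrow> j \<in> {1..r} \<Longrightarrow> cartan (\<alpha> i) (\<alpha> j) \<noteq> 0 \<Longrightarrow> g i = g j"
      and ij: "i \<in> {1..r}" "j \<in> {1..r}"
    have "\<forall>i\<in>{1..r}. \<forall>j\<in>{1..r}. A i j \<noteq> 0 \<longrightarrow> g i = g j" using g cartan_simple by simp
    then show "g i = g j" using conn ij by blast
  qed
  obtain i0 where i0: "i0 \<in> {1..r}" "t i0 = 1" using short by blast
  define m where "m = ?D (\<alpha> i0) (\<alpha> i0)"
  have m: "m > 0" unfolding m_def by (rule D_root_pos[OF simple_root[OF i0(1)]])
  have t_pos: "t i > 0" if "i \<in> {1..r}" for i using t[OF that] q by auto
  have len: "?D (\<alpha> i) (\<alpha> i) = m * t i" if i: "i \<in> {1..r}" for i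
  proof -
    \<comment> \<open>Symmetry of \<open>A i j * t j\<close> makes the quotient agree at the two
      ends of each edge, so \<open>t\<close> determines the lengths up to the one scale
      \<open>m\<close>.\<close>
    have "?D (\<alpha> i) (\<alpha> i) / t i = ?D (\<alpha> i0) (\<alpha> i0) / t i0"
    proof (rule connected[OF _ i i0(1)])
      fix i j assume ij: "i \<in> {1..r}" "j \<in> {1..r}" "cartan (\<alpha> i) (\<alpha> j) \<noteq> 0"
      have pos: "?D (\<alpha> i) (\<alpha> i) > 0" "?D (\<alpha> j) (\<alpha> j) > 0" using ij simple_root D_root_pos by auto
      have nz: "?D (\<alpha> i) (\<alpha> j) \<noteq> 0" using ij(3) by (auto simp: cartan_def)
      have "cartan (\<alpha> i) (\<alpha> j) * t j = cartan (\<alpha> j) (\<alpha> i) * t i"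
        using sym[OF ij(1,2)] ij(1,2) by (simp add: cartan_simple)
      then have "?D (\<alpha> i) (\<alpha> j) * (t j * ?D (\<alpha> i) (\<alpha> i)) = ?D (\<alpha> i) (\<alpha> j) * (t i * ?D (\<alpha> j) (\<alpha> j))"
        using pos D_sym[of "\<alpha> j" "\<alpha> i"] by (simp add: cartan_def field_simps)
      then have "t j * ?D (\<alpha> i) (\<alpha> i) = t i * ?D (\<alpha> j) (\<alpha> j)" using nz by simp
      then show "?D (\<alpha> i) (\<alpha> i) / t i = ?D (\<alpha> j) (\<alpha> j) / t j"
        using t_pos[OF ij(1)] t_pos[OF ij(2)] by (simp add: field_simps)
    qed
    then show ?thesis using t_pos[OF i] i0 by (simp add: m_def field_simps)
  qed
  have lengths: "?D c c = m \<or> ?D c c = q * m" if "c \<in> \<Phi>" for c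
    using that
  proof (induction rule: root_induct)
    case (simple i)
    then show ?case using len t by fastforce
  next
    case (reflect c d)
    then show ?case by (simp add: D_reflect)
  qed
  have q1: "q > 1" using q by auto
  then have qm: "m < q * m" using m by simp
  have a_root: "a \<in> \<Phi>" "\<And>c. c \<in> \<Phi> \<Longrightarrow> ?D a a \<le> ?D c c" using a by (auto simp: short_roots_def)
  have "?D (\<alpha> i0) (\<alpha> i0) = m" by (simp add: m_def)
  then have Da: "?D a a = m"
    using a_root(2)[OF simple_root[OF i0(1)]] lengths[OF a_root(1)] qm by auto
  then have ms: "m = s" using s by simp
  have card_x: "real (card (of_length m)) = x"
  proof (rule card_of_length[where q = q and c = cs, OF m q lengths])
    have iff: "?D (\<alpha> i) (\<alpha> i) = m \<longleftrightarrow> t i = 1" if "i \<in> {1..r}" for i using len[OF that] m by simp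
    show "(\<Sum>j=1..r. cs j * cartan (\<alpha> j) (\<alpha> i)) = (if ?D (\<alpha> i) (\<alpha> i) = m then 1 else 0)" if "i \<in> {1..r}" for i
      unfolding iff[OF that] cs[OF that, symmetric] using that by (intro sum.cong refl) (simp add: cartan_simple)
    have "(\<Sum>j=1..r. if ?D (\<alpha> j) (\<alpha> j) = m then cs j else 0) = (\<Sum>j=1..r. if t j = 1 then cs j else 0)"
      by (intro sum.cong refl) (simp add: iff)
    then show "12 * (\<Sum>j=1..r. if ?D (\<alpha> j) (\<alpha> j) = m then cs j else 0) = x * (1 + x / r)" using x by simp
  qed (use x in auto)
  have card_y: "real (card (of_length (q * m))) = y"
  proof (rule card_of_length[where q = q and c = cl, OF m q lengths])
    have iff: "?D (\<alpha> i) (\<alpha> i) = q * m \<longleftrightarrow> t i = q" if "i \<in> {1..r}" for i using len[OF that] m by auto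
    show "(\<Sum>j=1..r. cl j * cartan (\<alpha> j) (\<alpha> i)) = (if ?D (\<alpha> i) (\<alpha> i) = q * m then 1 else 0)" if "i \<in> {1..r}" for i
      unfolding iff[OF that] cl[OF that, symmetric] using that by (intro sum.cong refl) (simp add: cartan_simple)
    have "(\<Sum>j=1..r. if ?D (\<alpha> j) (\<alpha> j) = q * m then cl j else 0) = (\<Sum>j=1..r. if t j = q then cl j else 0)"
      by (intro sum.cong refl) (simp add: iff)
    then show "12 * (\<Sum>j=1..r. if ?D (\<alpha> j) (\<alpha> j) = q * m then cl j else 0) = y * (1 + y / r)" using y by simp
  qed (use y in auto)
  have k_reflect: "k (reflect d c) = k c" if "c \<in> \<Phi>" "d \<in> \<Phi>" for c d
    using parameter_invariant[OF form roots k that] by (simp add: reflect_def cartan_def)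
  have adjacent: "\<forall>i\<in>{1..r}. \<forall>j\<in>{1..r}. A i j = -1 \<and> A j i = -1 \<longrightarrow> k (\<alpha> i) = k (\<alpha> j)"
  proof (intro ballI impI)
    fix i j assume ij: "i \<in> {1..r}" "j \<in> {1..r}" "A i j = -1 \<and> A j i = -1"
    \<comment> \<open>Both sides equal \<open>\<alpha> i + \<alpha> j\<close>: the ends of a simple
      edge are conjugate, so \<open>k\<close> agrees on them.\<close>
    then have "reflect (\<alpha> j) (\<alpha> i) = reflect (\<alpha> i) (\<alpha> j)"
      by (simp add: reflect_def cartan_simple)
    then show "k (\<alpha> i) = k (\<alpha> j)"
      using k_reflect[OF simple_root[OF ij(1)] simple_root[OF ij(2)]]
        k_reflect[OF simple_root[OF ij(2)] simple_root[OF ij(1)]] by simp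
  qed
  note conn_k = conn_length[THEN spec, of "\<lambda>i. k (\<alpha> i)", THEN mp, OF adjacent]
  have k_simple: "k (\<alpha> i) = k (\<alpha> j)" if "i \<in> {1..r}" "j \<in> {1..r}" "t i = t j" for i j
    using conn_k that by blast
  have k_conj: "\<exists>i\<in>{1..r}. k c = k (\<alpha> i) \<and> ?D c c = ?D (\<alpha> i) (\<alpha> i)" if "c \<in> \<Phi>" for c
    using that
  proof (induction rule: root_induct)
    case (reflect c d)
    then show ?case by (simp add: D_reflect k_reflect)
  qed blast
  have k_length: "k c = k d" if cd: "c \<in> \<Phi>" "d \<in> \<Phi>" "?D c c = ?D d d" for c d
  proof -
    obtain i where i: "i \<in> {1..r}" "k c = k (\<alpha> i)" "?D c c = ?D (\<alpha> i) (\<alpha> i)" using k_conj[OF cd(1)] by blast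
    obtain j where j: "j \<in> {1..r}" "k d = k (\<alpha> j)" "?D d d = ?D (\<alpha> j) (\<alpha> j)" using k_conj[OF cd(2)] by blast
    have "t i = t j" using i j cd(3) len m by auto
    from k_simple[OF i(1) j(1) this] show ?thesis using i(2) j(2) by simp
  qed
  have k_eq: "k c = (if ?D c c = m then k a else k b)" if c: "c \<in> \<Phi>" for c
  proof (cases "?D c c = m")
    case True
    then show ?thesis using k_length[OF c a_root(1)] Da by simp
  next
    case False
    then have Dc: "?D c c = q * m" using lengths[OF c] by simp
    then have "c \<in> of_length (q * m)" using c by (simp add: of_length_def)
    then have "y \<noteq> 0" using card_y finite_of_length[of "q * m"] by auto
    then have bl: "b \<in> \<Phi>" "?D c c \<le> ?D b b" using b c by (auto simp: long_roots_def)
    then have "?D b b = q * m" using Dc lengths[OF bl(1)] qm by auto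
    then show ?thesis using k_length[OF c bl(1)] Dc False by simp
  qed
  obtain v where v: "\<And>c. c \<in> \<Phi> \<Longrightarrow> c \<bullet> v \<noteq> 0" and P: "P = {c \<in> \<Phi>. c \<bullet> v > 0}"
    using positive unfolding positive_system_def by blast
  have lin: "linear (\<lambda>c :: real^'n. c \<bullet> v)" by (rule linearI) (simp_all add: inner_add_left)
  define h :: "real \<Rightarrow> real" where "h p = (4 - p) / 32" for p
  have "degree0 (nu'_Omega P co B k) = (\<Sum>c\<in>P. \<Sum>d\<in>P. k c * k d *
      complex_of_real (?D c d * h (cartan c d * cartan d c)))"
    unfolding h_def cartan_def by (rule degree0_nu'_Omega_dual_form[OF form roots]) (simp add: P)
  also have "\<dots> = (\<Sum>c\<in>P. \<Sum>d\<in>P. (if ?D c c = m then k a else k b) * (if ?D d d = m then k a else k b) *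
      complex_of_real (?D c d * h (cartan c d * cartan d c)))"
  proof (intro sum.cong refl)
    fix c d assume "c \<in> P" "d \<in> P"
    then have "c \<in> \<Phi>" "d \<in> \<Phi>" by (auto simp: P)
    then show "k c * k d * complex_of_real (?D c d * h (cartan c d * cartan d c)) =
      (if ?D c c = m then k a else k b) * (if ?D d d = m then k a else k b) *
      complex_of_real (?D c d * h (cartan c d * cartan d c))"
      by (simp only: k_eq[of c] k_eq[of d])
  qed
  also have "\<dots> = ((k a)\<^sup>2 * complex_of_real m * complex_of_real x * complex_of_real (h 4 + h 1 / 3 * (x / r - 2))
     + (k b)\<^sup>2 * (complex_of_real q * complex_of_real m) * complex_of_real y * complex_of_real (h 4 + h 1 / 3 * (y / r - 2))
     + 2 * k a * k b * complex_of_real (kappa q * h q) * complex_of_real m * complex_of_real x * complex_of_real y / r) / 2"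
  proof -
    have "complex_of_nat (card (of_length m)) = complex_of_real x"
      "complex_of_nat (card (of_length (q * m))) = complex_of_real y"
      by (simp_all flip: card_x card_y)
    with two_length_sum[OF m q lengths lin v, where ks = "k a" and kl = "k b" and h = h]
    show ?thesis by (simp only: P card_x card_y of_real_mult)
  qed
  also have "\<dots> = ((k a)\<^sup>2 * complex_of_real (s * x * (x / r - 2))
     + (k b)\<^sup>2 * complex_of_real (q * s * y * (y / r - 2))
     + 2 * k a * k b * complex_of_real ((if q = 2 then 1 else 2 / 3) * s * x * y / r)) / 64"
  proof -
    have h: "h 4 + h 1 / 3 * z = z / 32" for z by (simp add: h_def)
    have kq: "kappa q * h q = (if q = 2 then 1 else 2 / 3) / 32" using q by (auto simp: kappa_def h_def)
    show ?thesis unfolding h kq ms by (simp add: field_simps)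
  qed
  finally show ?thesis by (simp add: r_def)
qed


section \<open>The irreducible types\<close>

text \<open>\<open>A\<close> may be any convenient formula agreeing with the Cartan entries on the
  index range, and connectedness is reduced to reaching one index \<open>i0\<close> of short
  length.\<close>

lemma cartan_dataI:
  fixes A :: "nat \<Rightarrow> nat \<Rightarrow> int"
  assumes "type_rank X = r" and "\<And>i j. i \<in> {1..r} \<Longrightarrow> j \<in> {1..r} \<Longrightarrow> cartan_entry X i j = A i j"
    and "q \<in> {2, 3}" and "\<And>i. i \<in> {1..r} \<Longrightarrow> t i = 1 \<or> t i = q" and "i0 \<in> {1..r}" "t i0 = 1"
    and "\<And>i j. i \<in> {1..r} \<Longrightarrow> j \<in> {1..r} \<Longrightarrow> real_of_int (A i j) * t j = real_of_int (A j i) * t i"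
    and "\<And>i. i \<in> {1..r} \<Longrightarrow> (\<Sum>j=1..r. cs j * real_of_int (A j i)) = (if t i = 1 then 1 else 0)"
    and "\<And>i. i \<in> {1..r} \<Longrightarrow> (\<Sum>j=1..r. cl j * real_of_int (A j i)) = (if t i = q then 1 else 0)"
    and "x \<ge> 0" "12 * (\<Sum>j=1..r. if t j = 1 then cs j else 0) = x * (1 + x / r)"
    and "y \<ge> 0" "12 * (\<Sum>j=1..r. if t j = q then cl j else 0) = y * (1 + y / r)"
    and conn: "\<And>(g :: nat \<Rightarrow> real) i. (\<And>i j. i \<in> {1..r} \<Longrightarrow> j \<in> {1..r} \<Longrightarrow> A i j \<noteq> 0 \<Longrightarrow> g i = g j) \<Longrightarrow>
      i \<in> {1..r} \<Longrightarrow> g i = g i0"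
    and conn_length: "\<And>(g :: nat \<Rightarrow> complex) i j.
      (\<And>i j. i \<in> {1..r} \<Longrightarrow> j \<in> {1..r} \<Longrightarrow> A i j = -1 \<Longrightarrow> A j i = -1 \<Longrightarrow> g i = g j) \<Longrightarrow>
      i \<in> {1..r} \<Longrightarrow> j \<in> {1..r} \<Longrightarrow> t i = t j \<Longrightarrow> g i = g j"
  shows "cartan_data X q t cs cl x y"
proof -
  have A: "real_of_int (cartan_entry X i j) = real_of_int (A i j)" if "i \<in> {1..r}" "j \<in> {1..r}" for i j
    using assms(2)[OF that] by simp
  have sums: "(\<Sum>j=1..r. c j * real_of_int (cartan_entry X j i)) = (\<Sum>j=1..r. c j * real_of_int (A j i))"
    if "i \<in> {1..r}" for c i
    using that by (intro sum.cong refl) (simp add: A)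
  show ?thesis
    unfolding cartan_data_def Let_def assms(1)
  proof (intro conjI ballI allI impI)
    show "q \<in> {2, 3}" by fact
    show "t i = 1 \<or> t i = q" if "i \<in> {1..r}" for i by (rule assms(4)[OF that])
    show "\<exists>i\<in>{1..r}. t i = 1" using assms(5,6) by blast
    show "real_of_int (cartan_entry X i j) * t j = real_of_int (cartan_entry X j i) * t i"
      if "i \<in> {1..r}" "j \<in> {1..r}" for i j
      unfolding A[OF that] A[OF that(2,1)] by (rule assms(7)[OF that])
    show "(\<Sum>j=1..r. cs j * real_of_int (cartan_entry X j i)) = (if t i = 1 then 1 else 0)"
      "(\<Sum>j=1..r. cl j * real_of_int (cartan_entry X j i)) = (if t i = q then 1 else 0)"
      if "i \<in> {1..r}" for i
      unfolding sums[OF that] by (rule assms(8)[OF that], rule assms(9)[OF that])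
    show "x \<ge> 0" "y \<ge> 0" "12 * (\<Sum>j=1..r. if t j = 1 then cs j else 0) = x * (1 + x / r)"
      "12 * (\<Sum>j=1..r. if t j = q then cl j else 0) = y * (1 + y / r)" by fact+
  next
    fix g :: "nat \<Rightarrow> real" and i j
    assume g: "\<forall>i\<in>{1..r}. \<forall>j\<in>{1..r}. real_of_int (cartan_entry X i j) \<noteq> 0 \<longrightarrow> g i = g j"
      and ij: "i \<in> {1..r}" "j \<in> {1..r}"
    have eq: "g i = g j" if "i \<in> {1..r}" "j \<in> {1..r}" "A i j \<noteq> 0" for i j
      using g[rule_format, OF that(1,2)] A[OF that(1,2)] that(3) by simp
    have "g i = g i0" if "i \<in> {1..r}" for i
      by (rule conn[OF _ that]) (rule eq)
    from this[OF ij(1)] this[OF ij(2)] show "g i = g j" by simp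
  next
    fix g :: "nat \<Rightarrow> complex" and i j
    assume g: "\<forall>i\<in>{1..r}. \<forall>j\<in>{1..r}. real_of_int (cartan_entry X i j) = -1 \<and>
        real_of_int (cartan_entry X j i) = -1 \<longrightarrow> g i = g j"
      and ij: "i \<in> {1..r}" "j \<in> {1..r}" "t i = t j"
    have eq: "g i = g j" if "i \<in> {1..r}" "j \<in> {1..r}" "A i j = -1" "A j i = -1" for i j
      using g[rule_format, OF that(1,2)] A[OF that(1,2)] A[OF that(2,1)] that(3,4) by simp
    show "g i = g j" by (rule conn_length[OF _ ij]) (rule eq)
  qed
qed

section \<open>The classical types\<close>

definition path_entry :: "nat \<Rightarrow> nat \<Rightarrow> int" where
  "path_entry i j = (if i = j then 2 else if Suc i = j \<or> Suc j = i then -1 else 0)"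

lemma simply_laced_entry_path:
  assumes "i \<in> {1..n}" "j \<in> {1..n}"
  shows "simply_laced_entry (path_edges n) i j = path_entry i j"
  using assms by (auto simp: simply_laced_entry_def path_edges_def path_entry_def)

text \<open>A negative second difference. The condition \<open>c 0 = 0\<close> absorbs the left end
  of the path; the right end stays explicit.\<close>

lemma path_sum:
  fixes c :: "nat \<Rightarrow> real"
  assumes i: "i \<in> {1..n}" and c: "c 0 = 0"
  shows "(\<Sum>j=1..n. c j * path_entry j i) = 2 * c i - c (i - 1) - (if i < n then c (Suc i) else 0)"
proof -
  have "(\<Sum>j=1..n. c j * path_entry j i) =
      (\<Sum>j=1..n. (if j = i then 2 * c i else 0) - (if j = i - 1 then c (i - 1) else 0)
        - (if j = Suc i then c (Suc i) else 0))"
    using i by (intro sum.cong refl) (auto simp: path_entry_def)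
  also have "\<dots> = 2 * c i - (if i - 1 \<in> {1..n} then c (i - 1) else 0) - (if Suc i \<in> {1..n} then c (Suc i) else 0)"
    using i unfolding sum_subtractf by (simp add: sum.delta)
  also have "\<dots> = 2 * c i - c (i - 1) - (if i < n then c (Suc i) else 0)"
  proof -
    have "i - 1 \<in> {1..n} \<or> i - 1 = 0" using i by auto
    then show ?thesis using c by auto
  qed
  finally show ?thesis .
qed

text \<open>Replacing one entry in column m by -2, as at the double bond of types B and C, changes
  only that column.\<close>

lemma modified_sum:
  fixes c :: "nat \<Rightarrow> real"
  assumes "p \<in> {1..n}"
  shows "(\<Sum>j=1..n. c j * real_of_int (if j = p \<and> i = m then -2 else path_entry j i)) =
    (\<Sum>j=1..n. c j * path_entry j i) - (if i = m then c p * (2 + path_entry p m) else 0)"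
proof -
  have "(\<Sum>j=1..n. c j * real_of_int (if j = p \<and> i = m then -2 else path_entry j i)) =
    (\<Sum>j=1..n. c j * path_entry j i - (if j = p then (if i = m then c p * (2 + path_entry p m) else 0) else 0))"
    by (intro sum.cong refl) (auto simp: algebra_simps)
  then show ?thesis using assms unfolding sum_subtractf by (simp add: sum.delta)
qed

lemma chain_constant:
  assumes "\<And>i. 1 \<le> i \<Longrightarrow> i < n \<Longrightarrow> g i = g (Suc i)" and "i \<in> {1..n}" "j \<in> {1..n}"
  shows "g i = g j"
proof -
  have "g i = g 1" if "1 \<le> i" "i \<le> n" for i
    using that
  proof (induction i rule: dec_induct)
    case (step i)
    then show ?case using assms(1)[of i] by simp
  qed simp
  from this[of i] this[of j] show ?thesis using assms(2,3) by simp
qed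

lemma sum_quadratic:
  "(\<Sum>j=1..m. a * real j - real j * (real j + 1) / 2) = a * m * (m + 1) / 2 - m * (real m + 1) * (m + 2) / 6"
  by (induction m) (simp_all add: field_simps)

text \<open>The coordinates of half the sum of the positive roots are j (n + 1 - j) / 2, written
  here in the shape that \<open>sum_quadratic\<close> sums. The next value, at j = n + 1, is 0 too,
  so the right end of the path needs no correction.\<close>

lemma cartan_data_A:
  assumes "n \<ge> 1"
  shows "cartan_data (Type_A n) 2 (\<lambda>_. 1) (\<lambda>j. (real n + 2) / 2 * real j - real j * (real j + 1) / 2) (\<lambda>_. 0)
    (real n * (real n + 1)) 0"
proof (rule cartan_dataI[where r = n and A = path_entry and ?i0.0 = 1])
  let ?c = "\<lambda>j. (real n + 2) / 2 * real j - real j * (real j + 1) / 2"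
  show "cartan_entry (Type_A n) i j = path_entry i j" if "i \<in> {1..n}" "j \<in> {1..n}" for i j
    using simply_laced_entry_path[OF that] by simp
  show "(\<Sum>j=1..n. ?c j * path_entry j i) = (if (1::real) = 1 then 1 else 0)" if i: "i \<in> {1..n}" for i
  proof -
    obtain k where k: "i = Suc k" using i by (cases i) auto
    show ?thesis
      using i by (subst path_sum[OF i]) (auto simp: k field_simps)
  qed
  show "12 * (\<Sum>j=1..n. if (1::real) = 1 then ?c j else 0) = real n * (real n + 1) * (1 + real n * (real n + 1) / real n)"
    using assms by (simp only: simp_thms if_True sum_quadratic) (simp add: field_simps)
  show "g i = g 1" if g: "\<And>i j. i \<in> {1..n} \<Longrightarrow> j \<in> {1..n} \<Longrightarrow> path_entry i j \<noteq> 0 \<Longrightarrow> g i = g j" and i: "i \<in> {1..n}"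
    for g :: "nat \<Rightarrow> real" and i
    by (rule chain_constant[of n g, OF g i]) (use assms in \<open>auto simp: path_entry_def\<close>)
  show "g i = g j" if g: "\<And>i j. i \<in> {1..n} \<Longrightarrow> j \<in> {1..n} \<Longrightarrow> path_entry i j = -1 \<Longrightarrow> path_entry j i = -1 \<Longrightarrow> g i = g j"
    and i: "i \<in> {1..n}" "j \<in> {1..n}" for g :: "nat \<Rightarrow> complex" and i j
    by (rule chain_constant[of n g, OF g i]) (use assms in \<open>auto simp: path_entry_def\<close>)
qed (use assms in \<open>auto simp: path_entry_def\<close>)


text \<open>In the usual coordinates the short positive roots are the e_i, with half sum (e_1 + ...
  + e_n) / 2, and the long ones e_i - e_j and e_i + e_j for i < j, with half sum of the (n - i) e_i.
  The coordinate at \<open>\<alpha> j\<close> is the sum of the first j coefficients.\<close>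

lemma cartan_data_B:
  assumes "n \<ge> 2"
  shows "cartan_data (Type_B n) 2 (\<lambda>i. if i = n then 1 else 2) (\<lambda>j. real j / 2)
    (\<lambda>j. real n * real j - real j * (real j + 1) / 2) (2 * n) (2 * real n * (real n - 1))"
proof -
  obtain m where m: "n = Suc m" "m \<ge> 1" using assms by (cases n) auto
  define A where "A i j = (if i = m \<and> j = n then -2 else path_entry i j)" for i j
  have mn: "m \<in> {1..n}" and e: "2 + path_entry m n = 1" using m by (auto simp: path_entry_def)
  note sum_A = modified_sum[OF mn, where m = n, folded A_def, unfolded e]
  show ?thesis
  proof (rule cartan_dataI[where r = n and A = A and ?i0.0 = n])
    show "cartan_entry (Type_B n) i j = A i j" if "i \<in> {1..n}" "j \<in> {1..n}" for i j
      using simply_laced_entry_path[OF that] m by (simp add: A_def)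
    show "(\<Sum>j=1..n. real j / 2 * A j i) = (if (if i = n then 1 else 2 :: real) = 1 then 1 else 0)"
      "(\<Sum>j=1..n. (real n * real j - real j * (real j + 1) / 2) * A j i) = (if (if i = n then 1 else 2 :: real) = 2 then 1 else 0)"
      if i: "i \<in> {1..n}" for i
    proof -
      obtain k where k: "i = Suc k" using i by (cases i) auto
      show "(\<Sum>j=1..n. real j / 2 * A j i) = (if (if i = n then 1 else 2 :: real) = 1 then 1 else 0)"
        unfolding sum_A by (subst path_sum[OF i]) (use i in \<open>auto simp: k m field_simps\<close>)
      show "(\<Sum>j=1..n. (real n * real j - real j * (real j + 1) / 2) * A j i) = (if (if i = n then 1 else 2 :: real) = 2 then 1 else 0)"
        unfolding sum_A by (subst path_sum[OF i]) (use i in \<open>auto simp: k m field_simps\<close>)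
    qed
    have "(\<Sum>j=1..n. if (if j = n then 1 else 2 :: real) = 1 then real j / 2 else 0) = (\<Sum>j=1..n. if j = n then real n / 2 else 0)"
      by (intro sum.cong refl) auto
    also have "\<dots> = real n / 2" using assms by (simp add: sum.delta)
    finally show "12 * (\<Sum>j=1..n. if (if j = n then 1 else 2 :: real) = 1 then real j / 2 else 0) = real (2 * n) * (1 + real (2 * n) / n)"
      using assms by simp
    have "(\<Sum>j=1..n. if (if j = n then 1 else 2 :: real) = 2 then real n * real j - real j * (real j + 1) / 2 else 0)
        = (\<Sum>j=1..m. real n * real j - real j * (real j + 1) / 2)"
      unfolding m(1) by (subst sum.cl_ivl_Suc) (auto intro!: sum.cong)
    then show "12 * (\<Sum>j=1..n. if (if j = n then 1 else 2 :: real) = 2 then real n * real j - real j * (real j + 1) / 2 else 0)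
        = 2 * real n * (real n - 1) * (1 + 2 * real n * (real n - 1) / real n)"
      by (simp only: sum_quadratic) (simp add: m field_simps)
    show "g i = g n" if g: "\<And>i j. i \<in> {1..n} \<Longrightarrow> j \<in> {1..n} \<Longrightarrow> A i j \<noteq> 0 \<Longrightarrow> g i = g j" and i: "i \<in> {1..n}"
      for g :: "nat \<Rightarrow> real" and i
      by (rule chain_constant[of n g, OF g i]) (use assms in \<open>auto simp: A_def path_entry_def\<close>)
    show "g i = g j" if g: "\<And>i j. i \<in> {1..n} \<Longrightarrow> j \<in> {1..n} \<Longrightarrow> A i j = -1 \<Longrightarrow> A j i = -1 \<Longrightarrow> g i = g j"
      and i: "i \<in> {1..n}" "j \<in> {1..n}" and t: "(if i = n then 1 else 2 :: real) = (if j = n then 1 else 2)"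
      for g :: "nat \<Rightarrow> complex" and i j
    proof (cases "i = n \<or> j = n")
      case True
      then show ?thesis using t by (auto split: if_splits)
    next
      case False
      then have ij: "i \<in> {1..m}" "j \<in> {1..m}" using i m by auto
      show ?thesis by (rule chain_constant[of m g, OF g ij]) (use m in \<open>auto simp: A_def path_entry_def\<close>)
    qed
    show "real_of_int (A i j) * (if j = n then 1 else 2) = real_of_int (A j i) * (if i = n then 1 else 2)"
      if "i \<in> {1..n}" "j \<in> {1..n}" for i j
      using that m by (auto simp: A_def path_entry_def)
  qed (use assms in auto)
qed

text \<open>As for type B, with the half sum of the (n - i) e_i now belonging to the short roots and
  e_1 + ... + e_n to the long roots 2 e_i. The last simple root is 2 e_n, which halves the last
  coordinate.\<close>

lemma cartan_data_C:
  assumes "n \<ge> 2"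
  shows "cartan_data (Type_C n) 2 (\<lambda>i. if i = n then 2 else 1)
    (\<lambda>j. if j = n then real n * (real n - 1) / 4 else real n * real j - real j * (real j + 1) / 2)
    (\<lambda>j. if j = n then real n / 2 else real j) (2 * real n * (real n - 1)) (2 * n)"
proof -
  obtain m where m: "n = Suc m" "m \<ge> 1" using assms by (cases n) auto
  define A where "A i j = (if i = n \<and> j = m then -2 else path_entry i j)" for i j
  have mn: "n \<in> {1..n}" and e: "2 + path_entry n m = 1" using m by (auto simp: path_entry_def)
  note sum_A = modified_sum[OF mn, where m = m, folded A_def, unfolded e]
  let ?c = "\<lambda>j. if j = n then real n * (real n - 1) / 4 else real n * real j - real j * (real j + 1) / 2"
  let ?d = "\<lambda>j. if j = n then real n / 2 else real j"
  show ?thesis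
  proof (rule cartan_dataI[where r = n and A = A and ?i0.0 = 1])
    show "cartan_entry (Type_C n) i j = A i j" if "i \<in> {1..n}" "j \<in> {1..n}" for i j
      using simply_laced_entry_path[OF that] m by (simp add: A_def)
    show "(\<Sum>j=1..n. ?c j * A j i) = (if (if i = n then 2 else 1 :: real) = 1 then 1 else 0)"
      "(\<Sum>j=1..n. ?d j * A j i) = (if (if i = n then 2 else 1 :: real) = 2 then 1 else 0)"
      if i: "i \<in> {1..n}" for i
    proof -
      obtain k where k: "i = Suc k" using i by (cases i) auto
      show "(\<Sum>j=1..n. ?c j * A j i) = (if (if i = n then 2 else 1 :: real) = 1 then 1 else 0)"
        unfolding sum_A by (subst path_sum[OF i]) (use i m in \<open>auto simp: k field_simps\<close>)
      show "(\<Sum>j=1..n. ?d j * A j i) = (if (if i = n then 2 else 1 :: real) = 2 then 1 else 0)"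
        unfolding sum_A by (subst path_sum[OF i]) (use i m in \<open>auto simp: k field_simps\<close>)
    qed
    have "(\<Sum>j=1..n. if (if j = n then 2 else 1 :: real) = 2 then ?d j else 0) = (\<Sum>j=1..n. if j = n then real n / 2 else 0)"
      by (intro sum.cong refl) auto
    also have "\<dots> = real n / 2" using assms by (simp add: sum.delta)
    finally show "12 * (\<Sum>j=1..n. if (if j = n then 2 else 1 :: real) = 2 then ?d j else 0) = real (2 * n) * (1 + real (2 * n) / n)"
      using assms by simp
    have "(\<Sum>j=1..n. if (if j = n then 2 else 1 :: real) = 1 then ?c j else 0)
        = (\<Sum>j=1..m. real n * real j - real j * (real j + 1) / 2)"
      unfolding m(1) by (subst sum.cl_ivl_Suc) (auto intro!: sum.cong)
    then show "12 * (\<Sum>j=1..n. if (if j = n then 2 else 1 :: real) = 1 then ?c j else 0)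
        = 2 * real n * (real n - 1) * (1 + 2 * real n * (real n - 1) / real n)"
      by (simp only: sum_quadratic) (simp add: m field_simps)
    show "g i = g 1" if g: "\<And>i j. i \<in> {1..n} \<Longrightarrow> j \<in> {1..n} \<Longrightarrow> A i j \<noteq> 0 \<Longrightarrow> g i = g j" and i: "i \<in> {1..n}"
      for g :: "nat \<Rightarrow> real" and i
      by (rule chain_constant[of n g, OF g i]) (use assms in \<open>auto simp: A_def path_entry_def\<close>)
    show "g i = g j" if g: "\<And>i j. i \<in> {1..n} \<Longrightarrow> j \<in> {1..n} \<Longrightarrow> A i j = -1 \<Longrightarrow> A j i = -1 \<Longrightarrow> g i = g j"
      and i: "i \<in> {1..n}" "j \<in> {1..n}" and t: "(if i = n then 2 else 1 :: real) = (if j = n then 2 else 1)"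
      for g :: "nat \<Rightarrow> complex" and i j
    proof (cases "i = n \<or> j = n")
      case True
      then show ?thesis using t by (auto split: if_splits)
    next
      case False
      then have ij: "i \<in> {1..m}" "j \<in> {1..m}" using i m by auto
      show ?thesis by (rule chain_constant[of m g, OF g ij]) (use m in \<open>auto simp: A_def path_entry_def\<close>)
    qed
    show "real_of_int (A i j) * (if j = n then 2 else 1) = real_of_int (A j i) * (if i = n then 2 else 1)"
      if "i \<in> {1..n}" "j \<in> {1..n}" for i j
      using that m by (auto simp: A_def path_entry_def)
  qed (use assms in auto)
qed

text \<open>The half sum is again that of the (n - i) e_i. Its coefficient at e_n is 0, so the two
  end nodes, e_(n-1) - e_n and e_(n-1) + e_n, share the partial sum n (n - 1) / 2 equally.\<close>

lemma cartan_data_D: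
  assumes "n \<ge> 3"
  shows "cartan_data (Type_D n) 2 (\<lambda>_. 1)
    (\<lambda>j. if j + 2 \<le> n then real n * real j - real j * (real j + 1) / 2 else real n * (real n - 1) / 4) (\<lambda>_. 0)
    (2 * real n * (real n - 1)) 0"
proof -
  obtain l where n: "n = Suc (Suc (Suc l))"
    using assms by (metis add_2_eq_Suc' le_Suc_ex numeral_3_eq_3 add_Suc plus_nat.add_0 add_Suc_right)
  let ?m = "Suc (Suc l)"
  define A where "A i j = (if i \<le> ?m \<and> j \<le> ?m then path_entry i j else if i = j then 2
    else if i = n \<and> j = Suc l \<or> j = n \<and> i = Suc l then -1 else 0)" for i j
  let ?c = "\<lambda>j. if j + 2 \<le> n then real n * real j - real j * (real j + 1) / 2 else real n * (real n - 1) / 4"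
  show ?thesis
  proof (rule cartan_dataI[where r = n and A = A and ?i0.0 = 1])
    show "cartan_entry (Type_D n) i j = A i j" if "i \<in> {1..n}" "j \<in> {1..n}" for i j
      using that by (auto simp: A_def n path_entry_def simply_laced_entry_def path_edges_def)
    show "(\<Sum>j=1..n. ?c j * A j i) = (if (1::real) = 1 then 1 else 0)" if i: "i \<in> {1..n}" for i
    proof (cases "i = n")
      case True
      have "(\<Sum>j=1..?m. ?c j * A j i) = (\<Sum>j=1..?m. if j = Suc l then - ?c (Suc l) else 0)"
        by (intro sum.cong refl) (auto simp: A_def n True)
      also have "\<dots> = - ?c (Suc l)" by (simp add: sum.delta)
      finally have "(\<Sum>j=1..?m. ?c j * A j i) = - ?c (Suc l)" .
      then have "(\<Sum>j=1..n. ?c j * A j i) = - ?c (Suc l) + ?c n * A n i"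
        unfolding n by (subst sum.cl_ivl_Suc) simp
      then show ?thesis by (simp add: True A_def) (simp add: n field_simps)
    next
      case False
      then have im: "i \<in> {1..?m}" using i by (simp add: n)
      then obtain k where k: "i = Suc k" by (cases i) auto
      have "(\<Sum>j=1..?m. ?c j * A j i) = (\<Sum>j=1..?m. ?c j * path_entry j i)"
        using im by (intro sum.cong refl) (auto simp: A_def)
      also have "\<dots> = 2 * ?c i - ?c (i - 1) - (if i < ?m then ?c (Suc i) else 0)"
        by (rule path_sum[OF im]) (simp add: n)
      finally have "(\<Sum>j=1..?m. ?c j * A j i) = 2 * ?c i - ?c (i - 1) - (if i < ?m then ?c (Suc i) else 0)" .
      then have "(\<Sum>j=1..n. ?c j * A j i) =
          2 * ?c i - ?c (i - 1) - (if i < ?m then ?c (Suc i) else 0) + ?c n * A n i"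
        unfolding n by (subst sum.cl_ivl_Suc) simp
      also have "A n i = (if i = Suc l then -1 else 0)" using im by (auto simp: A_def n)
      also have "2 * ?c i - ?c (i - 1) - (if i < ?m then ?c (Suc i) else 0)
          + ?c n * real_of_int (if i = Suc l then -1 else 0) = 1"
      proof -
        \<comment> \<open>Node i lies before the branch node n - 2 = Suc l, is that node, or is the
          end node n - 1 of the path.\<close>
        consider "k < l" | "k = l" | "k = Suc l" using im k by fastforce
        then show ?thesis by cases (auto simp: k n field_simps)
      qed
      finally show ?thesis by simp
    qed
    have "(\<Sum>j=1..n. if (1::real) = 1 then ?c j else 0) = (\<Sum>j=1..Suc l. ?c j) + ?c ?m + ?c n"
      unfolding n by (simp add: sum.cl_ivl_Suc)
    also have "(\<Sum>j=1..Suc l. ?c j) = (\<Sum>j=1..Suc l. real n * real j - real j * (real j + 1) / 2)"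
      by (intro sum.cong refl) (auto simp: n)
    finally show "12 * (\<Sum>j=1..n. if (1::real) = 1 then ?c j else 0)
        = 2 * real n * (real n - 1) * (1 + 2 * real n * (real n - 1) / real n)"
      by (simp only: sum_quadratic) (simp add: n field_simps)
    show "g i = g 1" if g: "\<And>i j. i \<in> {1..n} \<Longrightarrow> j \<in> {1..n} \<Longrightarrow> A i j \<noteq> 0 \<Longrightarrow> g i = g j" and i: "i \<in> {1..n}"
      for g :: "nat \<Rightarrow> real" and i
    proof -
      have chain: "g i = g 1" if "i \<in> {1..?m}" for i
        by (rule chain_constant[of ?m g, OF g that]) (auto simp: n A_def path_entry_def)
      have "g n = g (Suc l)" by (rule g) (auto simp: n A_def)
      then show ?thesis using i chain[of i] chain[of "Suc l"] by (cases "i = n") (auto simp: n)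
    qed
    show "g i = g j" if g: "\<And>i j. i \<in> {1..n} \<Longrightarrow> j \<in> {1..n} \<Longrightarrow> A i j = -1 \<Longrightarrow> A j i = -1 \<Longrightarrow> g i = g j"
      and i: "i \<in> {1..n}" "j \<in> {1..n}" for g :: "nat \<Rightarrow> complex" and i j
    proof -
      have chain: "g i = g 1" if "i \<in> {1..?m}" for i
        by (rule chain_constant[of ?m g, OF g that]) (auto simp: n A_def path_entry_def)
      have "g n = g (Suc l)" by (rule g) (auto simp: n A_def)
      then have "g i = g 1" if "i \<in> {1..n}" for i
        using that chain[of i] chain[of "Suc l"] by (cases "i = n") (auto simp: n)
      from this[OF i(1)] this[OF i(2)] show ?thesis by simp
    qed
  qed (use assms in \<open>auto simp: A_def path_entry_def\<close>)
qed


section \<open>The exceptional types and the final evaluation\<close>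

lemma E8_edges_connected:
  assumes g: "\<And>i j. i \<in> {1..r} \<Longrightarrow> j \<in> {1..r} \<Longrightarrow> (i, j) \<in> E8_edges \<Longrightarrow> g i = g j"
    and r: "4 \<le> r" "r \<le> 8" and i: "i \<in> {1..r}"
  shows "g i = g 1"
proof -
  have "g 1 = g 3" "g 3 = g 4" "g 2 = g 4" "r \<ge> 5 \<Longrightarrow> g 4 = g 5" "r \<ge> 6 \<Longrightarrow> g 5 = g 6"
    "r \<ge> 7 \<Longrightarrow> g 6 = g 7" "r \<ge> 8 \<Longrightarrow> g 7 = g 8"
    using r by (auto intro!: g simp: E8_edges_def)
  moreover have "i = 1 \<or> i = 2 \<or> i = 3 \<or> i = 4 \<or> i = 5 \<and> r \<ge> 5 \<or> i = 6 \<and> r \<ge> 6 \<or> i = 7 \<and> r \<ge> 7 \<or> i = 8 \<and> r \<ge> 8"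
    using i r by auto
  ultimately show ?thesis using r by auto
qed

text \<open>The E8 diagram restricted to its first r nodes gives E6, E7 and E8 alike; only the
  coordinates and the number of roots vary.\<close>

lemma cartan_data_E:
  assumes X: "type_rank X = r" "\<And>i j. cartan_entry X i j = simply_laced_entry E8_edges i j" and r: "4 \<le> r" "r \<le> 8"
    and sum: "\<And>i. i \<in> {1..r} \<Longrightarrow> (\<Sum>j=1..r. c j * real_of_int (simply_laced_entry E8_edges j i)) = 1"
    and x: "x \<ge> 0" "12 * (\<Sum>j=1..r. c j) = x * (1 + x / r)"
  shows "cartan_data X 2 (\<lambda>_. 1) c (\<lambda>_. 0) x 0"
proof (rule cartan_dataI[where A = "simply_laced_entry E8_edges" and ?i0.0 = 1, OF X])
  have edge: "simply_laced_entry E8_edges i j = -1" "simply_laced_entry E8_edges j i = -1" if "(i, j) \<in> E8_edges" for i j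
    using that by (auto simp: simply_laced_entry_def E8_edges_def)
  show "g i = g 1" if g: "\<And>i j. i \<in> {1..r} \<Longrightarrow> j \<in> {1..r} \<Longrightarrow> simply_laced_entry E8_edges i j \<noteq> 0 \<Longrightarrow> g i = g j"
    and i: "i \<in> {1..r}" for g :: "nat \<Rightarrow> real" and i
  proof (rule E8_edges_connected[OF _ r i])
    fix i j assume ij: "i \<in> {1..r}" "j \<in> {1..r}" "(i, j) \<in> E8_edges"
    show "g i = g j" by (rule g[OF ij(1,2)]) (simp add: edge[OF ij(3)])
  qed
  show "g i = g j" if g: "\<And>i j. i \<in> {1..r} \<Longrightarrow> j \<in> {1..r} \<Longrightarrow> simply_laced_entry E8_edges i j = -1 \<Longrightarrow>
      simply_laced_entry E8_edges j i = -1 \<Longrightarrow> g i = g j"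
    and i: "i \<in> {1..r}" "j \<in> {1..r}" for g :: "nat \<Rightarrow> complex" and i j
  proof -
    have "g i = g 1" if "i \<in> {1..r}" for i
    proof (rule E8_edges_connected[OF _ r that])
      fix i j assume ij: "i \<in> {1..r}" "j \<in> {1..r}" "(i, j) \<in> E8_edges"
      show "g i = g j" by (rule g[OF ij(1,2) edge[OF ij(3)]])
    qed
    from this[OF i(1)] this[OF i(2)] show ?thesis by simp
  qed
  show "real_of_int (simply_laced_entry E8_edges i j) * 1 = real_of_int (simply_laced_entry E8_edges j i) * 1" for i j
    by (auto simp: simply_laced_entry_def)
qed (use r sum x in auto)

lemma atLeast1_atMost_numeral:
  "{1..2::nat} = {1, 2}" "{1..4::nat} = {1, 2, 3, 4}" "{1..6::nat} = {1, 2, 3, 4, 5, 6}"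
  "{1..7::nat} = {1, 2, 3, 4, 5, 6, 7}" "{1..8::nat} = {1, 2, 3, 4, 5, 6, 7, 8}"
  by auto

text \<open>The list holds half the coefficients 16, 22, 30, 42, 30, 16 of the sum of the positive
  roots; the leading 0 pads it, simple roots being numbered from 1.\<close>

lemma cartan_data_E6:
  "cartan_data Type_E6 2 (\<lambda>_. 1) (\<lambda>j. [0, 8, 11, 15, 21, 15, 8] ! j) (\<lambda>_. 0) 72 0"
proof (rule cartan_data_E[where r = 6])
  show "(\<Sum>j=1..6. [0, 8, 11, 15, 21, 15, 8] ! j * real_of_int (simply_laced_entry E8_edges j i)) = 1" if "i \<in> {1..6}" for i
    using that unfolding atLeast1_atMost_numeral by (elim insertE emptyE) (simp_all add: simply_laced_entry_def E8_edges_def)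
  show "12 * (\<Sum>j=1..6. [0, 8, 11, 15, 21, 15, 8] ! j) = 72 * (1 + 72 / real 6)"
    unfolding atLeast1_atMost_numeral by simp
qed simp_all

lemma cartan_data_E7:
  "cartan_data Type_E7 2 (\<lambda>_. 1) (\<lambda>j. [0, 17, 49/2, 33, 48, 75/2, 26, 27/2] ! j) (\<lambda>_. 0) 126 0"
proof (rule cartan_data_E[where r = 7])
  show "(\<Sum>j=1..7. [0, 17, 49/2, 33, 48, 75/2, 26, 27/2] ! j * real_of_int (simply_laced_entry E8_edges j i)) = 1" if "i \<in> {1..7}" for i
    using that unfolding atLeast1_atMost_numeral by (elim insertE emptyE) (simp_all add: simply_laced_entry_def E8_edges_def)
  show "12 * (\<Sum>j=1..7. [0, 17, 49/2, 33, 48, 75/2, 26, 27/2] ! j) = 126 * (1 + 126 / real 7)"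
    unfolding atLeast1_atMost_numeral by simp
qed simp_all

lemma cartan_data_E8:
  "cartan_data Type_E8 2 (\<lambda>_. 1) (\<lambda>j. [0, 46, 68, 91, 135, 110, 84, 57, 29] ! j) (\<lambda>_. 0) 240 0"
proof (rule cartan_data_E[where r = 8])
  show "(\<Sum>j=1..8. [0, 46, 68, 91, 135, 110, 84, 57, 29] ! j * real_of_int (simply_laced_entry E8_edges j i)) = 1" if "i \<in> {1..8}" for i
    using that unfolding atLeast1_atMost_numeral by (elim insertE emptyE) (simp_all add: simply_laced_entry_def E8_edges_def)
  show "12 * (\<Sum>j=1..8. [0, 46, 68, 91, 135, 110, 84, 57, 29] ! j) = 240 * (1 + 240 / real 8)"
    unfolding atLeast1_atMost_numeral by simp
qed simp_all

text \<open>Simple roots 1 and 2 are long. The two lists add up to half of 16, 30, 42, 22, the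
  coefficients of the sum of all positive roots.\<close>

lemma cartan_data_F4:
  "cartan_data Type_F4 2 (\<lambda>i. if i \<le> 2 then 2 else 1) (\<lambda>j. [0, 3, 6, 9, 5] ! j) (\<lambda>j. [0, 5, 9, 12, 6] ! j) 24 24"
proof (rule cartan_dataI[where r = 4 and A = "\<lambda>i j. if i = 2 \<and> j = 3 then -2 else path_entry i j" and ?i0.0 = 3])
  let ?A = "\<lambda>i j. if i = 2 \<and> j = 3 then -2 else path_entry i j"
  show "cartan_entry Type_F4 i j = ?A i j" if "i \<in> {1..4}" "j \<in> {1..4}" for i j
    using simply_laced_entry_path[OF that] by simp
  show "real_of_int (?A i j) * (if j \<le> 2 then 2 else 1) = real_of_int (?A j i) * (if i \<le> 2 then 2 else 1)"
    if "i \<in> {1..4}" "j \<in> {1..4}" for i j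
    using that unfolding atLeast1_atMost_numeral by (elim insertE emptyE) (simp_all add: path_entry_def)
  show "(\<Sum>j=1..4. [0, 3, 6, 9, 5] ! j * real_of_int (?A j i)) = (if (if i \<le> 2 then 2 else 1 :: real) = 1 then 1 else 0)"
    "(\<Sum>j=1..4. [0, 5, 9, 12, 6] ! j * real_of_int (?A j i)) = (if (if i \<le> 2 then 2 else 1 :: real) = 2 then 1 else 0)"
    if "i \<in> {1..4}" for i
    using that unfolding atLeast1_atMost_numeral by (elim insertE emptyE; simp add: path_entry_def)+
  show "12 * (\<Sum>j=1..4. if (if j \<le> 2 then 2 else 1 :: real) = 1 then [0, 3, 6, 9, 5] ! j else 0) = 24 * (1 + 24 / real 4)"
    "12 * (\<Sum>j=1..4. if (if j \<le> 2 then 2 else 1 :: real) = 2 then [0, 5, 9, 12, 6] ! j else 0) = 24 * (1 + 24 / real 4)"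
    unfolding atLeast1_atMost_numeral by simp_all
  show "g i = g 3" if g: "\<And>i j. i \<in> {1..4} \<Longrightarrow> j \<in> {1..4} \<Longrightarrow> ?A i j \<noteq> 0 \<Longrightarrow> g i = g j" and i: "i \<in> {1..4}"
    for g :: "nat \<Rightarrow> real" and i
    by (rule chain_constant[of 4 g, OF g i]) (auto simp: path_entry_def)
  show "g i = g j" if g: "\<And>i j. i \<in> {1..4} \<Longrightarrow> j \<in> {1..4} \<Longrightarrow> ?A i j = -1 \<Longrightarrow> ?A j i = -1 \<Longrightarrow> g i = g j"
    and i: "i \<in> {1..4}" "j \<in> {1..4}" and t: "(if i \<le> 2 then 2 else 1 :: real) = (if j \<le> 2 then 2 else 1)"
    for g :: "nat \<Rightarrow> complex" and i j
  proof -
    have "g 1 = g 2" "g 3 = g 4" by (rule g; simp add: path_entry_def)+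
    then show ?thesis using i t unfolding atLeast1_atMost_numeral by auto
  qed
qed auto

text \<open>The short positive roots are (1, 0), (1, 1), (2, 1) and the long ones (0, 1), (3, 1),
  (3, 2) in the simple roots; the lists are their half sums.\<close>

lemma cartan_data_G2:
  "cartan_data Type_G2 3 (\<lambda>i. if i = 1 then 1 else 3) (\<lambda>j. [0, 2, 1] ! j) (\<lambda>j. [0, 3, 2] ! j) 6 6"
proof (rule cartan_dataI[where r = 2 and A = "\<lambda>i j. if i = 2 \<and> j = 1 then -3 else path_entry i j" and ?i0.0 = 1])
  let ?A = "\<lambda>i j. if i = 2 \<and> j = 1 then -3 else path_entry i j"
  show "cartan_entry Type_G2 i j = ?A i j" if "i \<in> {1..2}" "j \<in> {1..2}" for i j
    using simply_laced_entry_path[OF that] by simp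
  show "real_of_int (?A i j) * (if j = 1 then 1 else 3) = real_of_int (?A j i) * (if i = 1 then 1 else 3)"
    if "i \<in> {1..2}" "j \<in> {1..2}" for i j
    using that unfolding atLeast1_atMost_numeral by (elim insertE emptyE) (simp_all add: path_entry_def)
  show "(\<Sum>j=1..2. [0, 2, 1] ! j * real_of_int (?A j i)) = (if (if i = 1 then 1 else 3 :: real) = 1 then 1 else 0)"
    "(\<Sum>j=1..2. [0, 3, 2] ! j * real_of_int (?A j i)) = (if (if i = 1 then 1 else 3 :: real) = 3 then 1 else 0)"
    if "i \<in> {1..2}" for i
    using that unfolding atLeast1_atMost_numeral by (elim insertE emptyE; simp add: path_entry_def)+
  show "12 * (\<Sum>j=1..2. if (if j = 1 then 1 else 3 :: real) = 1 then [0, 2, 1] ! j else 0) = 6 * (1 + 6 / real 2)"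
    "12 * (\<Sum>j=1..2. if (if j = 1 then 1 else 3 :: real) = 3 then [0, 3, 2] ! j else 0) = 6 * (1 + 6 / real 2)"
    unfolding atLeast1_atMost_numeral by simp_all
  show "g i = g 1" if g: "\<And>i j. i \<in> {1..2} \<Longrightarrow> j \<in> {1..2} \<Longrightarrow> ?A i j \<noteq> 0 \<Longrightarrow> g i = g j" and i: "i \<in> {1..2}"
    for g :: "nat \<Rightarrow> real" and i
    by (rule chain_constant[of 2 g, OF g i]) (auto simp: path_entry_def)
  show "g i = g j" if i: "i \<in> {1..2}" "j \<in> {1..2}" and t: "(if i = 1 then 1 else 3 :: real) = (if j = 1 then 1 else 3)"
    for g :: "nat \<Rightarrow> complex" and i j
    using i t unfolding atLeast1_atMost_numeral by auto
qed auto


text \<open>\<open>u\<close>, the number of roots over the rank, is the Coxeter number. The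
  normalization speaks of the shortest and the longest roots; as both have squared length 2, all
  roots do.\<close>

lemma degree0_simply_laced:
  fixes \<Phi> P :: "(real^'n::finite) set" and k :: "real^'n \<Rightarrow> complex" and u :: real
  assumes roots: "root_system \<Phi> co" and "has_type \<Phi> co X" "positive_system \<Phi> P" "invariant_form \<Phi> co B"
    and norm: "bourbaki_normalized X \<Phi> B" and "invariant_parameter \<Phi> co k"
    and "cartan_data X 2 t cs cl x 0" and X: "bourbaki_lengths X = (2, 2)" and a: "a \<in> \<Phi>"
    and r: "type_rank X > 0" and x: "x = u * type_rank X"
  shows "degree0 (nu'_Omega P co B k) = (k a)\<^sup>2 * complex_of_real (x * (u - 2) / 32)"
proof -
  let ?L = "(\<lambda>a. dual_form B a a) ` \<Phi>"
  have fin: "finite ?L" "?L \<noteq> {}" using roots a by (auto simp: root_system_def)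
  obtain b where b: "b \<in> \<Phi>" "dual_form B b b = Min ?L" using Min_in[OF fin] by auto
  obtain c where c: "c \<in> \<Phi>" "dual_form B c c = Max ?L" using Max_in[OF fin] by auto
  have "b \<in> short_roots \<Phi> B" "c \<in> long_roots \<Phi> B"
    using b c fin by (auto simp: short_roots_def long_roots_def)
  then have "Min ?L = 2" "Max ?L = 2" using norm b c X by (auto simp: bourbaki_normalized_def)
  then have two: "dual_form B d d = 2" if "d \<in> \<Phi>" for d
    using Min_le[OF fin(1), of "dual_form B d d"] Max_ge[OF fin(1), of "dual_form B d d"] that by force
  then have "a \<in> short_roots \<Phi> B" using a by (simp add: short_roots_def)
  \<comment> \<open>\<open>undefined\<close> takes the place of a long root, whose terms carry the
    factor y = 0.\<close>
  from degree0_cartan_data[OF assms(1-4,6,7) this _ two[OF a], of undefined]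
  show ?thesis using r by (simp add: x)
qed

text \<open>\<open>u\<close> and \<open>v\<close> are the numbers of short and of long roots per
  unit of rank, supplied by the caller so that no division by the rank is left to simplify.\<close>

lemma degree0_two_lengths:
  fixes \<Phi> P :: "(real^'n::finite) set" and k :: "real^'n \<Rightarrow> complex" and u v :: real
  assumes "root_system \<Phi> co" "has_type \<Phi> co X" "positive_system \<Phi> P" "invariant_form \<Phi> co B"
    and norm: "bourbaki_normalized X \<Phi> B" and "invariant_parameter \<Phi> co k"
    and "cartan_data X q t cs cl x y" and a: "a \<in> short_roots \<Phi> B" and "b \<in> long_roots \<Phi> B"
    and r: "type_rank X > 0" and x: "x = u * type_rank X" and y: "y = v * type_rank X"
  defines "s \<equiv> fst (bourbaki_lengths X)"
  shows "degree0 (nu'_Omega P co B k) =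
    ((k a)\<^sup>2 * complex_of_real (s * x * (u - 2)) + (k b)\<^sup>2 * complex_of_real (q * s * y * (v - 2))
     + 2 * k a * k b * complex_of_real ((if q = 2 then 1 else 2 / 3) * s * x * v)) / 64"
proof -
  have "dual_form B a a = s" using norm a by (simp add: bourbaki_normalized_def s_def)
  from degree0_cartan_data[OF assms(1-4,6-8) _ this, of b]
  have "degree0 (nu'_Omega P co B k) =
    ((k a)\<^sup>2 * complex_of_real (s * x * (x / type_rank X - 2))
     + (k b)\<^sup>2 * complex_of_real (q * s * y * (y / type_rank X - 2))
     + 2 * k a * k b * complex_of_real ((if q = 2 then 1 else 2 / 3) * s * x * y / type_rank X)) / 64"
    using assms(9) by blast
  moreover have "x / type_rank X = u" "y / type_rank X = v" using r by (simp_all add: x y)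
  ultimately show ?thesis by (simp only: times_divide_eq_right[symmetric])
qed

theorem corollary4p15:
  fixes \<Phi> P :: "(real^'n::finite) set"
    and co :: "real^'n \<Rightarrow> real^'n"
    and B :: "real^'n \<Rightarrow> real^'n \<Rightarrow> real"
    and k :: "real^'n \<Rightarrow> complex"
    and X :: cartan_type
  assumes "root_system \<Phi> co"
    and "has_type \<Phi> co X"
    and "positive_system \<Phi> P"
    and "invariant_form \<Phi> co B"
    and "bourbaki_normalized X \<Phi> B"
    and "invariant_parameter \<Phi> co k"
  shows "let z = degree0 (nu'_Omega P co B k) in
    (\<forall>n\<ge>1. X = Type_A n \<longrightarrow> (\<forall>a\<in>\<Phi>.
       z = (k a)\<^sup>2 / 32 * (of_nat n + 1) * of_nat n * (of_nat n - 1))) \<and>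
    (\<forall>n\<ge>2. X = Type_B n \<longrightarrow> (\<forall>s\<in>short_roots \<Phi> B. \<forall>l\<in>long_roots \<Phi> B.
       z = 1 / 8 * k l * of_nat n * (of_nat n - 1) * ((of_nat n - 2) * k l + k s))) \<and>
    (\<forall>n\<ge>2. X = Type_C n \<longrightarrow> (\<forall>s\<in>short_roots \<Phi> B. \<forall>l\<in>long_roots \<Phi> B.
       z = 1 / 8 * k s * of_nat n * (of_nat n - 1) * ((of_nat n - 2) * k s + 2 * k l))) \<and>
    (\<forall>n\<ge>3. X = Type_D n \<longrightarrow> (\<forall>a\<in>\<Phi>.
       z = (k a)\<^sup>2 / 8 * of_nat n * (of_nat n - 1) * (of_nat n - 2))) \<and>
    (X = Type_E6 \<longrightarrow> (\<forall>a\<in>\<Phi>. z = 45 / 2 * (k a)\<^sup>2)) \<and>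
    (X = Type_E7 \<longrightarrow> (\<forall>a\<in>\<Phi>. z = 63 * (k a)\<^sup>2)) \<and>
    (X = Type_E8 \<longrightarrow> (\<forall>a\<in>\<Phi>. z = 210 * (k a)\<^sup>2)) \<and>
    (X = Type_F4 \<longrightarrow> (\<forall>s\<in>short_roots \<Phi> B. \<forall>l\<in>long_roots \<Phi> B.
       z = 3 / 2 * (k s + 2 * k l) * (k s + k l))) \<and>
    (X = Type_G2 \<longrightarrow> (\<forall>s\<in>short_roots \<Phi> B. \<forall>l\<in>long_roots \<Phi> B.
       z = 3 / 16 * (k s + 3 * k l) * (k s + k l)))"
proof -
  note simply_laced = degree0_simply_laced[OF assms(1) _ assms(3,4) _ assms(6)]
  note two_lengths = degree0_two_lengths[OF assms(1) _ assms(3,4) _ assms(6)]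
  show ?thesis
    unfolding Let_def
  proof (intro conjI allI impI ballI)
    fix n a assume n: "n \<ge> 1" and X: "X = Type_A n" and a: "a \<in> \<Phi>"
    show "degree0 (nu'_Omega P co B k) = (k a)\<^sup>2 / 32 * (of_nat n + 1) * of_nat n * (of_nat n - 1)"
      by (subst simply_laced[OF assms(2,5)[unfolded X] cartan_data_A[OF n] _ a, of "real n + 1"])
        (use n in \<open>simp_all add: field_simps\<close>)
  next
    fix n s l assume n: "n \<ge> 2" and X: "X = Type_B n"
      and sl: "s \<in> short_roots \<Phi> B" "l \<in> long_roots \<Phi> B"
    show "degree0 (nu'_Omega P co B k) =
        1 / 8 * k l * of_nat n * (of_nat n - 1) * ((of_nat n - 2) * k l + k s)"
      by (subst two_lengths[OF assms(2,5)[unfolded X] cartan_data_B[OF n] sl, of 2 "2 * (real n - 1)"])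
        (use n in \<open>simp_all add: field_simps power2_eq_square\<close>)
  next
    fix n s l assume n: "n \<ge> 2" and X: "X = Type_C n"
      and sl: "s \<in> short_roots \<Phi> B" "l \<in> long_roots \<Phi> B"
    show "degree0 (nu'_Omega P co B k) =
        1 / 8 * k s * of_nat n * (of_nat n - 1) * ((of_nat n - 2) * k s + 2 * k l)"
      by (subst two_lengths[OF assms(2,5)[unfolded X] cartan_data_C[OF n] sl, of "2 * (real n - 1)" 2])
        (use n in \<open>simp_all add: field_simps power2_eq_square\<close>)
  next
    fix n a assume n: "n \<ge> 3" and X: "X = Type_D n" and a: "a \<in> \<Phi>"
    show "degree0 (nu'_Omega P co B k) = (k a)\<^sup>2 / 8 * of_nat n * (of_nat n - 1) * (of_nat n - 2)"
      by (subst simply_laced[OF assms(2,5)[unfolded X] cartan_data_D[OF n] _ a, of "2 * (real n - 1)"])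
        (use n in \<open>simp_all add: field_simps\<close>)
  next
    fix a assume "X = Type_E6" "a \<in> \<Phi>"
    then show "degree0 (nu'_Omega P co B k) = 45 / 2 * (k a)\<^sup>2"
      using simply_laced[OF _ _ cartan_data_E6, of a 12] assms(2,5) by simp
  next
    fix a assume "X = Type_E7" "a \<in> \<Phi>"
    then show "degree0 (nu'_Omega P co B k) = 63 * (k a)\<^sup>2"
      using simply_laced[OF _ _ cartan_data_E7, of a 18] assms(2,5) by simp
  next
    fix a assume "X = Type_E8" "a \<in> \<Phi>"
    then show "degree0 (nu'_Omega P co B k) = 210 * (k a)\<^sup>2"
      using simply_laced[OF _ _ cartan_data_E8, of a 30] assms(2,5) by simp
  next
    fix s l assume X: "X = Type_F4" and sl: "s \<in> short_roots \<Phi> B" "l \<in> long_roots \<Phi> B"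
    show "degree0 (nu'_Omega P co B k) = 3 / 2 * (k s + 2 * k l) * (k s + k l)"
      by (subst two_lengths[OF assms(2,5)[unfolded X] cartan_data_F4 sl, of 6 6])
        (simp_all add: field_simps power2_eq_square)
  next
    fix s l assume X: "X = Type_G2" and sl: "s \<in> short_roots \<Phi> B" "l \<in> long_roots \<Phi> B"
    show "degree0 (nu'_Omega P co B k) = 3 / 16 * (k s + 3 * k l) * (k s + k l)"
      by (subst two_lengths[OF assms(2,5)[unfolded X] cartan_data_G2 sl, of 3 3])
        (simp_all add: field_simps power2_eq_square)
  qed
qed

end
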